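(* Let $R$ be a set. The map $\pi\mapsto\sum_{\nabla}\tau(\pi,\nabla)$ (sum over all triangulations $\nabla$ of the $R$-deco polygon $\pi$, with $\tau(\pi,\nabla)$ the dual oriented $R$-deco tree) induces a map of differential graded algebras $\mathcal P_\bullet(R)\to\mathcal T_\bullet(R)$, as well as $\overline{\mathcal P}_\bullet(R)\to\mathcal T_\bullet(R)$. Here $\mathcal P_\bullet(R)$ is the polygon algebra with the differential $\partial$, $\overline{\mathcal P}_\bullet(R)$ is the same algebra with the differential $\overline\partial$, and $\mathcal T_\bullet(R)$ is the $R$-deco tree algebra with the edge-contraction differential $d$.
   Context: **Polygons.** An $R$-deco polygon is an oriented convex polygon with $N\ge2$ sides decorated by elements of $R$, with a distinguished root side. The orientation gives a linear order of the sides with the root side last; write $[a_1,\dots,a_{n+1}]$ for the $(n+1)$-gon with decorations $a_1,\dots,a_{n+1}$ in this order ($a_{n+1}$ on the root). Its weight $\chi$ is the number $n$ of non-root sides. Denote by $v_0$ the vertex between root side and first side (the first vertex) and by $v_k$ the vertex between the $k$-th and $(k+1)$-st side. $V^{pg}_n(R)$, $n\ge1$, is the $\mathbb Q$-vector space with basis the $R$-deco $(n+1)$-gons; the polygon algebra is the exterior algebra (with unit) on $\bigoplus_{n\ge1}V^{pg}_n(R)$, bigraded by weight and exterior degree. An arrow goes from a vertex $v_k$ to the interior of a side $a_l$; it is trivial if $v_k$ is an endpoint of that side, forward if $l>k$, backward otherwise. A non-trivial arrow $\alpha$ dissects $\pi=[a_1,\dots,a_{n+1}]$ into a root polygon $\pi_\alpha^{rt}$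 (containing the first vertex and part of the root side) and a cut-off polygon, after contracting $\alpha$. Explicitly: if $\alpha:v_k\to a_l$ is forward, $\pi_\alpha^{rt}=[a_1,\dots,a_k,a_l,\dots,a_{n+1}]$, and the cut-off polygon is $\pi_\alpha^{co}=\overline\pi_\alpha^{co}=[a_{k+1},\dots,a_{l-1},a_l]$. If $\alpha:v_k\to a_l$ is backward ($l<k$), $\pi_\alpha^{rt}=[a_1,\dots,a_l,a_{k+1},\dots,a_{n+1}]$, while $\pi_\alpha^{co}=[a_k,a_{k-1},\dots,a_{l+1},a_l]$ (opposite orientation) and $\overline\pi_\alpha^{co}=[a_{l+1},\dots,a_k,a_l]$ (inherited orientation). Put $\varepsilon_\alpha=1$ for forward and $-1$ for backward arrows, and $\mathrm{sgn}(\alpha)=\varepsilon_\alpha^{\chi(\pi_\alpha^{co})}$. Then $$\partial\pi=\sum_\alpha\mathrm{sgn}(\alpha)\,\pi_\alpha^{rt}\wedge\pi_\alpha^{co},\qquad \overline\partial\pi=\sum_\alpha\varepsilon_\alpha\,\pi_\alpha^{rt}\wedge\overline\pi_\alpha^{co},$$ sums over non-trivial arrows, extended by the Leibniz rule $\partial(a\wedge b)=\partial a\wedge b+(-1)^{\deg a}a\wedge\partial b$ (and likewise for $\overline\partial$) with $\deg$ the exterior degree. **Trees.** A plane tree is a finite tree with internal vertices of valency $\ge3$ and a cyclic order of the incident edges at each vertex; other vertices (valency 1) are external. It is planted if one external vertex is distinguished as the root; the others are leaves. An $R$-deco tree is a planted plane tree with external vertices decorated by $R$. An orientation is an ordering of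 edges up to even permutations, $e_1\wedge\dots\wedge e_n$. The canonical orientation of a planted plane tree lists edges in the order they are first met when walking around the tree starting at the root edge and following the cyclic orders. $\mathcal T_\bullet(R)$ is the $\mathbb Q$-span of pairs $(\phi,\omega)$, $\phi$ a disjoint union of $R$-deco trees and $\omega$ an orientation of $\phi$, modulo $(\phi,-\omega)=-(\phi,\omega)$, with product $(\phi_1\sqcup\phi_2,\omega_1\wedge\omega_2)$, unit the empty forest, graded by the number of edges. The differential on a tree is $d(\tau,\omega)=\sum_e(\tau/e,i_e\omega)$, where $i_e(e\wedge s_2\wedge\dots\wedge s_n)=s_2\wedge\dots\wedge s_n$, extended by the Leibniz rule with sign $(-1)^{\#\text{edges}}$. Here $\tau/e$ is as follows: for internal $e$, contract $e$; for external $e$ (and at least two edges) contract $e$ to a vertex $w$ with the decoration of the external end of $e$ and split into the disjoint union of the trees $\tau_i\cup w$, $\tau_i$ the connected components of the complement of $w$, with $w$ serving as root for all pieces not containing the original root (for all pieces, if $e$ is the root edge), planarity inherited; a one-edge tree has $d=0$. **Duality.** For a triangulation $\nabla$ (by diagonals) of an $R$-deco polygon $\pi=[a_1,\dots,a_{n+1}]$, the dual tree $\tau(\pi,\nabla)$ is the trivalent planted plane tree whose internal vertices are the triangles, whose internal edges are the diagonals and external edges the sides of $\pi$, with leaves decorated in order by $a_1,\dots,a_n$ and root by $a_{n+1}$, with cyclic orders induced by the orientation of $\pi$ and with its canonical orientation (a 2-gon gives the one-edge tree). The map is extended to products of polygons multiplicatively.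
   Formalization: For the differential ∂ (no bar) the target is the quotient of the tree algebra in which trees differing only in their cyclic orders are identified; with plane trees the claim fails, e.g. for [a1,a2,a3,a4]. The claim for the barred differential is proved for plane trees as stated. *)

theory Defs
  imports Complex_Main "HOL-Library.Poly_Mapping" "HOL-Library.Multiset" "HOL-Library.Nat_Bijection"
begin

section \<open>Free vector spaces and differential graded algebras over the rationals\<close>

text \<open>
  The free rational vector space on a type \<open>'b\<close> is \<^typ>\<open>'b \<Rightarrow>\<^sub>0 rat\<close>. If \<open>'b\<close> is a monoid, written
  additively, the multiplication of \<^typ>\<open>'b \<Rightarrow>\<^sub>0 rat\<close> is that of the monoid algebra.
\<close>

definition smul :: "rat \<Rightarrow> ('b::monoid_add \<Rightarrow>\<^sub>0 rat) \<Rightarrow> 'b \<Rightarrow>\<^sub>0 rat" where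
  "smul c x = Poly_Mapping.single 0 c * x"

definition linext :: "('b \<Rightarrow> ('c::monoid_add \<Rightarrow>\<^sub>0 rat)) \<Rightarrow> ('b \<Rightarrow>\<^sub>0 rat) \<Rightarrow> 'c \<Rightarrow>\<^sub>0 rat" where
  "linext f x = (\<Sum>b\<in>Poly_Mapping.keys x. smul (Poly_Mapping.lookup x b) (f b))"

lemma smul_single: "smul c (Poly_Mapping.single b a) = Poly_Mapping.single b (c * a)"
  by (simp add: smul_def mult_single)

lemma smul_add_right: "smul c (x + y) = smul c x + smul c y"
  and smul_add_left: "smul (a + b) x = smul a x + smul b x"
  and smul_0_right [simp]: "smul c 0 = 0"
  and smul_0_left [simp]: "smul 0 x = 0"
  and smul_1_left [simp]: "smul 1 x = x"
  and smul_smul: "smul a (smul b x) = smul (a * b) x"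
  and smul_mult_left: "smul c x * y = smul c (x * y)"
  by (simp_all add: smul_def algebra_simps single_add mult_single flip: mult.assoc)

lemma smul_m1 [simp]: "smul (- 1) x = - x"
  using smul_add_left[of "-1" 1 x] by (simp add: eq_neg_iff_add_eq_0)

lemma smul_minus: "smul c (x - y) = smul c x - smul c y"
  by (simp add: smul_def algebra_simps)

lemma smul_sum: "smul c (sum f A) = (\<Sum>a\<in>A. smul c (f a))"
  by (simp add: smul_def sum_distrib_left)

lemma lookup_smul: "Poly_Mapping.lookup (smul c x) k = c * Poly_Mapping.lookup x k"
proof (induction x rule: Poly_Mapping.update_induct)
  case const
  then show ?case by simp
next
  case (update f a b)
  have "Poly_Mapping.update a b f = f + Poly_Mapping.single a b"
    by (rule poly_mapping_eqI)
      (use update in \<open>auto simp: lookup_update lookup_add lookup_single when_def in_keys_iff\<close>)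
  then show ?case
    using update by (simp add: smul_add_right smul_single lookup_add lookup_single when_def algebra_simps)
qed

lemma single_scalar_central: "Poly_Mapping.single 0 c * x = x * Poly_Mapping.single (0::'b::monoid_add) (c::rat)"
proof (induction x rule: Poly_Mapping.update_induct)
  case const
  then show ?case by simp
next
  case (update f a b)
  have "Poly_Mapping.update a b f = f + Poly_Mapping.single a b"
    by (rule poly_mapping_eqI)
      (use update in \<open>auto simp: lookup_update lookup_add lookup_single when_def in_keys_iff\<close>)
  then show ?case
    using update by (simp add: algebra_simps mult_single)
qed

lemma smul_mult_right: "x * smul c y = smul c (x * y)"
  unfolding smul_def by (metis mult.assoc single_scalar_central)

lemma linext_superset:
  assumes "finite A" "Poly_Mapping.keys x \<subseteq> A"
  shows "linext f x = (\<Sum>b\<in>A. smul (Poly_Mapping.lookup x b) (f b))"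
  unfolding linext_def
  by (rule sum.mono_neutral_left) (use assms in \<open>auto simp: in_keys_iff\<close>)

lemma linext_add: "linext f (x + y) = linext f x + linext f y"
proof -
  let ?A = "Poly_Mapping.keys x \<union> Poly_Mapping.keys y"
  have "linext f (x + y) = (\<Sum>b\<in>?A. smul (Poly_Mapping.lookup (x + y) b) (f b))"
    by (rule linext_superset) (simp_all add: keys_add)
  also have "\<dots> = linext f x + linext f y"
    by (simp add: linext_superset[of ?A] lookup_add smul_add_left sum.distrib)
  finally show ?thesis .
qed

lemma linext_single [simp]: "linext f (Poly_Mapping.single b c) = smul c (f b)"
  by (simp add: linext_def)

lemma linext_0 [simp]: "linext f 0 = 0"
  by (simp add: linext_def)

lemma linext_uminus: "linext f (- x) = - linext f x"
  using linext_add[of f x "- x"] by (simp add: eq_neg_iff_add_eq_0 add.commute)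

lemma linext_diff: "linext f (x - y) = linext f x - linext f y"
  using linext_add[of f x "- y"] by (simp add: linext_uminus)

lemma linext_smul: "linext f (smul c x) = smul c (linext f x)"
proof -
  have "linext f (smul c x) = (\<Sum>b\<in>Poly_Mapping.keys x. smul (Poly_Mapping.lookup (smul c x) b) (f b))"
    by (rule linext_superset) (auto simp: in_keys_iff lookup_smul)
  then show ?thesis
    by (simp add: lookup_smul linext_def smul_sum smul_smul)
qed

lemma free_induct [case_names zero add single]:
  assumes "P 0" "\<And>x y. P x \<Longrightarrow> P y \<Longrightarrow> P (x + y)" "\<And>b c. P (Poly_Mapping.single b (c::rat))"
  shows "P x"
proof (induction x rule: Poly_Mapping.update_induct)
  case const
  then show ?case by (rule assms(1))
next
  case (update f a b)
  have "Poly_Mapping.update a b f = f + Poly_Mapping.single a b"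
    by (rule poly_mapping_eqI)
      (use update in \<open>auto simp: lookup_update lookup_add lookup_single when_def in_keys_iff\<close>)
  then show ?case
    using update assms by simp
qed

locale two_sided_ideal =
  fixes I :: "('b::monoid_add \<Rightarrow>\<^sub>0 rat) set"
  assumes zero: "0 \<in> I"
    and add: "x \<in> I \<Longrightarrow> y \<in> I \<Longrightarrow> x + y \<in> I"
    and lmult: "x \<in> I \<Longrightarrow> y * x \<in> I"
    and rmult: "x \<in> I \<Longrightarrow> x * y \<in> I"
begin

lemma smul: "x \<in> I \<Longrightarrow> smul c x \<in> I"
  unfolding smul_def by (rule lmult)

lemma uminus: "x \<in> I \<Longrightarrow> - x \<in> I"
  using lmult[of x "- 1"] by simp

lemma diff: "x \<in> I \<Longrightarrow> y \<in> I \<Longrightarrow> x - y \<in> I"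
  using add[of x "- y"] uminus[of y] by simp

lemma sum: "(\<And>a. a \<in> A \<Longrightarrow> f a \<in> I) \<Longrightarrow> sum f A \<in> I"
  by (induction A rule: infinite_finite_induct) (auto intro: zero add)

lemma equivp: "equivp (\<lambda>x y. x - y \<in> I)"
proof (rule equivpI)
  show "reflp (\<lambda>x y. x - y \<in> I)"
    by (rule reflpI) (simp add: zero)
  show "symp (\<lambda>x y. x - y \<in> I)"
  proof (rule sympI)
    fix x y assume "x - y \<in> I"
    from uminus[OF this] show "y - x \<in> I" by simp
  qed
  show "transp (\<lambda>x y. x - y \<in> I)"
  proof (rule transpI)
    fix x y z assume "x - y \<in> I" "y - z \<in> I"
    from add[OF this] show "x - z \<in> I" by simp
  qed
qed

lemma cong_add: "x - x' \<in> I \<Longrightarrow> y - y' \<in> I \<Longrightarrow> (x + y) - (x' + y') \<in> I"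
  using add[of "x - x'" "y - y'"] by (simp add: algebra_simps)

lemma cong_uminus: "x - x' \<in> I \<Longrightarrow> (- x) - (- x') \<in> I"
  using uminus[of "x - x'"] by (simp add: algebra_simps)

lemma cong_diff: "x - x' \<in> I \<Longrightarrow> y - y' \<in> I \<Longrightarrow> (x - y) - (x' - y') \<in> I"
  using diff[of "x - x'" "y - y'"] by (simp add: algebra_simps)

lemma cong_mult:
  assumes "x - x' \<in> I" "y - y' \<in> I"
  shows "x * y - x' * y' \<in> I"
proof -
  have "x * y - x' * y' = (x - x') * y + x' * (y - y')"
    by (simp add: algebra_simps)
  then show ?thesis
    using assms by (auto intro: add lmult rmult)
qed

lemma cong_smul: "x - x' \<in> I \<Longrightarrow> smul c x - smul c x' \<in> I"
  using smul[of "x - x'" c] by (simp add: smul_minus)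

end

text \<open>
  A differential graded algebra is presented by its scalar multiplication, its homogeneous
  subspaces and its differential, which lowers the degree by one.
\<close>

record 'a dga =
  scalar :: "rat \<Rightarrow> 'a \<Rightarrow> 'a"
  piece :: "nat \<Rightarrow> 'a set"
  diff :: "'a \<Rightarrow> 'a"

definition alg_hom :: "'a::ring_1 dga \<Rightarrow> 'b::ring_1 dga \<Rightarrow> ('a \<Rightarrow> 'b) \<Rightarrow> bool" where
  "alg_hom A B f \<longleftrightarrow>
     Vector_Spaces.linear (scalar A) (scalar B) f \<and> f 1 = 1 \<and> (\<forall>x y. f (x * y) = f x * f y)"

definition dga_hom :: "'a::ring_1 dga \<Rightarrow> 'b::ring_1 dga \<Rightarrow> ('a \<Rightarrow> 'b) \<Rightarrow> bool" where
  "dga_hom A B f \<longleftrightarrow>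
     alg_hom A B f \<and> (\<forall>m. f ` piece A m \<subseteq> piece B m) \<and> (\<forall>x. f (diff A x) = diff B (f x))"


section \<open>Polygons\<close>

text \<open>The list consists of the decorations \<open>a\<^sub>1, \<dots>, a\<^sub>n\<^sub>+\<^sub>1\<close>, the one of the root side being last.\<close>

typedef 'r polygon = "{as :: 'r list. 2 \<le> length as}"
  morphisms sides Polygon
  by (rule exI[of _ "[undefined, undefined]"]) simp

definition weight :: "'r polygon \<Rightarrow> nat" where
  "weight \<pi> = length (sides \<pi>) - 1"

text \<open>
  The tensor algebra of the vector space with basis the polygons is the monoid algebra of the free
  monoid on the polygons.
\<close>

datatype 'r word = Word (letters: "'r polygon list")

instantiation word :: (type) monoid_add
begin

definition zero_word :: "'a word" where "0 = Word []"

definition plus_word :: "'a word \<Rightarrow> 'a word \<Rightarrow> 'a word" where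
  "v + w = Word (letters v @ letters w)"

instance
  by standard (simp_all add: zero_word_def plus_word_def)

end

type_synonym 'r tensor_alg = "'r word \<Rightarrow>\<^sub>0 rat"

definition word :: "'r polygon list \<Rightarrow> 'r tensor_alg" where
  "word ps = Poly_Mapping.single (Word ps) 1"

definition polygon_space :: "'r tensor_alg set" where
  "polygon_space = {v. \<forall>w\<in>Poly_Mapping.keys v. \<exists>\<pi>. w = Word [\<pi>]}"

inductive_set exterior_ideal :: "'r tensor_alg set" where
  ext_square: "v \<in> polygon_space \<Longrightarrow> v * v \<in> exterior_ideal"
| ext_add: "x \<in> exterior_ideal \<Longrightarrow> y \<in> exterior_ideal \<Longrightarrow> x + y \<in> exterior_ideal"
| ext_lmult: "x \<in> exterior_ideal \<Longrightarrow> y * x \<in> exterior_ideal"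
| ext_rmult: "x \<in> exterior_ideal \<Longrightarrow> x * y \<in> exterior_ideal"

lemma zero_in_polygon_space: "0 \<in> polygon_space"
  by (simp add: polygon_space_def)

interpretation ext: two_sided_ideal exterior_ideal
proof
  show "0 \<in> exterior_ideal"
    using ext_square[OF zero_in_polygon_space] by simp
qed (auto intro: exterior_ideal.intros)

lemma word_append: "word (xs @ ys) = word xs * word ys"
  by (simp add: word_def mult_single plus_word_def)

lemma word_Nil: "word [] = 1"
  by (simp add: word_def flip: zero_word_def)

lemma single_Word: "Poly_Mapping.single (Word ps) c = smul c (word ps)"
  by (simp add: word_def smul_single)

lemma tensor_induct [case_names add smul word]:
  assumes "\<And>x y. P x \<Longrightarrow> P y \<Longrightarrow> P (x + y)" "\<And>c x. P x \<Longrightarrow> P (smul c x)" "\<And>ps. P (word ps)"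
  shows "P (x :: 'r tensor_alg)"
proof (induction x rule: free_induct)
  case zero
  show ?case using assms(2)[OF assms(3), of 0 "[]"] by simp
next
  case (add x y)
  then show ?case by (rule assms(1))
next
  case (single b c)
  then show ?case
    using assms by (cases b) (simp add: single_Word)
qed

lemma lookup_mult_0:
  "Poly_Mapping.lookup (x * y) 0 = Poly_Mapping.lookup x 0 * Poly_Mapping.lookup (y :: 'r tensor_alg) 0"
proof (induction x rule: tensor_induct)
  case (word ps)
  show ?case
    by (induction y rule: tensor_induct)
      (auto simp: algebra_simps lookup_add smul_mult_right lookup_smul simp flip: word_append,
       auto simp: word_def lookup_single when_def zero_word_def)
qed (auto simp: algebra_simps lookup_add smul_mult_left lookup_smul)

lemma lookup_exterior_ideal: "x \<in> exterior_ideal \<Longrightarrow> Poly_Mapping.lookup x 0 = 0"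
proof (induction rule: exterior_ideal.induct)
  case (ext_square v)
  then have "Poly_Mapping.lookup v 0 = 0"
    by (force simp: polygon_space_def zero_word_def in_keys_iff)
  then show ?case by (simp add: lookup_mult_0)
qed (simp_all add: lookup_mult_0 lookup_add)

text \<open>
  \<open>leibniz \<delta>\<close> is the extension of \<open>\<delta>\<close> to the tensor algebra by linearity and by the Leibniz rule
  \<open>\<partial>(a b) = \<partial>a b + (-1)\<^bsup>deg a\<^esup> a \<partial>b\<close>, where \<open>deg\<close> counts the polygons.
\<close>

primrec leibniz_word :: "('r polygon \<Rightarrow> 'r tensor_alg) \<Rightarrow> 'r polygon list \<Rightarrow> 'r tensor_alg" where
  "leibniz_word \<delta> [] = 0"
| "leibniz_word \<delta> (\<pi> # ps) = \<delta> \<pi> * word ps - word [\<pi>] * leibniz_word \<delta> ps"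

definition leibniz :: "('r polygon \<Rightarrow> 'r tensor_alg) \<Rightarrow> 'r tensor_alg \<Rightarrow> 'r tensor_alg" where
  "leibniz \<delta> = linext (\<lambda>w. leibniz_word \<delta> (letters w))"

definition parity :: "'r tensor_alg \<Rightarrow> 'r tensor_alg" where
  "parity = linext (\<lambda>w. smul ((- 1) ^ length (letters w)) (word (letters w)))"

lemma parity_word: "parity (word ps) = smul ((- 1) ^ length ps) (word ps)"
  by (simp add: parity_def word_def)

lemma parity_mult: "parity (x * y) = parity x * parity y"
proof (induction x rule: tensor_induct)
  case (word ps)
  show ?case
  proof (induction y rule: tensor_induct)
    case (word qs)
    show ?case
      by (simp add: parity_word smul_mult_left smul_mult_right smul_smul power_add mult.commute
          flip: word_append)
  qed (simp_all add: algebra_simps parity_def linext_add linext_smul smul_mult_right)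
qed (simp_all add: algebra_simps parity_def linext_add linext_smul smul_mult_left)

lemma leibniz_word_single: "leibniz \<delta> (word ps) = leibniz_word \<delta> ps"
  by (simp add: leibniz_def word_def)

lemma leibniz_word_append:
  "leibniz_word \<delta> (ps @ qs) = leibniz_word \<delta> ps * word qs + smul ((- 1) ^ length ps) (word ps * leibniz_word \<delta> qs)"
proof (induction ps)
  case Nil
  then show ?case by (simp add: word_Nil)
next
  case (Cons p ps)
  have "word (p # ps) = word [p] * word ps"
    using word_append[of "[p]" ps] by simp
  moreover have "smul (- c) x = - smul c x" for c :: rat and x :: "'a tensor_alg"
    using smul_smul[of "-1" c x] by simp
  ultimately show ?case
    using Cons by (simp add: word_append algebra_simps smul_mult_right)
qed

lemma leibniz_mult: "leibniz \<delta> (x * y) = leibniz \<delta> x * y + parity x * leibniz \<delta> y"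
proof (induction x rule: tensor_induct)
  case (word ps)
  show ?case
  proof (induction y rule: tensor_induct)
    case (word qs)
    show ?case
      by (simp add: parity_word leibniz_word_single leibniz_word_append smul_mult_left flip: word_append)
  qed (simp_all add: algebra_simps leibniz_def linext_add linext_smul smul_mult_right smul_add_right)
qed (simp_all add: algebra_simps parity_def leibniz_def linext_add linext_smul smul_mult_left smul_add_right)

lemma polygon_space_add:
  "v \<in> polygon_space \<Longrightarrow> w \<in> polygon_space \<Longrightarrow> v + w \<in> polygon_space"
  unfolding polygon_space_def using keys_add[of v w] by blast

lemma word_in_polygon_space: "word [\<pi>] \<in> polygon_space"
  by (simp add: polygon_space_def word_def)

lemma polygon_space_anticommute:
  assumes "v \<in> polygon_space" "w \<in> polygon_space"
  shows "v * w + w * v \<in> exterior_ideal"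
proof -
  have "v * w + w * v = (v + w) * (v + w) - v * v - w * w"
    by (simp add: algebra_simps)
  then show ?thesis
    using assms by (auto intro!: ext.diff ext_square polygon_space_add)
qed

lemma polygon_space_commute:
  assumes "v \<in> polygon_space"
  shows "word [a] * word [b] * v - v * (word [a] * word [b]) \<in> exterior_ideal"
proof -
  have "word [a] * word [b] * v - v * (word [a] * word [b]) =
      word [a] * (word [b] * v + v * word [b]) - (word [a] * v + v * word [a]) * word [b]"
    by (simp add: algebra_simps)
  moreover have "word [a] * (word [b] * v + v * word [b]) \<in> exterior_ideal"
    by (rule ext_lmult) (rule polygon_space_anticommute[OF word_in_polygon_space assms])
  moreover have "(word [a] * v + v * word [a]) * word [b] \<in> exterior_ideal"
    by (rule ext_rmult) (rule polygon_space_anticommute[OF word_in_polygon_space assms])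
  ultimately show ?thesis
    by (simp add: ext.diff)
qed

lemma polygon_space_sum:
  assumes "v \<in> polygon_space"
  shows "v = (\<Sum>w\<in>Poly_Mapping.keys v. smul (Poly_Mapping.lookup v w) (word (letters w)))"
proof -
  have "x = linext (\<lambda>w. word (letters w)) x" for x :: "'a tensor_alg"
    by (induction x rule: tensor_induct) (simp_all add: linext_add linext_smul, simp add: word_def)
  then show ?thesis by (simp add: linext_def)
qed

lemma parity_polygon_space:
  assumes "v \<in> polygon_space"
  shows "parity v = - v"
proof -
  have "parity v = (\<Sum>w\<in>Poly_Mapping.keys v. smul (Poly_Mapping.lookup v w) (- word (letters w)))"
    unfolding parity_def linext_def
    by (rule sum.cong) (use assms in \<open>auto simp: polygon_space_def\<close>)
  also have "\<dots> = - v"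
    by (subst (3) polygon_space_sum[OF assms])
      (simp add: sum_negf smul_def)
  finally show ?thesis .
qed

lemma parity_exterior_ideal: "x \<in> exterior_ideal \<Longrightarrow> parity x \<in> exterior_ideal"
proof (induction rule: exterior_ideal.induct)
  case (ext_add x y)
  then show ?case by (simp add: parity_def linext_add exterior_ideal.ext_add)
qed (auto simp: parity_mult parity_polygon_space intro: exterior_ideal.intros)

lemma leibniz_exterior_ideal:
  assumes \<delta>: "\<And>\<pi> v. v \<in> polygon_space \<Longrightarrow> \<delta> \<pi> * v - v * \<delta> \<pi> \<in> exterior_ideal"
    and "x \<in> exterior_ideal"
  shows "leibniz \<delta> x \<in> exterior_ideal"
  using assms(2)
proof (induction rule: exterior_ideal.induct)
  case (ext_square v)
  let ?f = "\<lambda>w. smul (Poly_Mapping.lookup v w) (leibniz_word \<delta> (letters w))"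
  let ?K = "Poly_Mapping.keys v"
  have *: "?f w * v - v * ?f w \<in> exterior_ideal" if w: "w \<in> ?K" for w
  proof -
    obtain \<pi> where "w = Word [\<pi>]"
      using ext_square w by (auto simp: polygon_space_def)
    then have "?f w * v - v * ?f w = smul (Poly_Mapping.lookup v w) (\<delta> \<pi> * v - v * \<delta> \<pi>)"
      by (simp add: smul_mult_left smul_mult_right smul_minus word_Nil)
    then show ?thesis
      using \<delta>[OF ext_square] by (simp add: ext.smul)
  qed
  have "leibniz \<delta> v * v - v * leibniz \<delta> v = (\<Sum>w\<in>?K. ?f w * v - v * ?f w)"
    by (simp add: leibniz_def linext_def sum_distrib_left sum_distrib_right sum_subtractf)
  also have "\<dots> \<in> exterior_ideal"
    by (rule ext.sum) (rule *)
  finally show ?case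
    by (simp add: leibniz_mult parity_polygon_space[OF ext_square])
next
  case (ext_add x y)
  then show ?case by (simp add: leibniz_def linext_add exterior_ideal.ext_add)
next
  case (ext_lmult x y)
  then show ?case
    by (simp add: leibniz_mult exterior_ideal.ext_add exterior_ideal.ext_lmult)
next
  case (ext_rmult x y)
  then show ?case
    by (simp add: leibniz_mult exterior_ideal.ext_add exterior_ideal.ext_rmult parity_exterior_ideal)
qed

quotient_type 'r polygon_alg = "'r tensor_alg" / "\<lambda>x y. x - y \<in> exterior_ideal"
  by (rule ext.equivp)

instantiation polygon_alg :: (type) ring_1
begin

lift_definition zero_polygon_alg :: "'a polygon_alg" is 0 .
lift_definition one_polygon_alg :: "'a polygon_alg" is 1 .
lift_definition plus_polygon_alg :: "'a polygon_alg \<Rightarrow> 'a polygon_alg \<Rightarrow> 'a polygon_alg"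
  is "(+)" by (rule ext.cong_add)
lift_definition minus_polygon_alg :: "'a polygon_alg \<Rightarrow> 'a polygon_alg \<Rightarrow> 'a polygon_alg"
  is "(-)" by (rule ext.cong_diff)
lift_definition uminus_polygon_alg :: "'a polygon_alg \<Rightarrow> 'a polygon_alg"
  is "uminus" by (rule ext.cong_uminus)
lift_definition times_polygon_alg :: "'a polygon_alg \<Rightarrow> 'a polygon_alg \<Rightarrow> 'a polygon_alg"
  is "(*)" by (rule ext.cong_mult)

instance
proof
  show "(0 :: 'a polygon_alg) \<noteq> 1"
    by transfer (use lookup_exterior_ideal[of "- 1"] in \<open>auto simp: lookup_one\<close>)
qed (transfer; simp add: algebra_simps ext.zero)+

end

lift_definition polygon_scale :: "rat \<Rightarrow> 'r polygon_alg \<Rightarrow> 'r polygon_alg" is smul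
  by (rule ext.cong_smul)

interpretation polygon_alg: vector_space polygon_scale
  by standard (transfer; simp add: smul_add_left smul_add_right smul_smul ext.zero)+

lift_definition polygon_gen :: "'r polygon \<Rightarrow> 'r polygon_alg" is "\<lambda>\<pi>. word [\<pi>]" .

text \<open>
  The homological degree of \<open>\<pi>\<^sub>1 \<and> \<dots> \<and> \<pi>\<^sub>r\<close> is twice its weight minus its exterior degree; this
  is the number of edges of a forest of trivalent trees dual to \<open>\<pi>\<^sub>1, \<dots>, \<pi>\<^sub>r\<close>.
\<close>

definition word_degree :: "'r word \<Rightarrow> nat" where
  "word_degree w = (\<Sum>\<pi>\<leftarrow>letters w. 2 * weight \<pi> - 1)"

definition polygon_piece :: "nat \<Rightarrow> 'r polygon_alg set" where
  "polygon_piece m = abs_polygon_alg ` {x. \<forall>w\<in>Poly_Mapping.keys x. word_degree w = m}"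


subsection \<open>The two differentials\<close>

text \<open>
  The pair \<open>(k, l)\<close> is the arrow from the vertex \<open>v\<^sub>k\<close> to the side \<open>a\<^sub>l\<close>, where \<open>0 \<le> k \<le> n\<close> and
  \<open>1 \<le> l \<le> n + 1\<close>. The side \<open>a\<^sub>l\<close> has the endpoints \<open>v\<^bsub>l-1\<^esub>\<close> and \<open>v\<^sub>l\<close>, with \<open>v\<^bsub>n+1\<^esub> = v\<^sub>0\<close>. As
  lists are indexed from 0, the decoration \<open>a\<^sub>l\<close> is \<open>sides \<pi> ! (l - 1)\<close>.
\<close>

definition arrows :: "'r polygon \<Rightarrow> (nat \<times> nat) set" where
  "arrows \<pi> = {(k, l). k \<le> weight \<pi> \<and> 1 \<le> l \<and> l \<le> weight \<pi> + 1 \<and>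
     l \<noteq> k \<and> l \<noteq> k + 1 \<and> \<not> (k = 0 \<and> l = weight \<pi> + 1)}"

definition forward :: "nat \<times> nat \<Rightarrow> bool" where
  "forward \<alpha> \<longleftrightarrow> fst \<alpha> < snd \<alpha>"

definition arrow_sign :: "nat \<times> nat \<Rightarrow> rat" where
  "arrow_sign \<alpha> = (if forward \<alpha> then 1 else - 1)"

definition root_polygon :: "'r polygon \<Rightarrow> nat \<times> nat \<Rightarrow> 'r polygon" where
  "root_polygon \<pi> \<alpha> = (case \<alpha> of (k, l) \<Rightarrow>
     Polygon (if forward \<alpha> then take k (sides \<pi>) @ drop (l - 1) (sides \<pi>)
              else take l (sides \<pi>) @ drop k (sides \<pi>)))"

definition cutoff_polygon :: "'r polygon \<Rightarrow> nat \<times> nat \<Rightarrow> 'r polygon" where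
  "cutoff_polygon \<pi> \<alpha> = (case \<alpha> of (k, l) \<Rightarrow>
     Polygon (if forward \<alpha> then drop k (take l (sides \<pi>))
              else rev (drop l (take k (sides \<pi>))) @ [sides \<pi> ! (l - 1)]))"

definition cutoff_polygon_bar :: "'r polygon \<Rightarrow> nat \<times> nat \<Rightarrow> 'r polygon" where
  "cutoff_polygon_bar \<pi> \<alpha> = (case \<alpha> of (k, l) \<Rightarrow>
     Polygon (if forward \<alpha> then drop k (take l (sides \<pi>))
              else drop l (take k (sides \<pi>)) @ [sides \<pi> ! (l - 1)]))"

definition dissect :: "'r polygon \<Rightarrow> 'r tensor_alg" where
  "dissect \<pi> = (\<Sum>\<alpha>\<in>arrows \<pi>. smul (arrow_sign \<alpha> ^ weight (cutoff_polygon \<pi> \<alpha>))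
     (word [root_polygon \<pi> \<alpha>] * word [cutoff_polygon \<pi> \<alpha>]))"

definition dissect_bar :: "'r polygon \<Rightarrow> 'r tensor_alg" where
  "dissect_bar \<pi> = (\<Sum>\<alpha>\<in>arrows \<pi>. smul (arrow_sign \<alpha>)
     (word [root_polygon \<pi> \<alpha>] * word [cutoff_polygon_bar \<pi> \<alpha>]))"

lemma dissections_commute:
  assumes "v \<in> polygon_space"
  shows "(\<Sum>\<alpha>\<in>A. smul (c \<alpha>) (word [p \<alpha>] * word [q \<alpha>])) * v -
    v * (\<Sum>\<alpha>\<in>A. smul (c \<alpha>) (word [p \<alpha>] * word [q \<alpha>])) \<in> exterior_ideal"
  unfolding sum_distrib_left sum_distrib_right sum_subtractf[symmetric]
  by (rule ext.sum)
    (auto simp: smul_mult_left smul_mult_right smul_minus[symmetric]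
      intro!: ext.smul polygon_space_commute[OF assms])

lift_definition polygon_diff :: "'r polygon_alg \<Rightarrow> 'r polygon_alg" is "leibniz dissect"
  unfolding leibniz_def linext_diff[symmetric]
  by (rule leibniz_exterior_ideal[unfolded leibniz_def])
    (auto simp: dissect_def intro: dissections_commute)

lift_definition polygon_diff_bar :: "'r polygon_alg \<Rightarrow> 'r polygon_alg" is "leibniz dissect_bar"
  unfolding leibniz_def linext_diff[symmetric]
  by (rule leibniz_exterior_ideal[unfolded leibniz_def])
    (auto simp: dissect_bar_def intro: dissections_commute)

lemma polygon_diff_Leibniz:
  "polygon_diff 1 = 0"
  "polygon_diff (polygon_gen \<pi> * x) = polygon_diff (polygon_gen \<pi>) * x - polygon_gen \<pi> * polygon_diff x"
  "polygon_diff_bar 1 = 0"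
  "polygon_diff_bar (polygon_gen \<pi> * x) =
     polygon_diff_bar (polygon_gen \<pi>) * x - polygon_gen \<pi> * polygon_diff_bar x"
  by (transfer; simp add: leibniz_mult parity_word ext.zero smul_mult_left leibniz_word_single flip: word_Nil)+

definition polygon_dga :: "'r polygon_alg dga" where
  "polygon_dga = \<lparr>scalar = polygon_scale, piece = polygon_piece, diff = polygon_diff\<rparr>"

definition polygon_dga_bar :: "'r polygon_alg dga" where
  "polygon_dga_bar = \<lparr>scalar = polygon_scale, piece = polygon_piece, diff = polygon_diff_bar\<rparr>"

section \<open>Trees\<close>

text \<open>
  A planted plane tree is read from its root. \<open>Planted r b\<close> has a root decorated by \<open>r\<close>, and \<open>b\<close>
  consists of the root edge and all that lies beyond it. In a branch, \<open>Leaf e r\<close> is an edge \<open>e\<close>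
  ending in a leaf decorated by \<open>r\<close>, and \<open>Node e bs\<close> is an edge \<open>e\<close> ending in an internal vertex
  whose incident edges are, in cyclic order, \<open>e\<close> and the initial edges of \<open>bs\<close>. Edges have names in
  \<^typ>\<open>nat\<close>.
\<close>

datatype ('e, 'r) named_branch = Leaf 'e 'r | Node 'e "('e, 'r) named_branch list"

datatype ('e, 'r) named_tree = Planted 'r "('e, 'r) named_branch"

type_synonym 'r branch = "(nat, 'r) named_branch"
type_synonym 'r tree = "(nat, 'r) named_tree"

primrec first_edge :: "'r branch \<Rightarrow> nat" where
  "first_edge (Leaf e r) = e"
| "first_edge (Node e bs) = e"

primrec branches :: "'r branch \<Rightarrow> 'r branch list" where
  "branches (Leaf e r) = []"
| "branches (Node e bs) = bs"

text \<open>The edges in the order of the canonical orientation:\<close>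

primrec branch_edges :: "'r branch \<Rightarrow> nat list" where
  "branch_edges (Leaf e r) = [e]"
| "branch_edges (Node e bs) = e # concat (map branch_edges bs)"

primrec tree_edges :: "'r tree \<Rightarrow> nat list" where
  "tree_edges (Planted r b) = branch_edges b"

text \<open>Internal vertices have valency at least 3:\<close>

fun wf_branch :: "'r branch \<Rightarrow> bool" where
  "wf_branch (Leaf e r) \<longleftrightarrow> True"
| "wf_branch (Node e bs) \<longleftrightarrow> 2 \<le> length bs \<and> (\<forall>b\<in>set bs. wf_branch b)"

primrec wf_tree :: "'r tree \<Rightarrow> bool" where
  "wf_tree (Planted r b) \<longleftrightarrow> wf_branch b"

text \<open>
  An oriented forest \<open>(\<phi>, \<omega>)\<close> consists of a disjoint union \<open>\<phi>\<close> of trees, whose edges are named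
  distinctly, and an ordering \<open>\<omega> = e\<^sub>1 \<and> \<dots> \<and> e\<^sub>n\<close> of its edges.
\<close>

definition forest_edges :: "'r tree multiset \<Rightarrow> nat multiset" where
  "forest_edges F = (\<Sum>t\<in>#F. mset (tree_edges t))"

typedef 'r oforest = "{(F :: 'r tree multiset, \<omega> :: nat list).
    (\<forall>t\<in>#F. wf_tree t) \<and> distinct \<omega> \<and> mset \<omega> = forest_edges F}"
  morphisms rep_oforest OForest
  by (rule exI[of _ "({#}, [])"]) (simp add: forest_edges_def)

definition forest :: "'r oforest \<Rightarrow> 'r tree multiset" where
  "forest x = fst (rep_oforest x)"

definition orient :: "'r oforest \<Rightarrow> nat list" where
  "orient x = snd (rep_oforest x)"

definition relabel :: "(nat \<Rightarrow> nat) \<Rightarrow> 'r tree multiset \<Rightarrow> 'r tree multiset" where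
  "relabel f F = image_mset (map_named_tree f id) F"

definition valid :: "'r tree multiset \<Rightarrow> nat list \<Rightarrow> bool" where
  "valid F \<omega> \<longleftrightarrow> (\<forall>t\<in>#F. wf_tree t) \<and> distinct \<omega> \<and> mset \<omega> = forest_edges F"

lemma valid: "valid (forest x) (orient x)"
  using rep_oforest[of x] by (auto simp: valid_def forest_def orient_def)

lemma forest_OForest: "valid F \<omega> \<Longrightarrow> forest (OForest (F, \<omega>)) = F"
  and orient_OForest: "valid F \<omega> \<Longrightarrow> orient (OForest (F, \<omega>)) = \<omega>"
  by (simp_all add: forest_def orient_def valid_def OForest_inverse)

lemma OForest_eq: "OForest (forest x, orient x) = x"
  by (simp add: forest_def orient_def rep_oforest_inverse)

lemma oforest_eqI: "forest x = forest y \<Longrightarrow> orient x = orient y \<Longrightarrow> x = y"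
  by (metis OForest_eq)

lemma branch_edges_map: "branch_edges (map_named_branch f g b) = map f (branch_edges b)"
  by (induction b) (auto simp: map_concat o_def cong: map_cong)

lemma tree_edges_map: "tree_edges (map_named_tree f g t) = map f (tree_edges t)"
  by (cases t) (simp add: branch_edges_map)

lemma wf_branch_map: "wf_branch (map_named_branch f g b) = wf_branch b"
  by (induction b) (auto simp: list_all_iff)

lemma wf_tree_map: "wf_tree (map_named_tree f g t) = wf_tree t"
  by (cases t) (simp add: wf_branch_map)

lemma forest_edges_simps [simp]:
  "forest_edges {#} = {#}"
  "forest_edges (add_mset t F) = mset (tree_edges t) + forest_edges F"
  "forest_edges (F + G) = forest_edges F + forest_edges G"
  by (simp_all add: forest_edges_def)

lemma forest_edges_relabel: "forest_edges (relabel f F) = image_mset f (forest_edges F)"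
  by (induction F) (simp_all add: relabel_def tree_edges_map)

lemma valid_relabel: "valid F \<omega> \<Longrightarrow> inj_on f (set \<omega>) \<Longrightarrow> valid (relabel f F) (map f \<omega>)"
  by (auto simp: valid_def distinct_map forest_edges_relabel wf_tree_map)
    (auto simp: relabel_def wf_tree_map)

lemma relabel_relabel: "relabel f (relabel g F) = relabel (f \<circ> g) F"
  by (simp add: relabel_def multiset.map_comp named_tree.map_comp o_def id_def)

lemma relabel_add: "relabel f (F + G) = relabel f F + relabel f G"
  by (simp add: relabel_def)

lemma branch_map_cong:
  "(\<And>e. e \<in> set (branch_edges b) \<Longrightarrow> f e = g e) \<Longrightarrow> map_named_branch f id b = map_named_branch g id b"
  by (induction b) auto

lemma tree_map_cong:
  "(\<And>e. e \<in> set (tree_edges t) \<Longrightarrow> f e = g e) \<Longrightarrow> map_named_tree f id t = map_named_tree g id t"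
  by (cases t) (auto intro: branch_map_cong)

lemma in_forest_edges: "e \<in># forest_edges F \<longleftrightarrow> (\<exists>t\<in>#F. e \<in> set (tree_edges t))"
  by (auto simp: forest_edges_def)

lemma relabel_cong: "(\<And>e. e \<in># forest_edges F \<Longrightarrow> f e = g e) \<Longrightarrow> relabel f F = relabel g F"
  unfolding relabel_def by (rule image_mset_cong) (auto intro: tree_map_cong simp: in_forest_edges)

lemma relabel_id: "relabel id F = F"
  by (simp add: relabel_def named_tree.map_id0)

lemma set_orient: "set (orient x) = set_mset (forest_edges (forest x))"
  using valid[of x] by (metis valid_def set_mset_mset)

text \<open>
  The product of oriented forests is \<open>(\<phi>\<^sub>1 \<squnion> \<phi>\<^sub>2, \<omega>\<^sub>1 \<and> \<omega>\<^sub>2)\<close>. The edges of the second factor are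
  renamed so as to make the union disjoint.
\<close>

primrec bound :: "nat list \<Rightarrow> nat" where
  "bound [] = 0"
| "bound (e # es) = max (Suc e) (bound es)"

lemma bound_gt: "e \<in> set \<omega> \<Longrightarrow> e < bound \<omega>"
  by (induction \<omega>) (auto simp: less_max_iff_disj)

lemma bound_append_shift: "bound (\<omega> @ map ((+) (bound \<omega>)) \<omega>') = bound \<omega> + bound \<omega>'"
proof -
  have "bound (map ((+) k) \<omega>') = (if \<omega>' = [] then 0 else k + bound \<omega>')" for k
    by (induction \<omega>') (auto simp: max_def)
  moreover have "bound (u @ v) = max (bound u) (bound v)" for u v
    by (induction u) auto
  ultimately show ?thesis by (simp add: max_def)
qed

lemma valid_plus:
  assumes "valid F \<omega>" "valid F' \<omega>'"
  shows "valid (F + relabel ((+) (bound \<omega>)) F') (\<omega> @ map ((+) (bound \<omega>)) \<omega>')"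
proof -
  have "valid (relabel ((+) (bound \<omega>)) F') (map ((+) (bound \<omega>)) \<omega>')"
    by (rule valid_relabel[OF assms(2)]) simp
  moreover have "set \<omega> \<inter> set (map ((+) (bound \<omega>)) \<omega>') = {}"
    by (auto dest: bound_gt)
  ultimately show ?thesis
    using assms(1) by (auto simp: valid_def)
qed

instantiation oforest :: (type) monoid_add
begin

definition zero_oforest :: "'a oforest" where
  "0 = OForest ({#}, [])"

definition plus_oforest :: "'a oforest \<Rightarrow> 'a oforest \<Rightarrow> 'a oforest" where
  "x + y = OForest (forest x + relabel ((+) (bound (orient x))) (forest y),
                    orient x @ map ((+) (bound (orient x))) (orient y))"

lemma forest_plus: "forest (x + y) = forest x + relabel ((+) (bound (orient x))) (forest y)"
  and orient_plus: "orient (x + y) = orient x @ map ((+) (bound (orient x))) (orient y)"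
  by (simp_all add: plus_oforest_def valid_plus valid forest_OForest orient_OForest)

lemma forest_0 [simp]: "forest 0 = {#}"
  and orient_0 [simp]: "orient 0 = []"
  by (simp_all add: zero_oforest_def valid_def forest_OForest orient_OForest)

instance
proof
  fix x y z :: "'a oforest"
  show "x + y + z = x + (y + z)"
    by (rule oforest_eqI)
      (simp_all add: forest_plus orient_plus bound_append_shift relabel_add relabel_relabel o_def
        add.assoc[abs_def])
  have "(+) 0 = (id :: nat \<Rightarrow> nat)" by auto
  then show "0 + x = x"
    by (intro oforest_eqI) (simp_all add: forest_plus orient_plus relabel_id)
  show "x + 0 = x"
    by (rule oforest_eqI) (simp_all add: forest_plus orient_plus, simp add: relabel_def)
qed

end

text \<open>
  Two branches are related by \<open>replane\<close> if they differ only in the cyclic orders at the internal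
  vertices.
\<close>

inductive replane :: "'r branch \<Rightarrow> 'r branch \<Rightarrow> bool" where
  replane_Leaf: "replane (Leaf e r) (Leaf e r)"
| replane_Node: "list_all2 replane bs bs' \<Longrightarrow> mset bs' = mset bs'' \<Longrightarrow> replane (Node e bs) (Node e bs'')"

inductive replane_tree :: "'r tree \<Rightarrow> 'r tree \<Rightarrow> bool" where
  "replane b b' \<Longrightarrow> replane_tree (Planted r b) (Planted r b')"

text \<open>
  The relations between oriented forests: transposing two adjacent edges in \<open>\<omega>\<close>, and hence any odd
  permutation, changes the sign, and isomorphic oriented forests are identified. Isomorphisms
  preserve roots, decorations and orientations. They also preserve the cyclic orders if \<open>plane\<close> is
  true and need not do so otherwise; the cyclic orders then only serve to define contractions and
  canonical orientations.
\<close>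

inductive_set tree_relations :: "bool \<Rightarrow> ('r oforest \<Rightarrow>\<^sub>0 rat) set" for plane where
  rel_swap:
    "forest x = forest y \<Longrightarrow> orient x = u @ a # b # v \<Longrightarrow> orient y = u @ b # a # v \<Longrightarrow>
     Poly_Mapping.single x 1 + Poly_Mapping.single y 1 \<in> tree_relations plane"
| rel_relabel:
    "inj_on f (set (orient x)) \<Longrightarrow> forest y = relabel f (forest x) \<Longrightarrow> orient y = map f (orient x) \<Longrightarrow>
     Poly_Mapping.single x 1 - Poly_Mapping.single y 1 \<in> tree_relations plane"
| rel_replane:
    "\<not> plane \<Longrightarrow> rel_mset replane_tree (forest x) (forest y) \<Longrightarrow> orient x = orient y \<Longrightarrow>
     Poly_Mapping.single x 1 - Poly_Mapping.single y 1 \<in> tree_relations plane"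
| rel_zero: "0 \<in> tree_relations plane"
| rel_add: "x \<in> tree_relations plane \<Longrightarrow> y \<in> tree_relations plane \<Longrightarrow> x + y \<in> tree_relations plane"
| rel_smul: "x \<in> tree_relations plane \<Longrightarrow> smul c x \<in> tree_relations plane"

abbreviation unit_at :: "'r oforest \<Rightarrow> 'r oforest \<Rightarrow>\<^sub>0 rat" where
  "unit_at x \<equiv> Poly_Mapping.single x 1"

lemma rel_sum:
  "(\<And>a. a \<in> A \<Longrightarrow> f a \<in> tree_relations p) \<Longrightarrow> sum f A \<in> tree_relations p"
  by (induction A rule: infinite_finite_induct) (auto intro: rel_zero rel_add)

lemma replane_map: "replane b b' \<Longrightarrow> replane (map_named_branch f id b) (map_named_branch f id b')"
proof (induction rule: replane.induct)
  case (replane_Node bs bs' bs'' e)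
  have "list_all2 replane (map (map_named_branch f id) bs) (map (map_named_branch f id) bs')"
    using replane_Node(1) unfolding list_all2_map1 list_all2_map2 by (rule list_all2_mono) blast
  moreover have "mset (map (map_named_branch f id) bs') = mset (map (map_named_branch f id) bs'')"
    using replane_Node(2) by simp
  ultimately show ?case
    by (auto simp: id_def intro: replane.replane_Node)
qed (auto intro: replane.intros)

lemma replane_tree_map:
  "replane_tree t t' \<Longrightarrow> replane_tree (map_named_tree f id t) (map_named_tree f id t')"
  by (auto elim!: replane_tree.cases intro!: replane_tree.intros replane_map)

lemma replane_refl: "replane b b"
proof (induction b)
  case (Node e bs)
  then have "list_all2 replane bs bs" by (simp add: list.rel_refl_strong)
  then show ?case by (rule replane_Node) simp
qed (rule replane_Leaf)

lemma replane_tree_refl: "replane_tree t t"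
  by (cases t) (auto intro: replane_tree.intros replane_refl)

lemma rel_mset_relabel:
  "rel_mset replane_tree F G \<Longrightarrow> rel_mset replane_tree (relabel f F) (relabel f G)"
  unfolding relabel_def multiset.rel_map
  by (erule multiset.rel_mono_strong) (auto intro: replane_tree_map)

lemma rel_mset_replane_refl: "rel_mset replane_tree F F"
  by (simp add: multiset.rel_refl_strong replane_tree_refl)

lemma rel_mset_union: "rel_mset R F G \<Longrightarrow> rel_mset R F' G' \<Longrightarrow> rel_mset R (F + F') (G + G')"
proof (induction rule: rel_mset_induct)
  case (add F G a b)
  then show ?case by (simp add: rel_mset_Plus)
qed auto

lemma rel_mult_generators:
  fixes x y :: "'r oforest"
  shows "forest x = forest y \<Longrightarrow> orient x = u @ a # b # v \<Longrightarrow> orient y = u @ b # a # v \<Longrightarrow>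
     unit_at (x + z) + unit_at (y + z) \<in> tree_relations p \<and> unit_at (z + x) + unit_at (z + y) \<in> tree_relations p"
    and "inj_on f (set (orient x)) \<Longrightarrow> forest y = relabel f (forest x) \<Longrightarrow> orient y = map f (orient x) \<Longrightarrow>
     unit_at (x + z) - unit_at (y + z) \<in> tree_relations p \<and> unit_at (z + x) - unit_at (z + y) \<in> tree_relations p"
    and "\<not> p \<Longrightarrow> rel_mset replane_tree (forest x) (forest y) \<Longrightarrow> orient x = orient y \<Longrightarrow>
     unit_at (x + z) - unit_at (y + z) \<in> tree_relations p \<and> unit_at (z + x) - unit_at (z + y) \<in> tree_relations p"
proof -
  assume *: "forest x = forest y" "orient x = u @ a # b # v" "orient y = u @ b # a # v"
  have "bound (u @ a # b # v) = bound (u @ b # a # v)"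
    by (induction u) auto
  then have "bound (orient x) = bound (orient y)" by (simp add: *)
  note b = this
  let ?z = "(+) (bound (orient z))"
  have "unit_at (x + z) + unit_at (y + z) \<in> tree_relations p"
    by (rule rel_swap[of _ _ u a b "v @ map ((+) (bound (orient x))) (orient z)"])
      (simp_all only: forest_plus orient_plus b *(1), simp_all add: * b[symmetric])
  moreover have "unit_at (z + x) + unit_at (z + y) \<in> tree_relations p"
    by (rule rel_swap[of _ _ "orient z @ map ?z u" "?z a" "?z b" "map ?z v"])
      (simp_all add: forest_plus orient_plus *)
  ultimately show "unit_at (x + z) + unit_at (y + z) \<in> tree_relations p \<and> unit_at (z + x) + unit_at (z + y) \<in> tree_relations p" ..
next
  assume *: "inj_on f (set (orient x))" "forest y = relabel f (forest x)" "orient y = map f (orient x)"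
  let ?x = "bound (orient x)" and ?y = "bound (orient y)" and ?z = "bound (orient z)"
  define g where "g e = (if e < ?x then f e else e - ?x + ?y)" for e
  define h where "h e = (if e < ?z then e else ?z + f (e - ?z))" for e
  have lt: "e < ?x" if "e \<in> set (orient x)" for e using that by (rule bound_gt)
  have lty: "f e < ?y" if "e \<in> set (orient x)" for e
    using that by (auto intro!: bound_gt simp: *)
  have ltz: "e < ?z" if "e \<in> set (orient z)" for e using that by (rule bound_gt)
  have gx: "map g (orient x) = orient y" "relabel g (forest x) = forest y"
    unfolding * by (auto simp: g_def lt intro!: relabel_cong simp flip: set_orient)
  have gz: "map (g \<circ> (+) ?x) (orient z) = map ((+) ?y) (orient z)"
      "relabel (g \<circ> (+) ?x) (forest z) = relabel ((+) ?y) (forest z)"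
    by (auto simp: g_def intro!: relabel_cong)
  have "inj_on g (set (orient x))"
    using *(1) by (auto simp: inj_on_def g_def lt)
  moreover have "inj_on g ((+) ?x ` set (orient z))"
    by (auto simp: inj_on_def g_def)
  moreover have "g ` set (orient x) \<subseteq> {..<?y}" "g ` (+) ?x ` set (orient z) \<subseteq> {?y..}"
    using lt lty by (auto simp: g_def)
  then have "g ` set (orient x) \<inter> g ` (+) ?x ` set (orient z) = {}"
    by fastforce
  ultimately have "inj_on g (set (orient (x + z)))"
    by (simp add: orient_plus inj_on_Un) blast
  then have 1: "unit_at (x + z) - unit_at (y + z) \<in> tree_relations p"
    by (rule rel_relabel) (simp_all add: forest_plus orient_plus relabel_add relabel_relabel gx gz[unfolded o_def] o_def)
  have hx: "map (h \<circ> (+) ?z) (orient x) = map ((+) ?z) (orient y)"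
      "relabel (h \<circ> (+) ?z) (forest x) = relabel ((+) ?z) (forest y)"
    unfolding * relabel_relabel by (auto simp: h_def intro!: relabel_cong)
  have hz: "map h (orient z) = orient z" "relabel h (forest z) = forest z"
    using relabel_cong[of "forest z" h id] by (auto simp: h_def ltz map_idI relabel_id simp flip: set_orient)
  have "inj_on h (set (orient z))"
    by (auto simp: inj_on_def h_def ltz)
  moreover have "inj_on h ((+) ?z ` set (orient x))"
    using *(1) by (auto simp: inj_on_def h_def)
  moreover have "h ` set (orient z) \<subseteq> {..<?z}" "h ` (+) ?z ` set (orient x) \<subseteq> {?z..}"
    using ltz by (auto simp: h_def)
  then have "h ` set (orient z) \<inter> h ` (+) ?z ` set (orient x) = {}"
    by fastforce
  ultimately have "inj_on h (set (orient (z + x)))"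
    by (simp add: orient_plus inj_on_Un) blast
  then have 2: "unit_at (z + x) - unit_at (z + y) \<in> tree_relations p"
    by (rule rel_relabel) (simp_all add: forest_plus orient_plus relabel_add relabel_relabel hx[unfolded o_def] hz o_def)
  from 1 2 show "unit_at (x + z) - unit_at (y + z) \<in> tree_relations p \<and> unit_at (z + x) - unit_at (z + y) \<in> tree_relations p" ..
next
  assume *: "\<not> p" "rel_mset replane_tree (forest x) (forest y)" "orient x = orient y"
  then show "unit_at (x + z) - unit_at (y + z) \<in> tree_relations p \<and> unit_at (z + x) - unit_at (z + y) \<in> tree_relations p"
    by (auto intro!: rel_replane simp: forest_plus orient_plus
        intro!: rel_mset_union rel_mset_replane_refl rel_mset_relabel)
qed

lemma rel_mult_single:
  "x \<in> tree_relations p \<Longrightarrow> x * unit_at z \<in> tree_relations p \<and> unit_at z * x \<in> tree_relations p"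
proof (induction rule: tree_relations.induct)
  case (rel_swap x y u a b v)
  from rel_mult_generators(1)[OF this, of z p] show ?case
    by (simp add: algebra_simps mult_single)
next
  case (rel_relabel f x y)
  from rel_mult_generators(2)[OF this, of z p] show ?case
    by (simp add: algebra_simps mult_single)
next
  case (rel_replane x y)
  from rel_mult_generators(3)[OF this, of z] show ?case
    by (simp add: algebra_simps mult_single)
qed (auto simp: algebra_simps smul_mult_left smul_mult_right intro: tree_relations.intros)

lemma rel_mult: "x \<in> tree_relations p \<Longrightarrow> x * y \<in> tree_relations p \<and> y * x \<in> tree_relations p"
proof (induction y rule: free_induct)
  case (single b c)
  have "Poly_Mapping.single b c = smul c (unit_at b)"
    by (simp add: smul_single)
  then show ?case
    using rel_mult_single[OF single, of b]
    by (simp add: smul_mult_left smul_mult_right rel_smul)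
qed (auto simp: algebra_simps intro: tree_relations.intros)

interpretation rel: two_sided_ideal "tree_relations plane" for plane
  by standard (auto intro: rel_zero rel_add simp: rel_mult)

lemma lookup_tree_relations: "x \<in> tree_relations p \<Longrightarrow> Poly_Mapping.lookup x 0 = 0"
proof (induction rule: tree_relations.induct)
  case (rel_swap x y u a b v)
  then have "x \<noteq> 0" "y \<noteq> 0" by auto
  then show ?case by (simp add: lookup_add lookup_single)
next
  case (rel_relabel f x y)
  have "x = 0 \<longleftrightarrow> y = 0"
    using rel_relabel by (auto intro!: oforest_eqI simp: relabel_def dest: arg_cong[of _ _ forest])
  then show ?case by (auto simp: lookup_minus lookup_single)
next
  case (rel_replane x y)
  have "x = 0 \<longleftrightarrow> y = 0"
    using rel_replane by (auto intro!: oforest_eqI simp: rel_mset_Zero dest: rel_mset_size)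
  then show ?case by (auto simp: lookup_minus lookup_single)
qed (auto simp: lookup_add lookup_smul)

subsection \<open>Contraction of edges\<close>

text \<open>
  Let \<open>e\<close> be an edge of a branch \<open>b\<close> other than its first edge. \<open>trunk e b\<close> and \<open>pieces e b\<close> describe
  the result of contracting \<open>e\<close>. If \<open>e\<close> is internal, its far end is merged with its near end, and
  there are no further pieces. If \<open>e\<close> ends in a leaf decorated by \<open>r\<close>, its near end becomes an
  external vertex decorated by \<open>r\<close> at which the tree falls apart. The component containing the
  original root ends there in a leaf, and the other components have their roots there.
\<close>

fun trunk :: "nat \<Rightarrow> 'r branch \<Rightarrow> 'r branch" where
  "trunk e (Leaf f r) = Leaf f r"
| "trunk e (Node f bs) =
     (case find (\<lambda>b. first_edge b = e) bs of
        Some (Leaf _ r) \<Rightarrow> Leaf f r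
      | _ \<Rightarrow> Node f (concat (map (\<lambda>b. if first_edge b = e then branches b else [trunk e b]) bs)))"

fun pieces :: "nat \<Rightarrow> 'r branch \<Rightarrow> 'r tree list" where
  "pieces e (Leaf f r) = []"
| "pieces e (Node f bs) =
     (case find (\<lambda>b. first_edge b = e) bs of
        Some (Leaf _ r) \<Rightarrow> map (Planted r) (filter (\<lambda>b. first_edge b \<noteq> e) bs)
      | _ \<Rightarrow> concat (map (pieces e) bs))"

text \<open>Contracting the root edge makes the root the root of all pieces:\<close>

primrec contract_tree :: "nat \<Rightarrow> 'r tree \<Rightarrow> 'r tree multiset" where
  "contract_tree e (Planted r b) =
     (if first_edge b = e then mset (map (Planted r) (branches b))
      else add_mset (Planted r (trunk e b)) (mset (pieces e b)))"

definition contract_forest :: "nat \<Rightarrow> 'r tree multiset \<Rightarrow> 'r tree multiset" where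
  "contract_forest e F = (\<Sum>t\<in>#F. contract_tree e t)"

text \<open>The edges that do not form a tree of their own, as a tree with one edge has differential 0:\<close>

definition contractible :: "'r oforest \<Rightarrow> nat set" where
  "contractible x = {e \<in> set (orient x). \<forall>r s. Planted r (Leaf e s) \<notin># forest x}"

text \<open>\<open>i\<^sub>e \<omega>\<close> is obtained by moving \<open>e\<close> to the front of \<open>\<omega>\<close> and deleting it:\<close>

definition position :: "nat \<Rightarrow> nat list \<Rightarrow> nat" where
  "position e \<omega> = length (takeWhile (\<lambda>e'. e' \<noteq> e) \<omega>)"

definition contract :: "nat \<Rightarrow> 'r oforest \<Rightarrow> 'r oforest" where
  "contract e x = OForest (contract_forest e (forest x), remove1 e (orient x))"

definition boundary :: "'r oforest \<Rightarrow> 'r oforest \<Rightarrow>\<^sub>0 rat" where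
  "boundary x =
     (\<Sum>e\<in>contractible x. Poly_Mapping.single (contract e x) ((- 1) ^ position e (orient x)))"

lemma first_edge_in [simp]: "first_edge b \<in> set (branch_edges b)"
  by (cases b) auto

lemma trunk_pieces_notin:
  "e \<notin> set (branch_edges b) \<Longrightarrow> trunk e b = b \<and> pieces e b = []"
proof (induction b)
  case (Node f bs)
  have "find (\<lambda>b. first_edge b = e) bs = None"
    using Node.prems by (auto simp: find_None_iff) 
  moreover have "concat (map (\<lambda>b. if first_edge b = e then branches b else [trunk e b]) bs') = bs'"
    if "set bs' \<subseteq> set bs" for bs'
    using that Node by (induction bs') (auto dest: first_edge_in[THEN back_subst[of "\<lambda>x. x \<in> _"]])
  ultimately show ?case
    using Node by auto
qed auto

lemma find_notin:
  assumes "\<forall>b\<in>set us. e \<notin> set (branch_edges b)"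
  shows "find (\<lambda>b. first_edge b = e) (us @ vs) = find (\<lambda>b. first_edge b = e) vs"
  using assms
proof (induction us)
  case (Cons u us)
  have "first_edge u \<noteq> e" using Cons.prems by (metis first_edge_in list.set_intros(1))
  then show ?case using Cons by simp
qed simp

lemma first_edge_notin: "e \<notin> set (branch_edges b) \<Longrightarrow> first_edge b \<noteq> e"
  by (metis first_edge_in)

lemma concat_trunk_notin:
  assumes "\<forall>b\<in>set us. e \<notin> set (branch_edges b)"
  shows "concat (map (\<lambda>b. if first_edge b = e then branches b else [trunk e b]) us) = us"
    and "concat (map (pieces e) us) = []"
    and "filter (\<lambda>b. first_edge b \<noteq> e) us = us"
  using assms by (induction us) (auto simp: first_edge_notin trunk_pieces_notin)

lemma trunk_pieces_split:
  assumes "\<forall>b\<in>set us \<union> set vs. e \<notin> set (branch_edges b)"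
  shows "trunk e (Node f (us @ Leaf e r # vs)) = Leaf f r"
    and "pieces e (Node f (us @ Leaf e r # vs)) = map (Planted r) (us @ vs)"
    and "trunk e (Node f (us @ Node e cs # vs)) = Node f (us @ cs @ vs)"
    and "e \<notin> set (concat (map branch_edges cs)) \<Longrightarrow> pieces e (Node f (us @ Node e cs # vs)) = []"
    and "first_edge c \<noteq> e \<Longrightarrow> trunk e (Node f (us @ c # vs)) = Node f (us @ trunk e c # vs)"
    and "first_edge c \<noteq> e \<Longrightarrow> pieces e (Node f (us @ c # vs)) = pieces e c"
proof -
  have us: "\<forall>b\<in>set us. e \<notin> set (branch_edges b)" and vs: "\<forall>b\<in>set vs. e \<notin> set (branch_edges b)"
    using assms by auto
  note simps = find_notin[OF us] find_notin[OF vs, of "[]", simplified] concat_trunk_notin[OF us]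
    concat_trunk_notin[OF vs]
  show "trunk e (Node f (us @ Leaf e r # vs)) = Leaf f r"
      "pieces e (Node f (us @ Leaf e r # vs)) = map (Planted r) (us @ vs)"
      "trunk e (Node f (us @ Node e cs # vs)) = Node f (us @ cs @ vs)"
    by (simp_all add: simps)
  show "pieces e (Node f (us @ Node e cs # vs)) = []" if "e \<notin> set (concat (map branch_edges cs))"
  proof -
    have "\<forall>b\<in>set cs. e \<notin> set (branch_edges b)" using that by auto
    note cs = find_notin[OF this, of "[]", simplified] concat_trunk_notin[OF this]
    show ?thesis by (simp add: simps cs)
  qed
  show "trunk e (Node f (us @ c # vs)) = Node f (us @ trunk e c # vs)"
      "pieces e (Node f (us @ c # vs)) = pieces e c" if "first_edge c \<noteq> e"
    using that by (simp_all add: simps)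
qed

lemma branches_split:
  assumes "distinct (branch_edges (Node f bs))" "e \<in> set (branch_edges (Node f bs))" "f \<noteq> e"
  obtains us c vs where "bs = us @ c # vs" "e \<in> set (branch_edges c)"
    "\<forall>b\<in>set us \<union> set vs. e \<notin> set (branch_edges b)"
proof -
  obtain c where "c \<in> set bs" "e \<in> set (branch_edges c)" using assms by auto
  then obtain us vs where bs: "bs = us @ c # vs" by (meson split_list)
  then have "\<forall>b\<in>set us \<union> set vs. e \<notin> set (branch_edges b)"
    using assms(1) \<open>e \<in> set (branch_edges c)\<close> by auto
  with bs \<open>e \<in> set (branch_edges c)\<close> that show ?thesis by blast
qed

lemma trunk_pieces_edges:
  assumes "e \<in> set (branch_edges b)" "distinct (branch_edges b)" "first_edge b \<noteq> e" "wf_branch b"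
  shows "mset (branch_edges b) =
      add_mset e (mset (branch_edges (trunk e b)) + (\<Sum>t\<leftarrow>pieces e b. mset (tree_edges t))) \<and>
    first_edge (trunk e b) = first_edge b \<and>
    wf_branch (trunk e b) \<and> (\<forall>t\<in>set (pieces e b). wf_tree t)"
  using assms
proof (induction b)
  case (Node f bs)
  obtain us c vs where bs: "bs = us @ c # vs" and c: "e \<in> set (branch_edges c)"
      and uv: "\<forall>b\<in>set us \<union> set vs. e \<notin> set (branch_edges b)"
    by (rule branches_split[OF Node.prems(2,1)]) (use Node.prems in auto)
  have sum: "mset (concat (map branch_edges bs)) = (\<Sum>b\<leftarrow>bs. mset (branch_edges b))" for bs :: "'a branch list"
    by (induction bs) auto
  have dc: "distinct (branch_edges c)" using Node.prems(2) by (simp add: bs)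
  have "wf_branch c" using Node.prems(4) by (simp add: bs)
  show ?case
  proof (cases "first_edge c = e")
    case True
    show ?thesis
    proof (cases c)
      case (Leaf g r)
      then show ?thesis
        using True Node.prems(4) by (simp add: bs trunk_pieces_split[OF uv] o_def sum del: trunk.simps pieces.simps) auto
    next
      case (Node g cs)
      then have "e \<notin> set (concat (map branch_edges cs))" using dc True by simp
      then show ?thesis
        using True Node \<open>wf_branch c\<close> Node.prems(4)
        by (simp add: bs trunk_pieces_split[OF uv] sum del: set_concat trunk.simps pieces.simps) auto
    qed
  next
    case False
    have "c \<in> set bs" by (simp add: bs)
    from Node.IH[OF this c dc False \<open>wf_branch c\<close>] show ?thesis
      using False Node.prems(4)
      by (simp add: bs trunk_pieces_split[OF uv] sum del: trunk.simps pieces.simps)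
  qed
qed auto

lemma find_map: "find P (map g xs) = map_option g (find (P \<circ> g) xs)"
  by (induction xs) auto

lemma find_cong': "(\<And>x. x \<in> set xs \<Longrightarrow> P x = Q x) \<Longrightarrow> find P xs = find Q xs"
  by (induction xs) auto

lemma first_edge_map [simp]: "first_edge (map_named_branch f g b) = f (first_edge b)"
  by (cases b) auto

lemma branches_map [simp]: "branches (map_named_branch f g b) = map (map_named_branch f g) (branches b)"
  by (cases b) auto

lemma trunk_pieces_map:
  assumes "inj_on g (insert e (set (branch_edges b)))"
  shows "trunk (g e) (map_named_branch g id b) = map_named_branch g id (trunk e b) \<and>
    pieces (g e) (map_named_branch g id b) = map (map_named_tree g id) (pieces e b)"
  using assms
proof (induction b)
  case (Node f bs)
  have IH: "trunk (g e) (map_named_branch g id b) = map_named_branch g id (trunk e b)"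
      "pieces (g e) (map_named_branch g id b) = map (map_named_tree g id) (pieces e b)"
    if "b \<in> set bs" for b
  proof -
    have "inj_on g (insert e (set (branch_edges b)))"
      by (rule inj_on_subset[OF Node.prems]) (use that in auto)
    from Node.IH[OF that this] show
      "trunk (g e) (map_named_branch g id b) = map_named_branch g id (trunk e b)"
      "pieces (g e) (map_named_branch g id b) = map (map_named_tree g id) (pieces e b)"
      by blast+
  qed
  have eq: "g (first_edge b) = g e \<longleftrightarrow> first_edge b = e" if "b \<in> set bs" for b
    by (intro inj_on_eq_iff[OF Node.prems])
      (use that first_edge_in[of b] in \<open>auto simp del: first_edge_in\<close>)
  have find: "find (\<lambda>b. first_edge b = g e) (map (map_named_branch g id) bs) =
      map_option (map_named_branch g id) (find (\<lambda>b. first_edge b = e) bs)"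
    unfolding find_map by (rule arg_cong[where f = "map_option _"], rule find_cong') (simp add: eq)
  have 1: "concat (map (\<lambda>b. if first_edge b = g e then branches b else [trunk (g e) b]) (map (map_named_branch g id) bs)) =
      map (map_named_branch g id) (concat (map (\<lambda>b. if first_edge b = e then branches b else [trunk e b]) bs))"
    unfolding map_concat map_map
    by (rule arg_cong[where f = concat], rule map_cong) (auto simp: IH eq)
  have 2: "concat (map (pieces (g e)) (map (map_named_branch g id) bs)) =
      map (map_named_tree g id) (concat (map (pieces e) bs))"
    unfolding map_concat map_map
    by (rule arg_cong[where f = concat], rule map_cong) (auto simp: IH)
  have 3: "filter (\<lambda>b. first_edge b \<noteq> g e) (map (map_named_branch g id) bs) =
      map (map_named_branch g id) (filter (\<lambda>b. first_edge b \<noteq> e) bs)"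
    unfolding filter_map by (rule arg_cong[where f = "map _"], rule filter_cong) (auto simp: eq)
  note [simp del] = map_map
  show ?case
    by (cases "find (\<lambda>b. first_edge b = e) bs")
      (simp_all add: find[unfolded id_def] 1[unfolded id_def] 2[unfolded id_def] 3[unfolded id_def]
        id_def split: named_branch.split, simp_all add: map_map o_def)
qed simp

lemma contract_tree_map:
  assumes "inj_on g (insert e (set (tree_edges t)))"
  shows "contract_tree (g e) (map_named_tree g id t) = image_mset (map_named_tree g id) (contract_tree e t)"
proof (cases t)
  case (Planted r b)
  then have "g (first_edge b) = g e \<longleftrightarrow> first_edge b = e"
    using assms by (intro inj_on_eq_iff[OF assms]) auto
  then show ?thesis
    using Planted trunk_pieces_map[of g e b] assms
    by (simp add: multiset.map_comp o_def)
qed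

lemma contract_forest_relabel:
  assumes "inj_on g (insert e (set_mset (forest_edges F)))"
  shows "contract_forest (g e) (relabel g F) = relabel g (contract_forest e F)"
  using assms
proof (induction F)
  case (add t F)
  have "inj_on g (insert e (set (tree_edges t)))" "inj_on g (insert e (set_mset (forest_edges F)))"
    using add.prems by (auto elim!: inj_on_subset)
  then show ?case
    using add.IH by (simp add: contract_forest_def relabel_def contract_tree_map)
qed (simp add: contract_forest_def relabel_def)

lemma contract_tree_notin: "e \<notin> set (tree_edges t) \<Longrightarrow> contract_tree e t = {#t#}"
  by (cases t) (auto simp: trunk_pieces_notin first_edge_notin)

lemma contract_forest_notin: "e \<notin># forest_edges F \<Longrightarrow> contract_forest e F = F"
  by (induction F) (auto simp: contract_forest_def contract_tree_notin)

lemma contract_forest_union: "contract_forest e (F + G) = contract_forest e F + contract_forest e G"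
  by (simp add: contract_forest_def)

lemma forest_split:
  assumes "valid F \<omega>" "e \<in> set \<omega>"
  obtains t G where "F = add_mset t G" "e \<in> set (tree_edges t)" "e \<notin># forest_edges G"
    "distinct (tree_edges t)"
proof -
  have "e \<in># forest_edges F" using assms by (metis set_mset_mset valid_def)
  then obtain t where t: "t \<in># F" "e \<in> set (tree_edges t)" by (auto simp: in_forest_edges)
  then obtain G where G: "F = add_mset t G" by (metis multi_member_split)
  have c: "count (forest_edges F) x \<le> 1" for x
    using assms(1) by (metis valid_def distinct_count_atmost_1 count_mset le_numeral_extra(1,4))
  have "distinct (tree_edges t)"
    unfolding distinct_count_atmost_1
  proof
    fix x
    have "count (mset (tree_edges t)) x \<le> 1" using c[of x] by (simp add: G)
    then show "count (mset (tree_edges t)) x = (if x \<in> set (tree_edges t) then 1 else 0)"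
      by (metis One_nat_def Suc_leI count_greater_zero_iff count_mset_0_iff le_antisym set_mset_mset)
  qed
  moreover have "e \<notin># forest_edges G"
  proof
    assume "e \<in># forest_edges G"
    then have "count (forest_edges F) e \<ge> 2"
      using t by (simp add: G) (metis One_nat_def Suc_leI add_mono count_greater_zero_iff one_add_one set_mset_mset)
    with c[of e] show False by simp
  qed
  ultimately show ?thesis using that t G by blast
qed

lemma contract_tree_edges:
  assumes "e \<in> set (tree_edges t)" "distinct (tree_edges t)" "wf_tree t" "\<forall>r s. t \<noteq> Planted r (Leaf e s)"
  shows "mset (tree_edges t) = add_mset e (forest_edges (contract_tree e t))"
    and "\<forall>t'\<in>#contract_tree e t. wf_tree t'"
proof -
  obtain r b where t: "t = Planted r b" by (cases t)
  have mset_sum: "forest_edges (mset ts) = (\<Sum>t\<leftarrow>ts. mset (tree_edges t))" for ts :: "'a tree list"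
    by (induction ts) auto
  have sum: "mset (concat (map branch_edges bs)) = (\<Sum>b\<leftarrow>bs. mset (branch_edges b))" for bs :: "'a branch list"
    by (induction bs) auto
  have "mset (tree_edges t) = add_mset e (forest_edges (contract_tree e t)) \<and>
      (\<forall>t'\<in>#contract_tree e t. wf_tree t')"
  proof (cases "first_edge b = e")
    case True
    then obtain bs where "b = Node e bs" using assms(4) t by (cases b) auto
    then show ?thesis
      using t assms(3) by (auto simp: mset_sum sum o_def simp flip: mset_map)
  next
    case False
    then show ?thesis
      using trunk_pieces_edges[of e b] assms t by (simp add: mset_sum)
  qed
  then show "mset (tree_edges t) = add_mset e (forest_edges (contract_tree e t))"
    and "\<forall>t'\<in>#contract_tree e t. wf_tree t'" by auto
qed

lemma valid_contract:
  assumes "e \<in> contractible x"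
  shows "valid (contract_forest e (forest x)) (remove1 e (orient x))"
proof -
  have e: "e \<in> set (orient x)" using assms by (simp add: contractible_def)
  obtain t G where *: "forest x = add_mset t G" "e \<in> set (tree_edges t)" "e \<notin># forest_edges G"
    "distinct (tree_edges t)"
    by (rule forest_split[OF valid e])
  have wf: "\<forall>t\<in>#forest x. wf_tree t" "distinct (orient x)" "mset (orient x) = forest_edges (forest x)"
    using valid[of x] by (auto simp: valid_def)
  have t: "\<forall>r s. t \<noteq> Planted r (Leaf e s)" "wf_tree t"
    using assms *(1) wf(1) by (auto simp: contractible_def)
  have F: "contract_forest e (forest x) = contract_tree e t + G"
    using contract_forest_notin[OF *(3)] by (simp add: *(1) contract_forest_def)
  show ?thesis
    using wf contract_tree_edges[OF *(2,4) t(2,1)] unfolding valid_def F by (auto simp: *(1))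
qed

lemma forest_contract: "e \<in> contractible x \<Longrightarrow> forest (contract e x) = contract_forest e (forest x)"
  and orient_contract: "e \<in> contractible x \<Longrightarrow> orient (contract e x) = remove1 e (orient x)"
  by (simp_all add: contract_def forest_OForest orient_OForest valid_contract)

lemma replane_first_edge: "replane b b' \<Longrightarrow> first_edge b = first_edge b'"
  by (auto elim: replane.cases)

lemma replane_edges: "replane b b' \<Longrightarrow> mset (branch_edges b) = mset (branch_edges b')"
proof (induction rule: replane.induct)
  case (replane_Node bs bs' bs'' e)
  have "mset (concat (map branch_edges bs)) = mset (concat (map branch_edges bs'))"
    using replane_Node(1) by (induction rule: list_all2_induct) auto
  also have "\<dots> = mset (concat (map branch_edges bs''))"
    using replane_Node(2) by (metis mset_concat mset_map sum_mset_sum_list)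
  finally show ?case by simp
qed auto

lemma replane_Node_Leaf: "replane (Leaf e r) b \<longleftrightarrow> b = Leaf e r"
  by (auto elim: replane.cases intro: replane.intros)

lemma list_all2_mset_rel: "list_all2 R xs ys \<Longrightarrow> mset ys = mset zs \<Longrightarrow> rel_mset R (mset xs) (mset zs)"
  unfolding rel_mset_def by metis

lemma trunk_pieces_replane:
  assumes "replane b b'" "e \<in> set (branch_edges b)" "distinct (branch_edges b)" "first_edge b \<noteq> e"
  shows "replane (trunk e b) (trunk e b') \<and> rel_mset replane_tree (mset (pieces e b)) (mset (pieces e b'))"
  using assms
proof (induction rule: replane.induct)
  case (replane_Node bs bs' bs'' f)
  have rep: "list_all2 replane bs bs'"
    using replane_Node(1) by (rule list_all2_mono) blast
  obtain us c vs where bs: "bs = us @ c # vs" and c: "e \<in> set (branch_edges c)"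
      and uv: "\<forall>b\<in>set us \<union> set vs. e \<notin> set (branch_edges b)"
    by (rule branches_split[OF replane_Node.prems(2,1)]) (use replane_Node.prems in auto)
  let ?R = "\<lambda>c c'. replane c c' \<and> (e \<in> set (branch_edges c) \<longrightarrow> distinct (branch_edges c) \<longrightarrow> first_edge c \<noteq> e \<longrightarrow>
      replane (trunk e c) (trunk e c') \<and> rel_mset replane_tree (mset (pieces e c)) (mset (pieces e c')))"
  have "list_all2 ?R (us @ c # vs) bs'"
    using replane_Node(1) unfolding bs by (rule list_all2_mono) blast
  then obtain us' c' vs' where bs': "bs' = us' @ c' # vs'" and cc: "?R c c'"
      and uR: "list_all2 ?R us us'" and vR: "list_all2 ?R vs vs'"
    unfolding list_all2_append1 list_all2_Cons1 by blast
  have uu: "list_all2 replane us us'" using uR by (rule list_all2_mono) blast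
  have vv: "list_all2 replane vs vs'" using vR by (rule list_all2_mono) blast
  from cc have cc: "replane c c'"
      and IH: "e \<in> set (branch_edges c) \<Longrightarrow> distinct (branch_edges c) \<Longrightarrow> first_edge c \<noteq> e \<Longrightarrow>
        replane (trunk e c) (trunk e c') \<and> rel_mset replane_tree (mset (pieces e c)) (mset (pieces e c'))"
    by blast+
  have "c' \<in> set bs''" using replane_Node(2) bs' by (metis in_set_conv_decomp set_mset_mset)
  then obtain us'' vs'' where bs'': "bs'' = us'' @ c' # vs''" by (meson split_list)
  have m: "mset us' + mset vs' = mset us'' + mset vs''"
    using replane_Node(2) by (simp add: bs' bs'')
  have notin: "e \<notin> set (branch_edges b')" if "list_all2 replane ws ws'" "\<forall>b\<in>set ws. e \<notin> set (branch_edges b)" "b' \<in> set ws'"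
    for ws ws' :: "'a branch list" and b'
  proof -
    from that obtain b where "b \<in> set ws" "replane b b'"
      by (metis in_set_conv_nth list_all2_conv_all_nth)
    with that(2) show ?thesis by (metis replane_edges set_mset_mset)
  qed
  have uv': "\<forall>b\<in>set us'' \<union> set vs''. e \<notin> set (branch_edges b)"
  proof -
    have "\<forall>b\<in>set us' \<union> set vs'. e \<notin> set (branch_edges b)"
      using uv notin[OF uu] notin[OF vv] by blast
    moreover have "set us'' \<union> set vs'' = set us' \<union> set vs'"
      using m by (metis set_mset_mset set_mset_union)
    ultimately show ?thesis by simp
  qed
  have dc: "distinct (branch_edges c)" using replane_Node.prems(2) by (simp add: bs)
  note split = trunk_pieces_split[OF uv] trunk_pieces_split[OF uv']
  note [simp del] = trunk.simps pieces.simps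
  show ?case
  proof (cases "first_edge c = e")
    case True
    show ?thesis
    proof (cases c)
      case (Leaf g r)
      with True cc have c: "c = Leaf e r" "c' = Leaf e r" by (auto simp: replane_Node_Leaf)
      have "list_all2 replane (us @ vs) (us' @ vs')"
        using uu vv by (simp add: list_all2_appendI)
      then have "list_all2 replane_tree (map (Planted r) (us @ vs)) (map (Planted r) (us' @ vs'))"
        unfolding list_all2_map1 list_all2_map2
        by (rule list_all2_mono) (rule replane_tree.intros)
      moreover have "mset (map (Planted r) (us' @ vs')) = mset (map (Planted r) (us'' @ vs''))"
        using m by (metis mset_append mset_map)
      ultimately have "rel_mset replane_tree (mset (map (Planted r) (us @ vs))) (mset (map (Planted r) (us'' @ vs'')))"
        by (rule list_all2_mset_rel)
      then show ?thesis
        by (simp only: bs bs'' c split replane_Leaf simp_thms)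
    next
      case (Node g cs)
      with True have c: "c = Node e cs" by simp
      from cc obtain cs' cs'' where c': "c' = Node e cs''" "list_all2 replane cs cs'" "mset cs' = mset cs''"
        unfolding c by (auto elim: replane.cases)
      have n: "e \<notin> set (concat (map branch_edges cs))" using dc c by simp
      have "mset (branch_edges c) = mset (branch_edges c')" using cc by (rule replane_edges)
      then have "mset (concat (map branch_edges cs)) = mset (concat (map branch_edges cs''))"
        by (simp add: c c')
      then have n': "e \<notin> set (concat (map branch_edges cs''))" using n by (metis set_mset_mset)
      have "replane (Node f (us @ cs @ vs)) (Node f (us'' @ cs'' @ vs''))"
        using uu vv c' m by (intro replane.replane_Node[of _ "us' @ cs' @ vs'"])
          (auto intro!: list_all2_appendI simp: algebra_simps)
      then show ?thesis
        using n n' by (simp add: bs bs'' c c' split rel_mset_Zero del: set_concat)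
    qed
  next
    case False
    have False': "first_edge c' \<noteq> e" using False replane_first_edge[OF cc] by simp
    have "replane (Node f (us @ trunk e c # vs)) (Node f (us'' @ trunk e c' # vs''))"
      using uu vv m IH[OF c dc False]
      by (intro replane.replane_Node[of _ "us' @ trunk e c' # vs'"]) (auto intro!: list_all2_appendI)
    then show ?thesis
      using IH[OF c dc False] by (simp add: bs bs'' split False False')
  qed
qed auto

lemma replane_tree_edges: "replane_tree t t' \<Longrightarrow> mset (tree_edges t) = mset (tree_edges t')"
  by (auto elim!: replane_tree.cases simp: replane_edges)

lemma contract_tree_replane:
  assumes "replane_tree t t'" "distinct (tree_edges t)"
  shows "rel_mset replane_tree (contract_tree e t) (contract_tree e t')"
proof (cases "e \<in> set (tree_edges t)")
  case False
  then have "e \<notin> set (tree_edges t')"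
    using replane_tree_edges[OF assms(1)] by (metis set_mset_mset)
  then have "contract_tree e t = {#t#}" "contract_tree e t' = {#t'#}"
    using False by (auto simp: contract_tree_notin)
  then show ?thesis using assms(1) rel_mset_Plus[OF _ rel_mset_Zero] by auto
next
  case True
  obtain r b b' where t: "t = Planted r b" "t' = Planted r b'" "replane b b'"
    using assms(1) by (auto elim: replane_tree.cases)
  note fe = replane_first_edge[OF t(3)]
  show ?thesis
  proof (cases "first_edge b = e")
    case True
    from t(3) have "rel_mset replane (mset (branches b)) (mset (branches b'))"
      by (cases rule: replane.cases) (auto intro: list_all2_mset_rel rel_mset_Zero)
    then have "rel_mset replane_tree (image_mset (Planted r) (mset (branches b))) (image_mset (Planted r) (mset (branches b')))"
      unfolding multiset.rel_map
      by (rule multiset.rel_mono_strong) (auto intro: replane_tree.intros)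
    then show ?thesis using True fe by (simp add: t)
  next
    case False
    then show ?thesis
      using trunk_pieces_replane[OF t(3), of e] assms(2) \<open>e \<in> set (tree_edges t)\<close> fe
      by (auto simp: t intro!: rel_mset_Plus replane_tree.intros)
  qed
qed

lemma rel_replane_induct [consumes 1, case_names empty add]:
  assumes "rel_mset replane_tree F F'" "P {#} {#}"
    and "\<And>t t' F F'. replane_tree t t' \<Longrightarrow> rel_mset replane_tree F F' \<Longrightarrow> P F F' \<Longrightarrow>
      P (add_mset t F) (add_mset t' F')"
  shows "P F F'"
proof -
  obtain ts ts' where ts: "mset ts = F" "mset ts' = F'" "list_all2 replane_tree ts ts'"
    using assms(1) unfolding rel_mset_def by blast
  from ts(3) have "P (mset ts) (mset ts')"
  proof (induction rule: list_all2_induct)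
    case (Cons x xs y ys)
    then show ?case by (simp add: assms(3) list_all2_mset_rel)
  qed (simp add: assms(2))
  then show ?thesis by (simp add: ts)
qed

lemma contract_forest_replane:
  assumes "rel_mset replane_tree F F'" "\<forall>t\<in>#F. distinct (tree_edges t)"
  shows "rel_mset replane_tree (contract_forest e F) (contract_forest e F')"
  using assms
proof (induction rule: rel_replane_induct)
  case (add t t' F F')
  then show ?case
    by (simp add: contract_forest_def contract_tree_replane rel_mset_union)
qed (simp add: contract_forest_def rel_mset_Zero)

lemma distinct_trees: "t \<in># forest x \<Longrightarrow> distinct (tree_edges t)"
proof -
  assume t: "t \<in># forest x"
  obtain r b where [simp]: "t = Planted r b" by (cases t)
  let ?e = "first_edge b"
  have "?e \<in> set (orient x)"
    unfolding set_orient in_forest_edges using t by (intro bexI[of _ t]) auto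
  then obtain t' G where *: "forest x = add_mset t' G" "?e \<in> set (tree_edges t')"
      "?e \<notin># forest_edges G" "distinct (tree_edges t')"
    by (rule forest_split[OF valid])
  have "t \<notin># G" using *(3) by (auto simp: in_forest_edges)
  then have "t = t'" using t *(1) by auto
  then show ?thesis using *(4) by simp
qed

lemma finite_contractible [simp]: "finite (contractible x)"
  by (simp add: contractible_def)

lemma distinct_orient: "distinct (orient x)"
  using valid[of x] by (simp add: valid_def)

lemma single_smul: "Poly_Mapping.single x c = smul c (unit_at x)"
  by (simp add: smul_single)

lemma boundary_swap:
  assumes "forest x = forest y" "orient x = u @ a # b # v" "orient y = u @ b # a # v"
  shows "boundary x + boundary y \<in> tree_relations p"
proof -
  have C: "contractible y = contractible x"
    using assms by (auto simp: contractible_def)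
  let ?s = "\<lambda>e x. Poly_Mapping.single (contract e x) ((- 1 :: rat) ^ position e (orient x))"
  have d: "a \<noteq> b" "a \<notin> set u" "b \<notin> set u" "a \<notin> set v" "b \<notin> set v" "distinct u" "distinct v" "set u \<inter> set v = {}"
    using distinct_orient[of x] assms(2) by auto
  have "?s e x + ?s e y \<in> tree_relations p" if e: "e \<in> contractible x" for e
  proof (cases "e = a \<or> e = b")
    case True
    have "remove1 e (orient x) = remove1 e (orient y)"
      using True d by (auto simp: assms(2,3) remove1_append)
    then have "contract e x = contract e y"
      by (simp add: contract_def assms(1))
    moreover have "(- 1 :: rat) ^ position e (orient x) = - ((- 1) ^ position e (orient y))"
      using True d by (auto simp: assms(2,3) position_def takeWhile_append)
    ultimately show ?thesis
      by (simp add: rel_zero flip: single_add)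
  next
    case False
    have ey: "e \<in> contractible y" using e C by simp
    have "e \<in> set u \<or> e \<in> set v" using e False by (auto simp: contractible_def assms(2))
    then have "unit_at (contract e x) + unit_at (contract e y) \<in> tree_relations p"
    proof
      assume "e \<in> set u"
      then show ?thesis
        by (intro rel_swap[of _ _ "remove1 e u" a b v])
          (simp_all add: e ey forest_contract orient_contract assms remove1_append)
    next
      assume "e \<in> set v"
      then have "e \<notin> set u" using d by auto
      then show ?thesis using False
        by (intro rel_swap[of _ _ u a b "remove1 e v"])
          (simp_all add: e ey forest_contract orient_contract assms remove1_append)
    qed
    moreover have "position e (orient x) = position e (orient y)"
      using False by (auto simp: assms(2,3) position_def takeWhile_append)
    ultimately show ?thesis
      unfolding single_smul[of _ "_ ^ _"] by (simp add: rel_smul flip: smul_add_right)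
  qed
  then show ?thesis
    unfolding boundary_def C sum.distrib[symmetric] by (rule rel_sum)
qed

lemma position_map: "inj_on f (insert e (set w)) \<Longrightarrow> position (f e) (map f w) = position e w"
  unfolding position_def
  by (induction w) (auto simp: inj_on_def)

lemma remove1_map: "inj_on f (insert e (set w)) \<Longrightarrow> remove1 (f e) (map f w) = map f (remove1 e w)"
  by (induction w) (auto simp: inj_on_def)

lemma boundary_relabel:
  assumes inj: "inj_on f (set (orient x))" and y: "forest y = relabel f (forest x)" "orient y = map f (orient x)"
  shows "boundary x - boundary y \<in> tree_relations p"
proof -
  have inj': "inj_on f (insert e (set (orient x)))" if "e \<in> set (orient x)" for e
    using inj that by (simp add: insert_absorb)
  have single: "(\<exists>r s. Planted r (Leaf (f e) s) \<in># forest y) \<longleftrightarrow> (\<exists>r s. Planted r (Leaf e s) \<in># forest x)"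
    if e: "e \<in> set (orient x)" for e
  proof
    assume "\<exists>r s. Planted r (Leaf (f e) s) \<in># forest y"
    then obtain r s t where t: "t \<in># forest x" "Planted r (Leaf (f e) s) = map_named_tree f id t"
      by (auto simp: y relabel_def)
    then obtain r' e' s' where t': "t = Planted r' (Leaf e' s')" "f e' = f e"
      by (cases t; cases "case t of Planted r b \<Rightarrow> b") auto
    then have "e' \<in> set (orient x)" using t(1) by (force simp: set_orient in_forest_edges)
    then have "e' = e" using inj t' e by (auto dest: inj_onD)
    then show "\<exists>r s. Planted r (Leaf e s) \<in># forest x" using t t' by auto
  next
    assume "\<exists>r s. Planted r (Leaf e s) \<in># forest x"
    then obtain r s where "Planted r (Leaf e s) \<in># forest x" by blast
    then have "map_named_tree f id (Planted r (Leaf e s)) \<in># forest y"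
      unfolding y relabel_def set_image_mset by (rule imageI)
    then show "\<exists>r s. Planted r (Leaf (f e) s) \<in># forest y" by auto
  qed
  have C: "contractible y = f ` contractible x"
  proof (intro equalityI subsetI)
    fix e' assume e': "e' \<in> contractible y"
    then obtain e where e: "e' = f e" "e \<in> set (orient x)" by (auto simp: contractible_def y(2))
    then have "e \<in> contractible x" using single[OF e(2)] e' by (simp add: contractible_def)
    then show "e' \<in> f ` contractible x" using e by simp
  next
    fix e' assume "e' \<in> f ` contractible x"
    then obtain e where e: "e' = f e" "e \<in> contractible x" by blast
    then have "e \<in> set (orient x)" by (simp add: contractible_def)
    then show "e' \<in> contractible y" using single[of e] e by (simp add: contractible_def y(2))
  qed
  have "inj_on f (contractible x)"
    using inj by (rule inj_on_subset) (auto simp: contractible_def)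
  let ?s = "\<lambda>e x. Poly_Mapping.single (contract e x) ((- 1 :: rat) ^ position e (orient x))"
  have "boundary x - boundary y = (\<Sum>e\<in>contractible x. ?s e x - ?s (f e) y)"
    unfolding boundary_def C sum.reindex[OF \<open>inj_on f (contractible x)\<close>] by (simp add: sum_subtractf)
  also have "\<dots> \<in> tree_relations p"
  proof (rule rel_sum)
    fix e assume e: "e \<in> contractible x"
    then have eo: "e \<in> set (orient x)" by (simp add: contractible_def)
    have fe: "f e \<in> contractible y" using e C by simp
    have "unit_at (contract e x) - unit_at (contract (f e) y) \<in> tree_relations p"
    proof (rule rel_relabel[of f])
      show "inj_on f (set (orient (contract e x)))"
        using inj by (rule inj_on_subset) (simp add: e orient_contract set_remove1_subset)
      show "forest (contract (f e) y) = relabel f (forest (contract e x))"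
        using e fe inj'[OF eo] by (simp add: forest_contract y contract_forest_relabel set_orient)
      show "orient (contract (f e) y) = map f (orient (contract e x))"
        using e fe inj'[OF eo] by (simp add: orient_contract y remove1_map)
    qed
    then show "?s e x - ?s (f e) y \<in> tree_relations p"
      using position_map[OF inj'[OF eo]]
      unfolding single_smul[of _ "_ ^ _"] y by (simp add: rel_smul flip: smul_minus)
  qed
  finally show ?thesis .
qed

lemma boundary_replane:
  assumes p: "\<not> p" and F: "rel_mset replane_tree (forest x) (forest y)" and o: "orient x = orient y"
  shows "boundary x - boundary y \<in> tree_relations p"
proof -
  have single: "(\<exists>r s. Planted r (Leaf e s) \<in># F) \<longleftrightarrow> (\<exists>r s. Planted r (Leaf e s) \<in># F')"
    if "rel_mset replane_tree F F'" for e and F F' :: "'a tree multiset"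
    using that
  proof (induction rule: rel_replane_induct)
    case (add t t' F F')
    have "t = Planted r (Leaf e s) \<longleftrightarrow> t' = Planted r (Leaf e s)" for r s
      using add(1) by (auto elim!: replane_tree.cases replane.cases)
    with add(3) show ?case by (metis insertE insertI1 insertI2 set_mset_add_mset_insert)
  qed auto
  have C: "contractible y = contractible x"
    unfolding contractible_def o using single[OF F] by blast
  let ?s = "\<lambda>e x. Poly_Mapping.single (contract e x) ((- 1 :: rat) ^ position e (orient x))"
  have "?s e x - ?s e y \<in> tree_relations p" if e: "e \<in> contractible x" for e
  proof -
    have ey: "e \<in> contractible y" using e C by simp
    have "unit_at (contract e x) - unit_at (contract e y) \<in> tree_relations p"
      by (rule rel_replane[OF p])
        (use contract_forest_replane[OF F] distinct_trees[of _ x] in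
          \<open>simp_all add: e ey forest_contract orient_contract o\<close>)
    then show ?thesis
      unfolding single_smul[of _ "_ ^ _"] o by (simp add: rel_smul flip: smul_minus)
  qed
  then show ?thesis
    unfolding boundary_def C sum_subtractf[symmetric] by (rule rel_sum)
qed

lemma boundary_tree_relations:
  "x \<in> tree_relations p \<Longrightarrow> linext boundary x \<in> tree_relations p"
proof (induction rule: tree_relations.induct)
  case (rel_swap x y u a b v)
  then show ?case by (simp add: linext_add boundary_swap)
next
  case (rel_relabel f x y)
  then show ?case by (simp add: linext_diff boundary_relabel)
next
  case (rel_replane x y)
  then show ?case by (simp add: linext_diff boundary_replane)
qed (auto simp: linext_add linext_smul intro: tree_relations.intros)

lemma boundary_Leibniz:
  "boundary (x + y) - (boundary x * unit_at y + smul ((- 1) ^ length (orient x)) (unit_at x * boundary y))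
     \<in> tree_relations p"
proof -
  let ?b = "bound (orient x)"
  let ?s = "\<lambda>e x. Poly_Mapping.single (contract e x) ((- 1 :: rat) ^ position e (orient x))"
  have lt: "e < ?b" if "e \<in> set (orient x)" for e using that by (rule bound_gt)
  have emb: "Planted r (Leaf (?b + e) s) \<in># relabel ((+) ?b) F \<longleftrightarrow> Planted r (Leaf e s) \<in># F" for r e s F
  proof
    assume "Planted r (Leaf (?b + e) s) \<in># relabel ((+) ?b) F"
    then obtain t where t: "t \<in># F" "Planted r (Leaf (?b + e) s) = map_named_tree ((+) ?b) id t"
      by (auto simp: relabel_def)
    then have "t = Planted r (Leaf e s)"
      by (cases t; cases "case t of Planted r b \<Rightarrow> b") auto
    then show "Planted r (Leaf e s) \<in># F" using t by simp
  next
    assume "Planted r (Leaf e s) \<in># F"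
    then have "map_named_tree ((+) ?b) id (Planted r (Leaf e s)) \<in># relabel ((+) ?b) F"
      unfolding relabel_def set_image_mset by (rule imageI)
    then show "Planted r (Leaf (?b + e) s) \<in># relabel ((+) ?b) F" by simp
  qed
  have nr: "Planted r (Leaf e s) \<notin># relabel ((+) ?b) (forest y)" if "e < ?b" for r e s
  proof
    assume "Planted r (Leaf e s) \<in># relabel ((+) ?b) (forest y)"
    then have "e \<in># forest_edges (relabel ((+) ?b) (forest y))"
      unfolding in_forest_edges by (intro bexI) auto
    then show False using that by (auto simp: forest_edges_relabel)
  qed
  have nl: "Planted r (Leaf (?b + e) s) \<notin># forest x" for r e s
  proof
    assume "Planted r (Leaf (?b + e) s) \<in># forest x"
    then have "?b + e \<in> set (orient x)"
      unfolding set_orient in_forest_edges by (intro bexI) auto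
    then show False using lt by fastforce
  qed
  have C: "contractible (x + y) = contractible x \<union> (+) ?b ` contractible y"
    using lt by (auto simp: contractible_def forest_plus orient_plus nr nl emb image_iff)
  have disj: "contractible x \<inter> (+) ?b ` contractible y = {}"
    using lt by (fastforce simp: contractible_def)
  have inj: "inj_on ((+) ?b) A" for A by (rule inj_onI) simp
  have 1: "?s e (x + y) - ?s e x * unit_at y \<in> tree_relations p" if e: "e \<in> contractible x" for e
  proof -
    have ex: "e \<in> contractible (x + y)" using e C by simp
    have eo: "e \<in> set (orient x)" using e by (simp add: contractible_def)
    let ?b' = "bound (remove1 e (orient x))"
    define g where "g k = (if k < ?b then k else k - ?b + ?b')" for k
    have b': "k < ?b'" if "k \<in> set (remove1 e (orient x))" for k using that by (rule bound_gt)
    have o: "orient (contract e (x + y)) = remove1 e (orient x) @ map ((+) ?b) (orient y)"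
      using eo by (simp add: orient_contract[OF ex] orient_plus remove1_append)
    have "e \<notin># forest_edges (relabel ((+) ?b) (forest y))"
      using lt[OF eo] by (auto simp: forest_edges_relabel)
    then have f: "forest (contract e (x + y)) = forest (contract e x) + relabel ((+) ?b) (forest y)"
      by (simp add: forest_contract e ex forest_plus contract_forest_union contract_forest_notin)
    have gid: "g k = k" if "k \<in> set (remove1 e (orient x))" for k
      using that lt[of k] set_remove1_subset[of e "orient x"] by (auto simp: g_def)
    have "inj_on g (set (remove1 e (orient x)))"
      by (rule inj_onI) (simp add: gid)
    moreover have "inj_on g ((+) ?b ` set (orient y))"
      by (auto simp: inj_on_def g_def)
    moreover have "g ` set (remove1 e (orient x)) \<subseteq> {..<?b'}" "g ` (+) ?b ` set (orient y) \<subseteq> {?b'..}"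
      using b' by (auto simp: gid) (auto simp: g_def)
    then have "g ` set (remove1 e (orient x)) \<inter> g ` (+) ?b ` set (orient y) = {}"
      by fastforce
    ultimately have ig: "inj_on g (set (orient (contract e (x + y))))"
      by (simp add: o inj_on_Un) blast
    have "relabel g (forest (contract e x)) = forest (contract e x)"
      using relabel_cong[of "forest (contract e x)" g id]
      by (simp add: relabel_id gid orient_contract[OF e] flip: set_orient)
    moreover have "g \<circ> (+) ?b = (+) ?b'" by (auto simp: g_def)
    ultimately have "unit_at (contract e (x + y)) - unit_at (contract e x + y) \<in> tree_relations p"
      by (intro rel_relabel[OF ig])
        (simp_all add: f o forest_plus orient_plus orient_contract[OF e] relabel_add relabel_relabel
          gid map_idI)
    moreover have "position e (orient (x + y)) = position e (orient x)"
      using eo by (auto simp: position_def orient_plus takeWhile_append)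
    ultimately show ?thesis
      unfolding single_smul[of _ "_ ^ _"]
      by (simp add: rel_smul smul_mult_left mult_single flip: smul_minus)
  qed
  have 2: "?s (?b + e) (x + y) = smul ((- 1) ^ length (orient x)) (unit_at x * ?s e y)"
    if e: "e \<in> contractible y" for e
  proof -
    have ex: "?b + e \<in> contractible (x + y)" using e C by simp
    have ne: "?b + e \<notin> set (orient x)" using lt by fastforce
    have "contract (?b + e) (x + y) = x + contract e y"
    proof (rule oforest_eqI)
      have "?b + e \<notin># forest_edges (forest x)" using ne by (simp add: set_orient)
      then show "forest (contract (?b + e) (x + y)) = forest (x + contract e y)"
        using contract_forest_relabel[OF inj, of e "forest y"]
        by (simp add: forest_contract e ex forest_plus contract_forest_union contract_forest_notin)
      show "orient (contract (?b + e) (x + y)) = orient (x + contract e y)"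
        using ne remove1_map[OF inj, of e "orient y"]
        by (simp add: orient_contract e ex orient_plus remove1_append)
    qed
    moreover have "position (?b + e) (orient (x + y)) = length (orient x) + position e (orient y)"
    proof -
      have "takeWhile (\<lambda>e'. e' \<noteq> ?b + e) (orient x @ w) = orient x @ takeWhile (\<lambda>e'. e' \<noteq> ?b + e) w" for w
        using ne by (intro takeWhile_append2) auto
      then show ?thesis
        using position_map[OF inj, of e "orient y"] by (simp add: position_def orient_plus)
    qed
    ultimately show ?thesis
      by (simp add: mult_single smul_single power_add)
  qed
  have "boundary (x + y) - (boundary x * unit_at y + smul ((- 1) ^ length (orient x)) (unit_at x * boundary y)) =
      (\<Sum>e\<in>contractible x. ?s e (x + y) - ?s e x * unit_at y)"
    unfolding boundary_def C
    by (subst sum.union_disjoint[OF _ _ disj])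
      (simp_all add: sum.reindex[OF inj] 2 sum_subtractf sum_distrib_left sum_distrib_right smul_sum)
  also have "\<dots> \<in> tree_relations p"
    by (rule rel_sum) (rule 1)
  finally show ?thesis .
qed

subsection \<open>Algebras of trees\<close>

text \<open>
  In \<open>plane_tree_alg\<close> the cyclic orders at the internal vertices are part of the structure of a
  tree. In \<open>tree_alg\<close> two trees which differ only in the cyclic orders are the same, and a change of
  cyclic orders matters only through its effect on canonical orientations. The distinction is
  necessary since the differential \<open>\<partial>\<close> on polygons reverses the order of the sides of the polygons
  cut off by backward arrows, while the contraction of an edge retains the cyclic orders.
\<close>

quotient_type 'r plane_tree_alg = "'r oforest \<Rightarrow>\<^sub>0 rat" / "\<lambda>x y. x - y \<in> tree_relations True"
  by (rule rel.equivp)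

quotient_type 'r tree_alg = "'r oforest \<Rightarrow>\<^sub>0 rat" / "\<lambda>x y. x - y \<in> tree_relations False"
  by (rule rel.equivp)

instantiation plane_tree_alg :: (type) ring_1
begin

lift_definition zero_plane_tree_alg :: "'a plane_tree_alg" is 0 .
lift_definition one_plane_tree_alg :: "'a plane_tree_alg" is 1 .
lift_definition plus_plane_tree_alg :: "'a plane_tree_alg \<Rightarrow> 'a plane_tree_alg \<Rightarrow> 'a plane_tree_alg"
  is "(+)" by (rule rel.cong_add)
lift_definition minus_plane_tree_alg :: "'a plane_tree_alg \<Rightarrow> 'a plane_tree_alg \<Rightarrow> 'a plane_tree_alg"
  is "(-)" by (rule rel.cong_diff)
lift_definition uminus_plane_tree_alg :: "'a plane_tree_alg \<Rightarrow> 'a plane_tree_alg"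
  is "uminus" by (rule rel.cong_uminus)
lift_definition times_plane_tree_alg :: "'a plane_tree_alg \<Rightarrow> 'a plane_tree_alg \<Rightarrow> 'a plane_tree_alg"
  is "(*)" by (rule rel.cong_mult)

instance
proof
  show "(0 :: 'a plane_tree_alg) \<noteq> 1"
    by transfer (use lookup_tree_relations[of "- 1" True] in \<open>auto simp: lookup_one\<close>)
qed (transfer; simp add: algebra_simps rel.zero)+

end

instantiation tree_alg :: (type) ring_1
begin

lift_definition zero_tree_alg :: "'a tree_alg" is 0 .
lift_definition one_tree_alg :: "'a tree_alg" is 1 .
lift_definition plus_tree_alg :: "'a tree_alg \<Rightarrow> 'a tree_alg \<Rightarrow> 'a tree_alg"
  is "(+)" by (rule rel.cong_add)
lift_definition minus_tree_alg :: "'a tree_alg \<Rightarrow> 'a tree_alg \<Rightarrow> 'a tree_alg"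
  is "(-)" by (rule rel.cong_diff)
lift_definition uminus_tree_alg :: "'a tree_alg \<Rightarrow> 'a tree_alg"
  is "uminus" by (rule rel.cong_uminus)
lift_definition times_tree_alg :: "'a tree_alg \<Rightarrow> 'a tree_alg \<Rightarrow> 'a tree_alg"
  is "(*)" by (rule rel.cong_mult)

instance
proof
  show "(0 :: 'a tree_alg) \<noteq> 1"
    by transfer (use lookup_tree_relations[of "- 1" False] in \<open>auto simp: lookup_one\<close>)
qed (transfer; simp add: algebra_simps rel.zero)+

end

lift_definition plane_tree_scale :: "rat \<Rightarrow> 'r plane_tree_alg \<Rightarrow> 'r plane_tree_alg" is smul
  by (rule rel.cong_smul)

lift_definition tree_scale :: "rat \<Rightarrow> 'r tree_alg \<Rightarrow> 'r tree_alg" is smul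
  by (rule rel.cong_smul)

interpretation plane_tree_alg: vector_space plane_tree_scale
  by standard (transfer; simp add: smul_add_left smul_add_right smul_smul rel.zero)+

interpretation tree_alg: vector_space tree_scale
  by standard (transfer; simp add: smul_add_left smul_add_right smul_smul rel.zero)+

lift_definition plane_class :: "'r oforest \<Rightarrow> 'r plane_tree_alg" is "\<lambda>x. Poly_Mapping.single x 1" .

lift_definition tree_class :: "'r oforest \<Rightarrow> 'r tree_alg" is "\<lambda>x. Poly_Mapping.single x 1" .

lift_definition plane_tree_diff :: "'r plane_tree_alg \<Rightarrow> 'r plane_tree_alg" is "linext boundary"
  unfolding linext_diff[symmetric] by (rule boundary_tree_relations)

lift_definition tree_diff :: "'r tree_alg \<Rightarrow> 'r tree_alg" is "linext boundary"
  unfolding linext_diff[symmetric] by (rule boundary_tree_relations)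

lemma plane_tree_diff_Leibniz:
  "plane_tree_diff (plane_class x * plane_class y) = plane_tree_diff (plane_class x) * plane_class y +
     plane_tree_scale ((- 1) ^ length (orient x)) (plane_class x * plane_tree_diff (plane_class y))"
  by transfer (use boundary_Leibniz in \<open>simp add: mult_single\<close>)

lemma tree_diff_Leibniz:
  "tree_diff (tree_class x * tree_class y) = tree_diff (tree_class x) * tree_class y +
     tree_scale ((- 1) ^ length (orient x)) (tree_class x * tree_diff (tree_class y))"
  by transfer (use boundary_Leibniz in \<open>simp add: mult_single\<close>)

definition plane_tree_piece :: "nat \<Rightarrow> 'r plane_tree_alg set" where
  "plane_tree_piece m = abs_plane_tree_alg ` {x. \<forall>y\<in>Poly_Mapping.keys x. length (orient y) = m}"

definition tree_piece :: "nat \<Rightarrow> 'r tree_alg set" where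
  "tree_piece m = abs_tree_alg ` {x. \<forall>y\<in>Poly_Mapping.keys x. length (orient y) = m}"

definition plane_tree_dga :: "'r plane_tree_alg dga" where
  "plane_tree_dga = \<lparr>scalar = plane_tree_scale, piece = plane_tree_piece, diff = plane_tree_diff\<rparr>"

definition tree_dga :: "'r tree_alg dga" where
  "tree_dga = \<lparr>scalar = tree_scale, piece = tree_piece, diff = tree_diff\<rparr>"

lemma tree_relations_mono: "x \<in> tree_relations True \<Longrightarrow> x \<in> tree_relations False"
  by (induction rule: tree_relations.induct) (auto intro: tree_relations.intros)

lift_definition forget_plane :: "'r plane_tree_alg \<Rightarrow> 'r tree_alg" is "\<lambda>x. x"
  by (rule tree_relations_mono)

lemma forget_plane_dga_hom:
  "dga_hom plane_tree_dga tree_dga (forget_plane :: 'a plane_tree_alg \<Rightarrow> 'a tree_alg)"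
proof -
  have "Vector_Spaces.linear plane_tree_scale tree_scale (forget_plane :: 'a plane_tree_alg \<Rightarrow> _)"
    by unfold_locales (transfer; simp add: rel.zero)+
  moreover have "forget_plane (1 :: 'a plane_tree_alg) = 1" "forget_plane (x * y) = forget_plane x * forget_plane y"
      "forget_plane (plane_tree_diff x) = tree_diff (forget_plane x)" for x y :: "'a plane_tree_alg"
    by (transfer; simp add: rel.zero)+
  moreover have "forget_plane ` (plane_tree_piece m :: 'a plane_tree_alg set) \<subseteq> tree_piece m" for m
    by (auto simp: plane_tree_piece_def tree_piece_def forget_plane.abs_eq)
  ultimately show ?thesis
    by (simp add: dga_hom_def alg_hom_def plane_tree_dga_def tree_dga_def)
qed


section \<open>Triangulations and dual trees\<close>

text \<open>
  For \<open>i < j\<close>, the pair \<open>(i, j)\<close> stands for the segment joining the vertices \<open>v\<^sub>i\<close> and \<open>v\<^sub>j\<close> of an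
  \<open>(n+1)\<close>-gon with vertices \<open>v\<^sub>0, \<dots>, v\<^sub>n\<close>. The sides are \<open>(i, i + 1)\<close> and the root side \<open>(0, n)\<close>.
\<close>

definition diagonals :: "'r polygon \<Rightarrow> (nat \<times> nat) set" where
  "diagonals \<pi> = {(i, j). i + 2 \<le> j \<and> j \<le> weight \<pi> \<and> (i, j) \<noteq> (0, weight \<pi>)}"

definition cross :: "nat \<times> nat \<Rightarrow> nat \<times> nat \<Rightarrow> bool" where
  "cross D E \<longleftrightarrow> (case (D, E) of ((i, j), (k, l)) \<Rightarrow> (i < k \<and> k < j \<and> j < l) \<or> (k < i \<and> i < l \<and> l < j))"

definition triangulations :: "'r polygon \<Rightarrow> (nat \<times> nat) set set" where
  "triangulations \<pi> = {T. T \<subseteq> diagonals \<pi> \<and> (\<forall>D\<in>T. \<forall>E\<in>T. \<not> cross D E) \<and>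
     (\<forall>D\<in>diagonals \<pi> - T. \<exists>E\<in>T. cross D E)}"

text \<open>
  \<open>dual_branch as T i j\<close> is the part of the dual tree that is separated from the root by the segment
  \<open>(i, j)\<close>. It starts with the edge dual to \<open>(i, j)\<close>, whose name encodes this pair. If \<open>j = i + 1\<close>,
  it ends in a leaf; otherwise it leads to the vertex dual to the triangle with vertices \<open>v\<^sub>i\<close>,
  \<open>v\<^sub>k\<close>, \<open>v\<^sub>j\<close> where \<open>i < k < j\<close>, and its cyclic order is that of the segments \<open>(i, j)\<close>, \<open>(i, k)\<close>,
  \<open>(k, j)\<close>.
\<close>

definition segment :: "(nat \<times> nat) set \<Rightarrow> nat \<Rightarrow> nat \<Rightarrow> bool" where
  "segment T i j \<longleftrightarrow> j = i + 1 \<or> (i, j) \<in> T"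

definition apex :: "(nat \<times> nat) set \<Rightarrow> nat \<Rightarrow> nat \<Rightarrow> nat" where
  "apex T i j = (THE k. i < k \<and> k < j \<and> segment T i k \<and> segment T k j)"

function dual_branch :: "'r list \<Rightarrow> (nat \<times> nat) set \<Rightarrow> nat \<Rightarrow> nat \<Rightarrow> 'r branch" where
  "dual_branch as T i j =
     (let k = apex T i j in
      if i < k \<and> k < j
      then Node (prod_encode (i, j)) [dual_branch as T i k, dual_branch as T k j]
      else Leaf (prod_encode (i, j)) (as ! i))"
  by pat_completeness auto
termination
  by (relation "measure (\<lambda>(as, T, i, j). j - i)") auto

declare dual_branch.simps [simp del]

definition dual_tree :: "'r polygon \<Rightarrow> (nat \<times> nat) set \<Rightarrow> 'r tree" where
  "dual_tree \<pi> T = Planted (last (sides \<pi>)) (dual_branch (sides \<pi>) T 0 (weight \<pi>))"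

definition canonically_oriented :: "'r tree \<Rightarrow> 'r oforest" where
  "canonically_oriented t = OForest ({#t#}, tree_edges t)"

definition triangulation_sum :: "'r polygon \<Rightarrow> 'r plane_tree_alg" where
  "triangulation_sum \<pi> = (\<Sum>T\<in>triangulations \<pi>. plane_class (canonically_oriented (dual_tree \<pi> T)))"

lemma dual_branch_edges:
  assumes "i < j"
  shows "distinct (branch_edges (dual_branch as T i j)) \<and> wf_branch (dual_branch as T i j) \<and>
    set (branch_edges (dual_branch as T i j)) \<subseteq> prod_encode ` {(a, b). i \<le> a \<and> a < b \<and> b \<le> j}"
  using assms
proof (induction as T i j rule: dual_branch.induct)
  case (1 as T i j)
  define k where "k = apex T i j"
  show ?case
  proof (cases "i < k \<and> k < j")
    case True
    then have "i < apex T i j \<and> apex T i j < j" by (simp add: k_def)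
    note IH = 1(1)[OF refl this] 1(2)[OF refl this]
    let ?l = "branch_edges (dual_branch as T i k)" and ?r = "branch_edges (dual_branch as T k j)"
    have l: "distinct ?l" "wf_branch (dual_branch as T i k)"
        "set ?l \<subseteq> prod_encode ` {(a, b). i \<le> a \<and> a < b \<and> b \<le> k}"
      and r: "distinct ?r" "wf_branch (dual_branch as T k j)"
        "set ?r \<subseteq> prod_encode ` {(a, b). k \<le> a \<and> a < b \<and> b \<le> j}"
      using IH True by (auto simp: k_def)
    have "prod_encode ` {(a, b). i \<le> a \<and> a < b \<and> b \<le> k} \<inter> prod_encode ` {(a, b). k \<le> a \<and> a < b \<and> b \<le> j} = {}"
      by auto
    then have "set ?l \<inter> set ?r = {}" using l(3) r(3) by blast
    moreover have "prod_encode (i, j) \<notin> set ?l" "prod_encode (i, j) \<notin> set ?r"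
      using l(3) r(3) True by auto
    moreover have "set ?l \<union> set ?r \<union> {prod_encode (i, j)} \<subseteq> prod_encode ` {(a, b). i \<le> a \<and> a < b \<and> b \<le> j}"
    proof (intro Un_least)
      show "set ?l \<subseteq> prod_encode ` {(a, b). i \<le> a \<and> a < b \<and> b \<le> j}"
        by (rule subset_trans[OF l(3)]) (use True in auto)
      show "set ?r \<subseteq> prod_encode ` {(a, b). i \<le> a \<and> a < b \<and> b \<le> j}"
        by (rule subset_trans[OF r(3)]) (use True in auto)
      show "{prod_encode (i, j)} \<subseteq> prod_encode ` {(a, b). i \<le> a \<and> a < b \<and> b \<le> j}"
        using 1(3) by auto
    qed
    moreover have "dual_branch as T i j =
        Node (prod_encode (i, j)) [dual_branch as T i k, dual_branch as T k j]"
      using True by (subst dual_branch.simps) (simp add: Let_def k_def)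
    ultimately show ?thesis
      using l(1,2) r(1,2) by (simp del: prod_encode_eq)
  next
    case False
    then have "dual_branch as T i j = Leaf (prod_encode (i, j)) (as ! i)"
      by (subst dual_branch.simps) (auto simp: Let_def k_def)
    then show ?thesis
      using 1(3) by auto
  qed
qed

lemma forest_canonically_oriented_dual_tree:
  "forest (canonically_oriented (dual_tree \<pi> T)) = {#dual_tree \<pi> T#}"
  "orient (canonically_oriented (dual_tree \<pi> T)) = tree_edges (dual_tree \<pi> T)"
proof -
  have "0 < weight \<pi>" using sides[of \<pi>] by (simp add: weight_def)
  from dual_branch_edges[OF this, of "sides \<pi>" T]
  have "valid {#dual_tree \<pi> T#} (tree_edges (dual_tree \<pi> T))"
    by (simp add: valid_def dual_tree_def)
  then show "forest (canonically_oriented (dual_tree \<pi> T)) = {#dual_tree \<pi> T#}"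
    "orient (canonically_oriented (dual_tree \<pi> T)) = tree_edges (dual_tree \<pi> T)"
    by (simp_all add: canonically_oriented_def forest_OForest orient_OForest)
qed

end

theory Submission
  imports Defs
begin

text \<open>
  Triangulations of a polygon with non-root sides \<open>a\<^sub>1, \<dots>, a\<^sub>n\<close> correspond to binary trees with
  leaves \<open>a\<^sub>1, \<dots>, a\<^sub>n\<close>. An edge of a binary tree other than the first one is given by a context and
  one of the two branches of the fork put into its hole. In the sum over all trees, the contraction
  of an internal edge on the left of a fork, \<open>((x y) z)\<close>, cancels against that of one on the right,
  \<open>(x (y z))\<close>, as every branch has an odd number of edges. The contraction of the edge of a leaf \<open>s\<close>
  in a fork \<open>(s y)\<close> or \<open>(y s)\<close> leaves the context filled with \<open>s\<close> and a tree \<open>y\<close> with root \<open>s\<close>, which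
  are dual to the root polygon and the cut-off polygon of a backward or forward arrow; the contraction
  of the root edge accounts for the arrows to the root side. This gives the claim for the bar
  differential. Up to the cyclic orders, a tree with \<open>m\<close> leaves equals \<open>(- 1)\<^bsup>m - 1\<^esup>\<close> times its mirror
  image, since each of its \<open>m - 1\<close> forks swaps two blocks of odd length in the canonical orientation;
  so the two differentials have the same image.
\<close>

section \<open>Signs of reorderings\<close>

text \<open>Edges have names and forests are multisets, so two representatives of one class are
  rarely equal. Every comparison rests on two reductions: forests listed tree by tree in canonical
  order agree up to renaming as soon as their shapes agree (\<open>sim_same_shape\<close>), and
  other orderings are brought to this form by swapping blocks (\<open>sim_blocks\<close>). The signs
  then come from parities alone. A trivalent tree with \<open>m\<close> leaves has
  \<open>2 * m - 1\<close> edges, and a context has an even number. When a leaf edge of the fork in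
  the hole of \<open>c\<close> is contracted, its position is \<open>edges_before c + 1\<close> for
  a left edge and has the parity of \<open>edges_before c\<close> for a right one; the odd block of
  the tree split off passes the \<open>edges_after c\<close> later edges. The total sign is -1 on
  the left and 1 on the right, which is \<open>arrow_sign\<close> of the backward or forward
  arrow.\<close>

definition sim :: "bool \<Rightarrow> rat \<Rightarrow> 'r oforest \<Rightarrow> 'r oforest \<Rightarrow> bool" where
  "sim p c x y \<longleftrightarrow> unit_at x - smul c (unit_at y) \<in> tree_relations p"

lemma sim_refl: "sim p 1 x x"
  by (simp add: sim_def rel_zero)

lemma sim_trans:
  assumes "sim p c x y" "sim p d y z"
  shows "sim p (c * d) x z"
proof -
  have "unit_at x - smul (c * d) (unit_at z) =
      (unit_at x - smul c (unit_at y)) + smul c (unit_at y - smul d (unit_at z))"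
    by (simp add: smul_minus smul_smul)
  then show ?thesis
    unfolding sim_def by (rule ssubst) (intro rel_add rel_smul assms[unfolded sim_def])
qed

lemma valid_reorder: "valid F \<omega> \<Longrightarrow> mset \<omega> = mset \<omega>' \<Longrightarrow> valid F \<omega>'"
  using mset_eq_imp_distinct_iff[of \<omega> \<omega>'] by (simp add: valid_def)

lemma sim_transpose:
  assumes "valid F (u @ a # b # v)"
  shows "sim p (- 1) (OForest (F, u @ a # b # v)) (OForest (F, u @ b # a # v))"
proof -
  have "valid F (u @ b # a # v)"
    by (rule valid_reorder[OF assms]) simp
  then show ?thesis
    using assms unfolding sim_def
    by (simp add: rel_swap[of _ _ u a b v] forest_OForest orient_OForest)
qed

lemma sim_move:
  assumes "valid F (u @ a # w @ v)"
  shows "sim p ((- 1) ^ length w) (OForest (F, u @ a # w @ v)) (OForest (F, u @ w @ a # v))"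
  using assms
proof (induction w arbitrary: u)
  case (Cons b w)
  have v: "valid F ((u @ [b]) @ a # w @ v)"
    by (rule valid_reorder[OF Cons.prems]) simp
  have "sim p (- 1) (OForest (F, u @ a # b # w @ v)) (OForest (F, u @ b # a # w @ v))"
    by (rule sim_transpose) (use Cons.prems in simp)
  from sim_trans[OF this, of "(- 1) ^ length w"] show ?case
    using Cons.IH[OF v] by simp
qed (simp add: sim_refl)

text \<open>The letters of \<open>x\<close>, the last one first, each pass the whole block
  \<open>w\<close>. All later reorderings are instances of this, so only the parities of the two
  lengths matter; \<open>p\<close> stays free because the reversal argument needs the same signs in
  the algebra without cyclic orders.\<close>

lemma sim_blocks:
  assumes "valid F (u @ x @ w @ v)"
  shows "sim p ((- 1) ^ (length x * length w)) (OForest (F, u @ x @ w @ v)) (OForest (F, u @ w @ x @ v))"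
  using assms
proof (induction x arbitrary: u)
  case (Cons a x)
  have v: "valid F (u @ a # w @ x @ v)"
    by (rule valid_reorder[OF Cons.prems]) simp
  have "sim p ((- 1) ^ (length x * length w)) (OForest (F, (u @ [a]) @ x @ w @ v)) (OForest (F, (u @ [a]) @ w @ x @ v))"
    by (rule Cons.IH) (use Cons.prems in simp)
  from sim_trans[OF this, of "(- 1) ^ length w"] show ?case
    using sim_move[OF v] by (simp add: power_add mult.commute)
qed (simp add: sim_refl)

section \<open>Renaming the edges\<close>

text \<open>The isomorphism type of a plane branch: names are erased, while decorations and cyclic
  orders stay.\<close>

definition shape :: "'r branch \<Rightarrow> (unit, 'r) named_branch" where
  "shape b = map_named_branch (\<lambda>_. ()) id b"

lemma shape_simps [simp]:
  "shape (Leaf e r) = Leaf () r"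
  "shape (Node e bs) = Node () (map shape bs)"
  by (simp_all add: shape_def[abs_def])

lemma shape_map [simp]: "shape (map_named_branch f id b) = shape b"
  by (simp add: shape_def named_branch.map_comp o_def id_def)

text \<open>Giving all edges the same name factors through the shape. The name 0 is used because
  \<open>branch_edges\<close> expects names in \<open>nat\<close>.\<close>

lemma length_edges_shape:
  assumes "shape b = shape b'"
  shows "length (branch_edges b) = length (branch_edges b')"
proof -
  have "length (branch_edges b) = length (branch_edges (map_named_branch (\<lambda>_. 0) id (shape b)))" for b :: "'a branch"
    by (simp add: shape_def named_branch.map_comp o_def branch_edges_map)
  then show ?thesis using assms by metis
qed

text \<open>A branch can be rebuilt from its shape and its edges in canonical order: equal shapes
  force the concatenated edge lists of the children to break at the same places.\<close>

lemma map_branch_eqI: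
  "shape b = shape b' \<Longrightarrow> map f (branch_edges b) = branch_edges b' \<Longrightarrow> map_named_branch f id b = b'"
proof (induction b arbitrary: b')
  case (Leaf e r)
  then show ?case by (cases b') auto
next
  case (Node e bs)
  from Node.prems(1) obtain e' bs' where b': "b' = Node e' bs'" and sh: "map shape bs = map shape bs'"
    by (cases b') auto
  have e: "f e = e'" and "map f (concat (map branch_edges bs)) = concat (map branch_edges bs')"
    using Node.prems(2) by (auto simp: b')
  from this(2) sh Node.IH have "map (map_named_branch f id) bs = bs'"
  proof (induction bs arbitrary: bs')
    case (Cons c cs)
    from Cons.prems(2) obtain c' cs' where bs': "bs' = c' # cs'" and c: "shape c = shape c'" "map shape cs = map shape cs'"
      by (cases bs') auto
    have "length (branch_edges c) = length (branch_edges c')"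
      using c(1) by (rule length_edges_shape)
    then have "map f (branch_edges c) = branch_edges c'"
        "map f (concat (map branch_edges cs)) = concat (map branch_edges cs')"
      using Cons.prems(1) by (auto simp: bs')
    then show ?case
      using Cons.IH[of cs'] Cons.prems(3) c by (auto simp: bs')
  qed simp
  then show ?case using e by (simp add: b' id_def)
qed

primrec tree_shape :: "'r tree \<Rightarrow> 'r \<times> (unit, 'r) named_branch" where
  "tree_shape (Planted r b) = (r, shape b)"

lemma map_trees_eqI:
  "map tree_shape ts = map tree_shape ts' \<Longrightarrow>
   map f (concat (map tree_edges ts)) = concat (map tree_edges ts') \<Longrightarrow> map (map_named_tree f id) ts = ts'"
proof (induction ts arbitrary: ts')
  case (Cons t ts)
  obtain r b where t: "t = Planted r b" by (cases t)
  obtain r' b' us where ts': "ts' = Planted r' b' # us"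
    using Cons.prems(1) by (cases ts'; cases "hd ts'") auto
  have sh: "r = r'" "shape b = shape b'" "map tree_shape ts = map tree_shape us"
    using Cons.prems(1) by (auto simp: t ts')
  then have "map f (branch_edges b) = branch_edges b'"
      "map f (concat (map tree_edges ts)) = concat (map tree_edges us)"
    using Cons.prems(2) length_edges_shape[OF sh(2)] by (auto simp: t ts')
  then show ?case
    using Cons.IH[OF sh(3)] map_branch_eqI[OF sh(2), of f] sh by (simp add: t ts' id_def)
qed simp

text \<open>Matching the two edge lists position by position is a bijection of names, as both lists
  are distinct, and by the equality of shapes it is an isomorphism of the forests.\<close>

lemma sim_same_shape:
  assumes v: "valid (mset ts) (concat (map tree_edges ts))" "valid (mset ts') (concat (map tree_edges ts'))"
    and sh: "map tree_shape ts = map tree_shape ts'"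
  shows "sim p 1 (OForest (mset ts, concat (map tree_edges ts))) (OForest (mset ts', concat (map tree_edges ts')))"
proof -
  let ?u = "concat (map tree_edges ts)" and ?v = "concat (map tree_edges ts')"
  have d: "distinct ?u" "distinct ?v" using v unfolding valid_def by blast+
  have "length ?u = length ?v"
    using sh
  proof (induction ts arbitrary: ts')
    case (Cons t ts)
    obtain r b where t: "t = Planted r b" by (cases t)
    obtain r' b' us where ts': "ts' = Planted r' b' # us"
      using Cons.prems(1) by (cases ts'; cases "hd ts'") auto
    show ?case
      using Cons.IH[of us] Cons.prems length_edges_shape[of b b'] by (simp add: t ts')
  qed simp
  define f where "f e = the (map_of (zip ?u ?v) e)" for e
  have f: "map f ?u = ?v"
    using \<open>length ?u = length ?v\<close> d by (intro nth_equalityI) (auto simp: f_def map_of_zip_nth simp del: map_concat)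
  then have "inj_on f (set ?u)" using d by (metis distinct_map)
  then have "unit_at (OForest (mset ts, ?u)) - unit_at (OForest (mset ts', ?v)) \<in> tree_relations p"
    using v f map_trees_eqI[OF sh f]
    by (intro rel_relabel[of f]) (simp_all add: forest_OForest orient_OForest relabel_def flip: mset_map)
  then show ?thesis by (simp add: sim_def)
qed

text \<open>The product shifts the names in its second factor, so a forest produced by a contraction
  is not literally a product; this identifies the two up to renaming.\<close>

lemma canonical_product:
  assumes "wf_tree s" "distinct (tree_edges s)" "wf_tree t" "distinct (tree_edges t)"
    and "valid {#s, t'#} (tree_edges s @ tree_edges t')" "tree_shape t = tree_shape t'"
  shows "sim p 1 (OForest ({#s, t'#}, tree_edges s @ tree_edges t')) (canonically_oriented s + canonically_oriented t)"
proof -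
  let ?f = "(+) (bound (tree_edges s))"
  let ?t = "map_named_tree ?f id t"
  have v: "valid {#s#} (tree_edges s)" "valid {#t#} (tree_edges t)"
    using assms(1-4) by (simp_all add: valid_def)
  have "canonically_oriented s + canonically_oriented t = OForest ({#s, ?t#}, tree_edges s @ tree_edges ?t)"
    using v by (simp add: plus_oforest_def canonically_oriented_def forest_OForest orient_OForest
        relabel_def tree_edges_map add_mset_commute)
  moreover have "valid {#s, ?t#} (tree_edges s @ tree_edges ?t)"
    using valid_plus[OF v] by (simp add: relabel_def tree_edges_map add_mset_commute)
  moreover have "tree_shape ?t = tree_shape t'"
    using assms(6) by (cases t; cases t') auto
  ultimately show ?thesis
    using sim_same_shape[of "[s, t']" "[s, ?t]" p] assms(5) by simp
qed

lemma sim_canonical: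
  assumes "wf_tree t" "distinct (tree_edges t)" "wf_tree t'" "distinct (tree_edges t')" "tree_shape t = tree_shape t'"
  shows "sim p 1 (canonically_oriented t) (canonically_oriented t')"
  using sim_same_shape[of "[t]" "[t']" p] assms by (simp add: canonically_oriented_def valid_def)

section \<open>Binary trees and contexts\<close>

text \<open>Trivalent branches without names, so that sums over trees have an index set with plain
  equality.\<close>

datatype 'r btree = Tip 'r | Fork "'r btree" "'r btree"

primrec leaves :: "'r btree \<Rightarrow> 'r list" where
  "leaves (Tip r) = [r]"
| "leaves (Fork x y) = leaves x @ leaves y"

text \<open>Every tip and every fork accounts for the edge above it, so the edge leading into the
  tree is included.\<close>

primrec edge_count :: "'r btree \<Rightarrow> nat" where
  "edge_count (Tip r) = 1"
| "edge_count (Fork x y) = 1 + edge_count x + edge_count y"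

text \<open>The edges are numbered in the order of the canonical orientation.\<close>

primrec numbered :: "nat \<Rightarrow> 'r btree \<Rightarrow> 'r branch" where
  "numbered n (Tip r) = Leaf n r"
| "numbered n (Fork x y) = Node n [numbered (Suc n) x, numbered (Suc n + edge_count x) y]"

lemma leaves_ne [simp]: "leaves t \<noteq> []"
  by (induction t) auto

lemma edge_count_leaves: "edge_count t + 1 = 2 * length (leaves t)"
  by (induction t) auto

lemma odd_edge_count [simp]: "odd (edge_count t)"
  by (induction t) auto

lemma leaves_length_pos: "1 \<le> length (leaves t)"
  by (simp add: Suc_le_eq)

lemma edge_count_pos [simp]: "0 < edge_count t"
  by (cases t) auto

lemma edge_count_neq_0 [simp]: "edge_count t \<noteq> 0"
  by (cases t) auto

lemma upt_append: "i \<le> j \<Longrightarrow> j \<le> k \<Longrightarrow> [i..<j] @ [j..<k] = [i..<k]"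
  by (metis le_add_diff_inverse upt_add_eq_append)

lemma branch_edges_numbered [simp]: "branch_edges (numbered n t) = [n..<n + edge_count t]"
proof (induction t arbitrary: n)
  case (Fork x y)
  have "[n..<n + edge_count (Fork x y)] = n # [Suc n..<Suc n + edge_count x + edge_count y]"
    by (subst upt_conv_Cons) (simp_all add: add.assoc)
  also have "[Suc n..<Suc n + edge_count x + edge_count y] =
      [Suc n..<Suc n + edge_count x] @ [Suc n + edge_count x..<Suc n + edge_count x + edge_count y]"
    by (rule upt_append[symmetric]) auto
  finally show ?case
    by (simp only: numbered.simps branch_edges.simps list.map concat.simps Fork append_Nil2)
qed simp

lemma wf_branch_numbered [simp]: "wf_branch (numbered n t)"
  by (induction t arbitrary: n) auto

lemma first_edge_numbered [simp]: "first_edge (numbered n t) = n"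
  by (cases t) auto

primrec unnumbered :: "'r btree \<Rightarrow> (unit, 'r) named_branch" where
  "unnumbered (Tip r) = Leaf () r"
| "unnumbered (Fork x y) = Node () [unnumbered x, unnumbered y]"

lemma shape_numbered [simp]: "shape (numbered n t) = unnumbered t"
  by (induction t arbitrary: n) auto

lemma inj_unnumbered: "unnumbered s = unnumbered t \<Longrightarrow> s = t"
proof (induction s arbitrary: t)
  case (Tip r)
  then show ?case by (cases t) auto
next
  case (Fork x y)
  then show ?case by (cases t) auto
qed

text \<open>A fork cuts its list of leaves into two shorter nonempty lists, which leaves finitely
  many choices at each length.\<close>

lemma finite_leaves: "finite {t. leaves t = as}"
proof (induction as rule: length_induct)
  case (1 as)
  let ?T = "\<lambda>bs. {t. leaves t = bs}"
  have "?T as \<subseteq> Tip ` set as \<union> (\<Union>k\<in>{1..<length as}. (\<lambda>(x, y). Fork x y) ` (?T (take k as) \<times> ?T (drop k as)))"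
  proof
    fix t assume "t \<in> ?T as"
    then have t: "leaves t = as" by simp
    show "t \<in> Tip ` set as \<union> (\<Union>k\<in>{1..<length as}. (\<lambda>(x, y). Fork x y) ` (?T (take k as) \<times> ?T (drop k as)))"
    proof (cases t)
      case (Tip r)
      then show ?thesis using t by auto
    next
      case (Fork x y)
      then have "as = leaves x @ leaves y" using t by simp
      moreover have "1 \<le> length (leaves x)" "1 \<le> length (leaves y)"
        by (simp_all add: Suc_le_eq)
      ultimately show ?thesis
        using Fork by (intro UnI2 UN_I[of "length (leaves x)"]) auto
    qed
  qed
  moreover have "finite (?T (take k as))" "finite (?T (drop k as))" if "k \<in> {1..<length as}" for k
    using 1 that by auto
  ultimately show ?case
    by (elim finite_subset) (auto intro!: finite_imageI)
qed

section \<open>One-hole contexts as positions of edges and forks\<close>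

datatype 'r ctx = Hole | CtxL "'r ctx" "'r btree" | CtxR "'r btree" "'r ctx"

primrec plug :: "'r ctx \<Rightarrow> 'r btree \<Rightarrow> 'r btree" where
  "plug Hole t = t"
| "plug (CtxL c y) t = Fork (plug c t) y"
| "plug (CtxR x c) t = Fork x (plug c t)"

primrec leaves_before :: "'r ctx \<Rightarrow> 'r list" where
  "leaves_before Hole = []"
| "leaves_before (CtxL c y) = leaves_before c"
| "leaves_before (CtxR x c) = leaves x @ leaves_before c"

primrec leaves_after :: "'r ctx \<Rightarrow> 'r list" where
  "leaves_after Hole = []"
| "leaves_after (CtxL c y) = leaves_after c @ leaves y"
| "leaves_after (CtxR x c) = leaves_after c"

text \<open>The edge leading into the hole belongs to the filling and is not counted here. In a
  numbering from \<open>n\<close> it therefore has the number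
  \<open>n + edges_before c\<close>.\<close>

primrec edges_before :: "'r ctx \<Rightarrow> nat" where
  "edges_before Hole = 0"
| "edges_before (CtxL c y) = Suc (edges_before c)"
| "edges_before (CtxR x c) = Suc (edge_count x + edges_before c)"

primrec edges_after :: "'r ctx \<Rightarrow> nat" where
  "edges_after Hole = 0"
| "edges_after (CtxL c y) = edges_after c + edge_count y"
| "edges_after (CtxR x c) = edges_after c"

lemma leaves_plug: "leaves (plug c t) = leaves_before c @ leaves t @ leaves_after c"
  by (induction c) auto

lemma edge_count_plug: "edge_count (plug c t) = edges_before c + edge_count t + edges_after c"
  by (induction c) auto

text \<open>Each step towards the hole adds one edge above a fork and one sibling branch, whose
  number of edges is odd.\<close>

lemma even_edges_ctx: "even (edges_before c + edges_after c)"
  by (induction c) auto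

text \<open>
  \<open>numbered_ctx n m c b\<close> numbers the edges of the context \<open>c\<close> from \<open>n\<close>, with \<open>m\<close> numbers reserved
  for the edges of the branch \<open>b\<close> put into the hole.
\<close>

primrec numbered_ctx :: "nat \<Rightarrow> nat \<Rightarrow> 'r ctx \<Rightarrow> 'r branch \<Rightarrow> 'r branch" where
  "numbered_ctx n m Hole b = b"
| "numbered_ctx n m (CtxL c y) b =
     Node n [numbered_ctx (Suc n) m c b, numbered (Suc n + edges_before c + m + edges_after c) y]"
| "numbered_ctx n m (CtxR x c) b =
     Node n [numbered (Suc n) x, numbered_ctx (Suc n + edge_count x) m c b]"

lemma numbered_plug:
  "numbered n (plug c t) = numbered_ctx n (edge_count t) c (numbered (n + edges_before c) t)"
  by (induction c arbitrary: n) (auto simp: edge_count_plug algebra_simps)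

lemma branch_edges_numbered_ctx:
  "branch_edges (numbered_ctx n m c b) = [n..<n + edges_before c] @ branch_edges b @
     [n + edges_before c + m..<n + edges_before c + m + edges_after c]"
proof (induction c arbitrary: n)
  case (CtxL c y)
  let ?k = "Suc n + edges_before c + m"
  have "[n..<n + edges_before (CtxL c y)] = n # [Suc n..<Suc n + edges_before c]"
    by (subst upt_conv_Cons) (simp_all add: add.assoc)
  moreover have "[?k..<?k + (edges_after c + edge_count y)] =
      [?k..<?k + edges_after c] @ [?k + edges_after c..<?k + (edges_after c + edge_count y)]"
    by (rule upt_append[symmetric]) auto
  ultimately show ?case
    by (simp add: CtxL add.assoc del: upt_Suc)
next
  case (CtxR x c)
  have "[n..<n + edges_before (CtxR x c)] = n # [Suc n..<Suc n + edge_count x + edges_before c]"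
    by (subst upt_conv_Cons) (simp_all add: add.assoc)
  also have "[Suc n..<Suc n + edge_count x + edges_before c] =
      [Suc n..<Suc n + edge_count x] @ [Suc n + edge_count x..<Suc n + edge_count x + edges_before c]"
    by (rule upt_append[symmetric]) auto
  finally have "[n..<n + edges_before (CtxR x c)] =
      n # [Suc n..<Suc n + edge_count x] @ [Suc n + edge_count x..<Suc n + edge_count x + edges_before c]" .
  moreover have "n + edges_before (CtxR x c) = Suc n + edge_count x + edges_before c" by simp
  ultimately show ?case
    by (simp only: numbered_ctx.simps branch_edges.simps list.map concat.simps CtxR append_Nil2
        branch_edges_numbered append_assoc append_Cons edges_after.simps)
qed simp

lemma wf_numbered_ctx: "wf_branch (numbered_ctx n m c b) \<longleftrightarrow> wf_branch b"
  by (induction c arbitrary: n) auto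

lemma first_edge_numbered_ctx:
  "first_edge b = n + edges_before c \<Longrightarrow> first_edge (numbered_ctx n m c b) = n"
  by (cases c) auto

lemma shape_numbered_ctx:
  "shape b = shape b' \<Longrightarrow> shape (numbered_ctx n m c b) = shape (numbered_ctx n' m' c b')"
  by (induction c arbitrary: n n') auto

text \<open>Contraction is local: an edge strictly inside the filling has a name different from all
  those in the sibling branches, so the context is only carried along. The first edge of the filling
  is excluded because its contraction would alter the context itself.\<close>

lemma trunk_pieces_numbered_ctx:
  assumes "first_edge b = n + edges_before c" "set (branch_edges b) \<subseteq> {n + edges_before c..<n + edges_before c + m}"
    "e \<in> set (branch_edges b)" "e \<noteq> first_edge b"
  shows "trunk e (numbered_ctx n m c b) = numbered_ctx n m c (trunk e b) \<and>
    pieces e (numbered_ctx n m c b) = pieces e b"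
  using assms
proof (induction c arbitrary: n)
  case (CtxL c y)
  let ?z = "numbered (Suc n + edges_before c + m + edges_after c) y"
  have e: "e \<in> {Suc n + edges_before c..<Suc n + edges_before c + m}" "e \<noteq> Suc n + edges_before c"
    using CtxL.prems by auto
  then have f: "first_edge (numbered_ctx (Suc n) m c b) \<noteq> e"
    using CtxL.prems(1) by (subst first_edge_numbered_ctx) auto
  have IH: "trunk e (numbered_ctx (Suc n) m c b) = numbered_ctx (Suc n) m c (trunk e b)"
      "pieces e (numbered_ctx (Suc n) m c b) = pieces e b"
    using CtxL.IH[of "Suc n"] CtxL.prems by auto
  have "\<forall>b\<in>set [] \<union> set [?z]. e \<notin> set (branch_edges b)"
    using e by auto
  from trunk_pieces_split(5,6)[OF this f, of n] show ?case
    by (simp only: append_Nil numbered_ctx.simps IH)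
next
  case (CtxR x c)
  let ?x = "numbered (Suc n) x" and ?c = "numbered_ctx (Suc n + edge_count x) m c"
  have e: "e \<in> {Suc n + edge_count x + edges_before c..<Suc n + edge_count x + edges_before c + m}"
      "e \<noteq> Suc n + edge_count x + edges_before c"
    using CtxR.prems by auto
  then have f: "first_edge (?c b) \<noteq> e"
    using CtxR.prems(1) by (subst first_edge_numbered_ctx) auto
  have IH: "trunk e (?c b) = ?c (trunk e b)" "pieces e (?c b) = pieces e b"
    using CtxR.IH[of "Suc n + edge_count x"] CtxR.prems by (auto simp: add.assoc)
  have "\<forall>b\<in>set [?x] \<union> set []. e \<notin> set (branch_edges b)"
    using e by auto
  from trunk_pieces_split(5,6)[OF this f, of n] show ?case
    by (simp only: append_Nil append_Cons numbered_ctx.simps IH)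
qed simp

text \<open>The internal vertices of \<open>t\<close>: the context records where the vertex lies,
  which also tells equal subtrees apart.\<close>

definition forks :: "'r btree \<Rightarrow> ('r ctx \<times> 'r btree \<times> 'r btree) set" where
  "forks t = {(c, x, y). plug c (Fork x y) = t}"

lemma forks_Tip [simp]: "forks (Tip r) = {}"
proof -
  have "plug c (Fork x y) \<noteq> Tip r" for c and x y :: "'a btree" by (cases c) auto
  then show ?thesis by (auto simp: forks_def)
qed

lemma forks_Fork:
  "forks (Fork x y) = {(Hole, x, y)} \<union> (\<lambda>(c, u). (CtxL c y, u)) ` forks x \<union> (\<lambda>(c, u). (CtxR x c, u)) ` forks y"
    (is "_ = ?R")
proof (intro equalityI subsetI)
  fix z assume "z \<in> forks (Fork x y)"
  then obtain c u v where z: "z = (c, u, v)" "plug c (Fork u v) = Fork x y" by (auto simp: forks_def)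
  then show "z \<in> ?R" by (cases c) (auto simp: forks_def image_iff)
qed (auto simp: forks_def)

lemma finite_forks: "finite (forks t)"
  by (induction t) (auto simp: forks_Fork)

text \<open>Apart from the first one, the edges of a tree come in pairs of siblings.\<close>

lemma sum_edges:
  fixes g :: "nat \<Rightarrow> 'b::comm_monoid_add"
  shows "(\<Sum>e\<in>{Suc n..<n + edge_count t}. g e) =
    (\<Sum>(c, x, y)\<in>forks t. g (Suc (n + edges_before c)) + g (Suc (n + edges_before c + edge_count x)))"
proof (induction t arbitrary: n)
  case (Fork x y)
  let ?f = "\<lambda>n (c, x, y). g (Suc (n + edges_before c)) + g (Suc (n + edges_before c + edge_count x))"
  have inj: "inj_on (\<lambda>a. (CtxL (fst a) y, snd a)) (forks x)" "inj_on (\<lambda>a. (CtxR x (fst a), snd a)) (forks y)"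
    by (auto intro!: inj_onI)
  \<comment> \<open>\<open>Suc n\<close> and \<open>Suc n + edge_count x\<close> are the first edges
    of the two branches; \<open>?X\<close> and \<open>?Y\<close> are the ranges to which the
    induction hypotheses apply.\<close>
  let ?X = "{Suc (Suc n)..<Suc n + edge_count x}"
    and ?Y = "{Suc (Suc n + edge_count x)..<Suc n + edge_count x + edge_count y}"
  have "{Suc n..<n + edge_count (Fork x y)} = insert (Suc n) ?X \<union> insert (Suc n + edge_count x) ?Y"
    using edge_count_pos[of x] edge_count_pos[of y] by (auto simp del: edge_count_pos)
  moreover have "insert (Suc n) ?X \<inter> insert (Suc n + edge_count x) ?Y = {}"
    using edge_count_pos[of x] by (auto simp del: edge_count_pos)
  ultimately have "(\<Sum>e\<in>{Suc n..<n + edge_count (Fork x y)}. g e) =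
      sum g (insert (Suc n) ?X) + sum g (insert (Suc n + edge_count x) ?Y)"
    by (simp only: sum.union_disjoint finite_insert finite_atLeastLessThan)
  also have "\<dots> = g (Suc n) + sum g ?X + (g (Suc n + edge_count x) + sum g ?Y)"
    by (subst (1 2) sum.insert) auto
  also have "\<dots> = ?f n (Hole, x, y) + sum (?f (Suc n)) (forks x) + sum (?f (Suc n + edge_count x)) (forks y)"
    unfolding Fork.IH by (simp add: algebra_simps)
  also have "sum (?f (Suc n)) (forks x) = sum (?f n) ((\<lambda>(c, u). (CtxL c y, u)) ` forks x)"
    by (simp add: sum.reindex[OF inj(1)] o_def split_def)
  also have "sum (?f (Suc n + edge_count x)) (forks y) = sum (?f n) ((\<lambda>(c, u). (CtxR x c, u)) ` forks y)"
    by (simp add: sum.reindex[OF inj(2)] o_def split_def add.assoc)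
  also have "?f n (Hole, x, y) + sum (?f n) ((\<lambda>(c, u). (CtxL c y, u)) ` forks x) +
      sum (?f n) ((\<lambda>(c, u). (CtxR x c, u)) ` forks y) = sum (?f n) (forks (Fork x y))"
    unfolding forks_Fork
    by (subst sum.union_disjoint) (auto simp: finite_forks sum.insert_if)
  finally show ?case .
qed simp

section \<open>The boundary of a trivalent tree\<close>

declare upt_Suc [simp del]

lemma plane_class_sim: "sim True c x y \<Longrightarrow> plane_class x = plane_tree_scale c (plane_class y)"
  unfolding sim_def by transfer

lemma plane_class_plus: "plane_class (x + y) = plane_class x * plane_class y"
  by transfer (simp add: mult_single rel.zero)

lemma abs_plane_tree_alg_sum: "abs_plane_tree_alg (sum f A) = (\<Sum>a\<in>A. abs_plane_tree_alg (f a))"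
  by (induction A rule: infinite_finite_induct)
    (simp_all add: zero_plane_tree_alg.abs_eq plus_plane_tree_alg.abs_eq[symmetric])

lemma abs_plane_tree_alg_single:
  "abs_plane_tree_alg (Poly_Mapping.single x c) = plane_tree_scale c (plane_class x)"
  by (simp add: plane_class.abs_eq plane_tree_scale.abs_eq smul_single)

lemma plane_tree_diff_class:
  "plane_tree_diff (plane_class x) =
    (\<Sum>e\<in>contractible x. plane_tree_scale ((- 1) ^ position e (orient x)) (plane_class (contract e x)))"
proof -
  have "plane_tree_diff (plane_class x) = abs_plane_tree_alg (boundary x)"
    by (simp add: plane_class.abs_eq plane_tree_diff.abs_eq)
  then show ?thesis
    by (simp only: boundary_def abs_plane_tree_alg_sum abs_plane_tree_alg_single)
qed

definition trivalent :: "'r \<Rightarrow> 'r btree \<Rightarrow> 'r oforest" where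
  "trivalent r t = canonically_oriented (Planted r (numbered 0 t))"

definition gen :: "'r \<Rightarrow> 'r btree \<Rightarrow> 'r plane_tree_alg" where
  "gen r t = plane_class (trivalent r t)"

lemma valid_tree: "wf_branch b \<Longrightarrow> distinct (branch_edges b) \<Longrightarrow> valid {#Planted r b#} (branch_edges b)"
  by (simp add: valid_def)

lemma forest_trivalent [simp]: "forest (trivalent r t) = {#Planted r (numbered 0 t)#}"
  and orient_trivalent [simp]: "orient (trivalent r t) = [0..<edge_count t]"
  using valid_tree[of "numbered 0 t" r]
  by (simp_all add: trivalent_def canonically_oriented_def forest_OForest orient_OForest)

lemma gen_eqI:
  assumes "wf_branch b" "distinct (branch_edges b)" "shape b = unnumbered t"
  shows "plane_class (canonically_oriented (Planted r b)) = gen r t"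
proof -
  have "sim True 1 (canonically_oriented (Planted r b)) (trivalent r t)"
    unfolding trivalent_def by (rule sim_canonical) (use assms in auto)
  then show ?thesis by (simp add: gen_def plane_class_sim)
qed

text \<open>The tree with one four-valent vertex, placed in the hole of \<open>c\<close>: the common
  contraction of \<open>((x y) z)\<close> and \<open>(x (y z))\<close>.\<close>

definition tetravalent :: "'r \<Rightarrow> 'r ctx \<Rightarrow> 'r btree \<Rightarrow> 'r btree \<Rightarrow> 'r btree \<Rightarrow> 'r plane_tree_alg" where
  "tetravalent r c x y z = plane_class (canonically_oriented (Planted r
     (numbered_ctx 0 (1 + edge_count x + edge_count y + edge_count z) c
       (let n = edges_before c in Node n [numbered (Suc n) x, numbered (Suc n + edge_count x) y,
         numbered (Suc n + edge_count x + edge_count y) z]))))"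

lemma tetravalent_eqI:
  assumes "wf_branch b" "distinct (branch_edges b)"
    and "shape b = shape (numbered_ctx 0 m c (Node n [numbered i x, numbered j y, numbered k z]))"
  shows "plane_class (canonically_oriented (Planted r b)) = tetravalent r c x y z"
proof -
  let ?n = "edges_before c"
  let ?z = "Node ?n [numbered (Suc ?n) x, numbered (Suc ?n + edge_count x) y,
         numbered (Suc ?n + edge_count x + edge_count y) z]"
  let ?b = "numbered_ctx 0 (1 + edge_count x + edge_count y + edge_count z) c ?z"
  have "shape ?b = shape b"
    unfolding assms(3) by (rule shape_numbered_ctx) simp
  moreover have "wf_branch ?b" by (simp add: wf_numbered_ctx)
  moreover have "distinct (branch_edges ?b)"
    by (auto simp: branch_edges_numbered_ctx)
  ultimately have "sim True 1 (canonically_oriented (Planted r b)) (canonically_oriented (Planted r ?b))"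
    by (intro sim_canonical) (use assms in auto)
  then show ?thesis by (simp add: tetravalent_def Let_def plane_class_sim)
qed

lemma contractible_trivalent:
  "contractible (trivalent r (Tip s)) = {}"
  "contractible (trivalent r (Fork x y)) = {0..<edge_count (Fork x y)}"
  by (auto simp: contractible_def)

lemma position_trivalent:
  assumes "e < edge_count t"
  shows "position e (orient (trivalent r t)) = e"
proof -
  have "[0..<edge_count t] = [0..<e] @ [e..<edge_count t]"
    using assms by (simp add: upt_append)
  also have "[e..<edge_count t] = e # [Suc e..<edge_count t]"
    using assms by (rule upt_conv_Cons)
  finally have "[0..<edge_count t] = [0..<e] @ e # [Suc e..<edge_count t]" .
  then show ?thesis
    by (simp add: position_def takeWhile_append)
qed

lemma contract_trivalent:
  "contract e (trivalent r t) =
    OForest (contract_tree e (Planted r (numbered 0 t)), remove1 e [0..<edge_count t])"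
  by (simp add: contract_def contract_forest_def del: contract_tree.simps)

text \<open>The edges of the piece that splits off stand between the blocks \<open>u\<close> and
  \<open>v\<close> of the remaining tree. Moving this block of odd length to the end costs one sign
  for each edge in \<open>v\<close> and gives the orientation of the product.\<close>

lemma split_contraction:
  assumes e: "e \<in> contractible (trivalent r t)"
    and F: "contract_tree e (Planted r (numbered 0 t)) = {#Planted r b, Planted s (numbered k y)#}"
    and b: "branch_edges b = u @ v" "shape b = unnumbered x"
    and o: "remove1 e [0..<edge_count t] = u @ [k..<k + edge_count y] @ v"
  shows "plane_class (contract e (trivalent r t)) = plane_tree_scale ((- 1) ^ length v) (gen r x * gen s y)"
proof -
  let ?F = "{#Planted r b, Planted s (numbered k y)#}" and ?y = "[k..<k + edge_count y]"
  have C: "contract e (trivalent r t) = OForest (?F, u @ ?y @ v)"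
    by (simp only: contract_trivalent F o)
  have v: "valid ?F (u @ ?y @ v)"
    using valid_contract[OF e] by (simp only: forest_trivalent orient_trivalent o contract_forest_def
        image_mset_single sum_mset.singleton F)
  then have v': "valid ?F (u @ v @ ?y)"
    by (rule valid_reorder) simp
  have wf: "wf_branch b" "distinct (branch_edges b)"
    using v' b by (auto simp: valid_def)
  have "odd (length ?y)" by simp
  then have "(- 1 :: rat) ^ (length ?y * length v) = (- 1) ^ length v"
    by (simp add: power_mult)
  then have "sim True ((- 1) ^ length v) (OForest (?F, u @ ?y @ v)) (OForest (?F, u @ v @ ?y))"
    using sim_blocks[of ?F u ?y v "[]" True] v by simp
  moreover have "sim True 1 (OForest (?F, u @ v @ ?y)) (canonically_oriented (Planted r b) + trivalent s y)"
    using canonical_product[of "Planted r b" "Planted s (numbered 0 y)" "Planted s (numbered k y)" True]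
      wf v' b by (simp add: trivalent_def)
  ultimately have "plane_class (contract e (trivalent r t)) =
      plane_tree_scale ((- 1) ^ length v * 1) (plane_class (canonically_oriented (Planted r b) + trivalent s y))"
    unfolding C by (intro plane_class_sim) (rule sim_trans)
  then show ?thesis
    by (simp add: plane_class_plus gen_eqI[OF wf b(2)] flip: gen_def)
qed

text \<open>No sign occurs here: deleting an internal edge from the canonical list leaves the
  canonical list of the contracted tree.\<close>

lemma internal_contraction:
  assumes e: "e \<in> contractible (trivalent r t)"
    and F: "contract_tree e (Planted r (numbered 0 t)) = {#Planted r b#}"
    and o: "remove1 e [0..<edge_count t] = branch_edges b"
    and sh: "shape b = shape (numbered_ctx 0 m c (Node n [numbered i x, numbered j y, numbered k z]))"
  shows "plane_class (contract e (trivalent r t)) = tetravalent r c x y z"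
proof -
  have C: "contract e (trivalent r t) = canonically_oriented (Planted r b)"
    by (simp only: contract_trivalent F o canonically_oriented_def tree_edges.simps)
  have "valid {#Planted r b#} (branch_edges b)"
    using valid_contract[OF e] by (simp only: forest_trivalent orient_trivalent o contract_forest_def
        image_mset_single sum_mset.singleton F)
  then have "wf_branch b" "distinct (branch_edges b)" by (auto simp: valid_def)
  then show ?thesis unfolding C using sh by (rule tetravalent_eqI)
qed

lemma contract_tree_plug:
  assumes "edges_before c < e" "e < edges_before c + edge_count u"
  shows "contract_tree e (Planted r (numbered 0 (plug c u))) =
    add_mset (Planted r (numbered_ctx 0 (edge_count u) c (trunk e (numbered (edges_before c) u))))
      (mset (pieces e (numbered (edges_before c) u)))"
proof -
  let ?b = "numbered (edges_before c) u"
  have "trunk e (numbered_ctx 0 (edge_count u) c ?b) = numbered_ctx 0 (edge_count u) c (trunk e ?b) \<and>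
      pieces e (numbered_ctx 0 (edge_count u) c ?b) = pieces e ?b"
    by (rule trunk_pieces_numbered_ctx) (use assms in auto)
  then show ?thesis
    using assms by (simp add: numbered_plug first_edge_numbered_ctx)
qed

text \<open>\<open>left_term\<close> and \<open>right_term\<close> are the signed contributions of
  the two edges below the fork in the hole of \<open>c\<close>; the last argument is the branch
  whose first edge is contracted. The two edges are an odd number of positions apart, namely
  \<open>edge_count\<close> of the left branch, hence the opposite signs of the
  \<open>tetravalent\<close> terms.\<close>

primrec left_term :: "'r \<Rightarrow> 'r ctx \<Rightarrow> 'r btree \<Rightarrow> 'r btree \<Rightarrow> 'r plane_tree_alg" where
  "left_term r c y (Tip s) = - (gen r (plug c (Tip s)) * gen s y)"
| "left_term r c y (Fork x x') = - plane_tree_scale ((- 1) ^ edges_before c) (tetravalent r c x x' y)"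

primrec right_term :: "'r \<Rightarrow> 'r ctx \<Rightarrow> 'r btree \<Rightarrow> 'r btree \<Rightarrow> 'r plane_tree_alg" where
  "right_term r c x (Tip s) = gen r (plug c (Tip s)) * gen s x"
| "right_term r c x (Fork y y') = plane_tree_scale ((- 1) ^ edges_before c) (tetravalent r c x y y')"

lemma contract_left_edge:
  fixes c :: "'r ctx"
  assumes "t = plug c (Fork x y)" "e = Suc (edges_before c)"
  shows "plane_tree_scale ((- 1) ^ e) (plane_class (contract e (trivalent r t))) = left_term r c y x"
proof -
  let ?n = "edges_before c" and ?m = "edge_count (Fork x y)"
  let ?b = "numbered ?n (Fork x y)" and ?y = "numbered (Suc ?n + edge_count x) y"
  have t: "numbered 0 t = numbered_ctx 0 ?m c ?b"
    using numbered_plug[of 0 c "Fork x y"] assms by simp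
  have N: "[0..<edge_count t] = [0..<?n] @ branch_edges ?b @ [?n + ?m..<?n + ?m + edges_after c]"
    using branch_edges_numbered_ctx[of 0 ?m c ?b] by (simp only: branch_edges_numbered add_0 flip: t)
  have "e < edge_count t" using assms by (simp add: edge_count_plug)
  moreover have "\<exists>x y. t = Fork x y" using assms by (cases c) auto
  ultimately have e: "e \<in> contractible (trivalent r t)"
    by (auto simp: contractible_trivalent)
  have F: "contract_tree e (Planted r (numbered 0 t)) =
      add_mset (Planted r (numbered_ctx 0 ?m c (trunk e ?b))) (mset (pieces e ?b))"
    unfolding assms(1) by (rule contract_tree_plug) (use assms in \<open>simp_all\<close>)
  have y: "\<forall>b\<in>set [] \<union> set [?y]. e \<notin> set (branch_edges b)"
    using assms by auto
  note split = trunk_pieces_split[OF y, where f = ?n]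
  show ?thesis
  proof (cases x)
    case (Tip s)
    have b: "?b = Node ?n ([] @ Leaf e s # [?y])" using Tip assms by simp
    have "plane_class (contract e (trivalent r t)) =
        plane_tree_scale ((- 1) ^ length [?n + ?m..<?n + ?m + edges_after c]) (gen r (plug c (Tip s)) * gen s y)"
    proof (rule split_contraction[OF e])
      show "contract_tree e (Planted r (numbered 0 t)) =
          {#Planted r (numbered_ctx 0 ?m c (Leaf ?n s)), Planted s ?y#}"
        unfolding F b split by simp
      \<comment> \<open>\<open>[?n]\<close> is the edge above the fork; after the contraction it
        ends in the leaf \<open>s\<close>.\<close>
      show "branch_edges (numbered_ctx 0 ?m c (Leaf ?n s)) = ([0..<?n] @ [?n]) @ [?n + ?m..<?n + ?m + edges_after c]"
        by (simp add: branch_edges_numbered_ctx)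
      show "shape (numbered_ctx 0 ?m c (Leaf ?n s)) = unnumbered (plug c (Tip s))"
        unfolding shape_numbered[of 0, symmetric] numbered_plug by (rule shape_numbered_ctx) simp
      show "remove1 e [0..<edge_count t] = ([0..<?n] @ [?n]) @
          [Suc ?n + edge_count x..<Suc ?n + edge_count x + edge_count y] @ [?n + ?m..<?n + ?m + edges_after c]"
        unfolding N b using assms by (simp add: remove1_append)
    qed
    \<comment> \<open>The position of \<open>e\<close> gives one factor, the passage of the piece
      over the later edges of the context the other.\<close>
    moreover have "odd (e + edges_after c)" using even_edges_ctx[of c] assms by simp
    then have "(- 1 :: rat) ^ e * (- 1) ^ edges_after c = - 1"
      by (simp flip: power_add)
    ultimately show ?thesis
      by (simp add: Tip)
  next
    case (Fork x1 x2)
    let ?xs = "[numbered (Suc e) x1, numbered (Suc e + edge_count x1) x2]"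
    have b: "?b = Node ?n ([] @ Node e ?xs # [?y])" using Fork assms by simp
    have n: "e \<notin> set (concat (map branch_edges ?xs))" by simp
    have "plane_class (contract e (trivalent r t)) = tetravalent r c x1 x2 y"
    proof (rule internal_contraction[OF e])
      show "contract_tree e (Planted r (numbered 0 t)) = {#Planted r (numbered_ctx 0 ?m c (Node ?n (?xs @ [?y])))#}"
        unfolding F b split(3) split(4)[OF n] by simp
      show "remove1 e [0..<edge_count t] = branch_edges (numbered_ctx 0 ?m c (Node ?n (?xs @ [?y])))"
        unfolding N b branch_edges_numbered_ctx using assms by (simp add: remove1_append)
      show "shape (numbered_ctx 0 ?m c (Node ?n (?xs @ [?y]))) =
          shape (numbered_ctx 0 ?m c (Node ?n [numbered (Suc e) x1, numbered (Suc e + edge_count x1) x2, ?y]))"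
        by simp
    qed
    then show ?thesis by (simp add: Fork assms)
  qed
qed

lemma contract_right_edge:
  fixes c :: "'r ctx"
  assumes "t = plug c (Fork x y)" "e = Suc (edges_before c + edge_count x)"
  shows "plane_tree_scale ((- 1) ^ e) (plane_class (contract e (trivalent r t))) = right_term r c x y"
proof -
  let ?n = "edges_before c" and ?m = "edge_count (Fork x y)"
  let ?b = "numbered ?n (Fork x y)" and ?x = "numbered (Suc ?n) x"
  have t: "numbered 0 t = numbered_ctx 0 ?m c ?b"
    using numbered_plug[of 0 c "Fork x y"] assms by simp
  have N: "[0..<edge_count t] = [0..<?n] @ branch_edges ?b @ [?n + ?m..<?n + ?m + edges_after c]"
    using branch_edges_numbered_ctx[of 0 ?m c ?b] by (simp only: branch_edges_numbered add_0 flip: t)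
  have "e < edge_count t" using assms by (simp add: edge_count_plug)
  moreover have "\<exists>x y. t = Fork x y" using assms by (cases c) auto
  ultimately have e: "e \<in> contractible (trivalent r t)"
    by (auto simp: contractible_trivalent)
  have F: "contract_tree e (Planted r (numbered 0 t)) =
      add_mset (Planted r (numbered_ctx 0 ?m c (trunk e ?b))) (mset (pieces e ?b))"
    unfolding assms(1) by (rule contract_tree_plug) (use assms in \<open>simp_all\<close>)
  have x: "\<forall>b\<in>set [?x] \<union> set []. e \<notin> set (branch_edges b)"
    using assms by auto
  note split = trunk_pieces_split[OF x, where f = ?n]
  show ?thesis
  proof (cases y)
    case (Tip s)
    have b: "?b = Node ?n ([?x] @ Leaf e s # [])" using Tip assms by simp
    have "plane_class (contract e (trivalent r t)) =
        plane_tree_scale ((- 1) ^ length [?n + ?m..<?n + ?m + edges_after c]) (gen r (plug c (Tip s)) * gen s x)"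
    proof (rule split_contraction[OF e])
      show "contract_tree e (Planted r (numbered 0 t)) =
          {#Planted r (numbered_ctx 0 ?m c (Leaf ?n s)), Planted s ?x#}"
        unfolding F b split by simp
      show "branch_edges (numbered_ctx 0 ?m c (Leaf ?n s)) = ([0..<?n] @ [?n]) @ [?n + ?m..<?n + ?m + edges_after c]"
        by (simp add: branch_edges_numbered_ctx)
      show "shape (numbered_ctx 0 ?m c (Leaf ?n s)) = unnumbered (plug c (Tip s))"
        unfolding shape_numbered[of 0, symmetric] numbered_plug by (rule shape_numbered_ctx) simp
      show "remove1 e [0..<edge_count t] = ([0..<?n] @ [?n]) @
          [Suc ?n..<Suc ?n + edge_count x] @ [?n + ?m..<?n + ?m + edges_after c]"
        unfolding N b using assms by (simp add: remove1_append)
    qed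
    moreover have "even (e + edges_after c)" using even_edges_ctx[of c] assms by simp
    then have "(- 1 :: rat) ^ e * (- 1) ^ edges_after c = 1"
      by (simp flip: power_add)
    ultimately show ?thesis
      by (simp add: Tip)
  next
    case (Fork y1 y2)
    let ?ys = "[numbered (Suc e) y1, numbered (Suc e + edge_count y1) y2]"
    have b: "?b = Node ?n ([?x] @ Node e ?ys # [])" using Fork assms by simp
    have n: "e \<notin> set (concat (map branch_edges ?ys))" by simp
    have "plane_class (contract e (trivalent r t)) = tetravalent r c x y1 y2"
    proof (rule internal_contraction[OF e])
      show "contract_tree e (Planted r (numbered 0 t)) = {#Planted r (numbered_ctx 0 ?m c (Node ?n ([?x] @ ?ys)))#}"
        unfolding F b split(3) split(4)[OF n] by simp
      show "remove1 e [0..<edge_count t] = branch_edges (numbered_ctx 0 ?m c (Node ?n ([?x] @ ?ys)))"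
        unfolding N b branch_edges_numbered_ctx using assms by (simp add: remove1_append)
      show "shape (numbered_ctx 0 ?m c (Node ?n ([?x] @ ?ys))) =
          shape (numbered_ctx 0 ?m c (Node ?n [?x, numbered (Suc e) y1, numbered (Suc e + edge_count y1) y2]))"
        by simp
    qed
    \<comment> \<open>\<open>edge_count x\<close> is odd, so \<open>e\<close> and \<open>?n\<close>
      have the same parity.\<close>
    moreover have "(- 1 :: rat) ^ e = (- 1) ^ ?n"
      using assms by (simp add: power_add)
    ultimately show ?thesis by (simp add: Fork)
  qed
qed

text \<open>The root edge comes first in the canonical order. Without it, the edges of
  \<open>x\<close> and \<open>y\<close> already stand in the order of the product.\<close>

lemma contract_root_edge: "plane_class (contract 0 (trivalent r (Fork x y))) = gen r x * gen r y"
proof -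
  let ?x = "numbered (Suc 0) x" and ?y = "numbered (Suc (edge_count x)) y"
  let ?F = "{#Planted r ?x, Planted r ?y#}"
  have "[Suc 0..<Suc (edge_count x)] @ [Suc (edge_count x)..<edge_count (Fork x y)] = [Suc 0..<edge_count (Fork x y)]"
    by (rule upt_append) auto
  then have o: "[0..<edge_count (Fork x y)] =
      0 # tree_edges (Planted r ?x) @ tree_edges (Planted r ?y)"
    by (subst upt_conv_Cons) simp_all
  have e: "0 \<in> contractible (trivalent r (Fork x y))" by (simp add: contractible_trivalent)
  have C: "contract 0 (trivalent r (Fork x y)) = OForest (?F, tree_edges (Planted r ?x) @ tree_edges (Planted r ?y))"
    unfolding contract_trivalent o by simp
  have "valid ?F (tree_edges (Planted r ?x) @ tree_edges (Planted r ?y))"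
    using valid_contract[OF e] unfolding orient_trivalent o by (simp add: contract_forest_def)
  then have "sim True 1 (contract 0 (trivalent r (Fork x y)))
      (canonically_oriented (Planted r ?x) + trivalent r y)"
    unfolding C unfolding trivalent_def by (intro canonical_product) auto
  from plane_class_sim[OF this] show ?thesis
    by (simp add: plane_class_plus gen_eqI flip: gen_def)
qed

primrec root_term :: "'r \<Rightarrow> 'r btree \<Rightarrow> 'r plane_tree_alg" where
  "root_term r (Tip s) = 0"
| "root_term r (Fork x y) = gen r x * gen r y"

text \<open>The edges other than the root edge are grouped into sibling pairs, one pair for each
  fork. A one-edge tree has no fork and differential 0, in accordance with
  \<open>root_term\<close>.\<close>

lemma plane_tree_diff_gen:
  "plane_tree_diff (gen r t) = root_term r t + (\<Sum>(c, x, y)\<in>forks t. left_term r c y x + right_term r c x y)"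
proof (cases t)
  case (Tip s)
  then show ?thesis by (simp add: gen_def plane_tree_diff_class contractible_trivalent)
next
  case (Fork x y)
  let ?g = "\<lambda>e. plane_tree_scale ((- 1) ^ e) (plane_class (contract e (trivalent r t)))"
  have "plane_tree_diff (gen r t) = (\<Sum>e\<in>{0..<edge_count t}. ?g e)"
    unfolding gen_def plane_tree_diff_class Fork contractible_trivalent
    by (rule sum.cong) (simp_all only: atLeastLessThan_iff position_trivalent)
  also have "\<dots> = ?g 0 + (\<Sum>e\<in>{Suc 0..<0 + edge_count t}. ?g e)"
    by (simp add: sum.atLeast_Suc_lessThan)
  also have "\<dots> = root_term r t + (\<Sum>(c, x, y)\<in>forks t. left_term r c y x + right_term r c x y)"
    unfolding sum_edges
  proof (intro arg_cong2[of _ _ _ _ "(+)"] sum.cong refl)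
    show "?g 0 = root_term r t"
      by (simp add: Fork contract_root_edge)
    show "(case z of (c, x, y) \<Rightarrow> ?g (Suc (0 + edges_before c)) + ?g (Suc (0 + edges_before c + edge_count x))) =
        (case z of (c, x, y) \<Rightarrow> left_term r c y x + right_term r c x y)" if "z \<in> forks t" for z
    proof -
      obtain c x y where z: "z = (c, x, y)" by (cases z)
      with that have "t = plug c (Fork x y)" by (simp add: forks_def)
      then show ?thesis
        unfolding z prod.case add_0 by (simp only: contract_left_edge[OF _ refl] contract_right_edge[OF _ refl])
    qed
  qed
  finally show ?thesis .
qed

section \<open>The boundary of the sum of all trees with given leaves\<close>

lemma plane_tree_diff_add: "plane_tree_diff (x + y) = plane_tree_diff x + plane_tree_diff y"
  by transfer (simp add: linext_add rel.zero)

lemma plane_tree_diff_0 [simp]: "plane_tree_diff 0 = 0"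
  by transfer (simp add: rel.zero)

lemma plane_tree_diff_sum: "plane_tree_diff (sum f A) = (\<Sum>a\<in>A. plane_tree_diff (f a))"
  by (induction A rule: infinite_finite_induct) (simp_all add: plane_tree_diff_add)

lemma sum_product_Sigma:
  fixes f :: "'k \<Rightarrow> 'x \<Rightarrow> 'b::semiring_0"
  assumes "finite K" "\<And>k. k \<in> K \<Longrightarrow> finite (A k)" "\<And>k. k \<in> K \<Longrightarrow> finite (B k)"
  shows "(\<Sum>(k, x, y)\<in>(SIGMA k:K. A k \<times> B k). f k x * g k y) = (\<Sum>k\<in>K. sum (f k) (A k) * sum (g k) (B k))"
proof -
  have "(\<Sum>k\<in>K. sum (f k) (A k) * sum (g k) (B k)) = (\<Sum>k\<in>K. \<Sum>(x, y)\<in>A k \<times> B k. f k x * g k y)"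
    by (simp only: sum_product sum.cartesian_product)
  also have "\<dots> = (\<Sum>(k, x, y)\<in>(SIGMA k:K. A k \<times> B k). f k x * g k y)"
    by (rule sum.Sigma) (use assms in auto)
  finally show ?thesis by (rule sym)
qed

definition tree_sum :: "'r \<Rightarrow> 'r list \<Rightarrow> 'r plane_tree_alg" where
  "tree_sum r as = (\<Sum>t | leaves t = as. gen r t)"

text \<open>\<open>k\<close> counts the leaves of the left branch; it will be the starting vertex of
  an arrow to the root side.\<close>

lemma sum_root_terms:
  "(\<Sum>t | leaves t = as. root_term r t) =
    (\<Sum>k\<in>{1..<length as}. tree_sum r (take k as) * tree_sum r (drop k as))"
proof -
  let ?T = "\<lambda>bs. {t. leaves t = bs}"
  let ?S = "SIGMA k:{1..<length as}. ?T (take k as) \<times> ?T (drop k as)"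
  have inj: "inj_on (\<lambda>(k, x, y). Fork x y) ?S"
    by (rule inj_on_inverseI[of _ "\<lambda>t. case t of Fork x y \<Rightarrow> (length (leaves x), x, y)"]) auto
  have "(\<Sum>t\<in>?T as. root_term r t) = (\<Sum>t\<in>(\<lambda>(k, x, y). Fork x y) ` ?S. root_term r t)"
  proof (rule sum.mono_neutral_right[OF finite_leaves])
    show "(\<lambda>(k, x, y). Fork x y) ` ?S \<subseteq> ?T as" by auto
    show "\<forall>t\<in>?T as - (\<lambda>(k, x, y). Fork x y) ` ?S. root_term r t = 0"
    proof
      fix t assume t: "t \<in> ?T as - (\<lambda>(k, x, y). Fork x y) ` ?S"
      show "root_term r t = 0"
      proof (cases t)
        case (Fork x y)
        then have "as = leaves x @ leaves y" using t by simp
        moreover have "1 \<le> length (leaves x)" "1 \<le> length (leaves y)"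
          by (simp_all add: Suc_le_eq)
        ultimately have "(length (leaves x), x, y) \<in> ?S" by simp
        from imageI[OF this, of "\<lambda>(k, x, y). Fork x y"] show ?thesis using t Fork by simp
      qed simp
    qed
  qed
  also have "\<dots> = (\<Sum>(k, x, y)\<in>?S. gen r x * gen r y)"
    by (subst sum.reindex[OF inj]) (simp add: o_def case_prod_unfold)
  also have "\<dots> = (\<Sum>k\<in>{1..<length as}. tree_sum r (take k as) * tree_sum r (drop k as))"
    unfolding tree_sum_def by (rule sum_product_Sigma) (simp_all add: finite_leaves)
  finally show ?thesis .
qed

text \<open>A leaf is located by its index, counted from 0. In the mixed cases the same index would
  lie in the left branch for one context and in the right branch for the other.\<close>

lemma Tip_ctx_unique:
  assumes "plug c (Tip s) = plug c' (Tip s')" "length (leaves_before c) = length (leaves_before c')"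
  shows "c = c' \<and> s = s'"
  using assms
proof (induction c arbitrary: c')
  case Hole
  then show ?case by (cases c') auto
next
  case (CtxL c y)
  show ?case
  proof (cases c')
    case Hole
    then show ?thesis using CtxL.prems by simp
  next
    case (CtxL d z)
    then show ?thesis using CtxL.IH[of d] CtxL.prems by simp
  next
    case (CtxR z d)
    then have "length (leaves z) \<le> length (leaves_before c)" "plug c (Tip s) = z"
      using CtxL.prems by auto
    then show ?thesis by (auto simp: leaves_plug)
  qed
next
  case (CtxR x c)
  show ?case
  proof (cases c')
    case Hole
    then show ?thesis using CtxR.prems by simp
  next
    case (CtxL d z)
    then have "length (leaves x) \<le> length (leaves_before d)" "plug d (Tip s') = x"
      using CtxR.prems by auto
    then show ?thesis by (auto simp: leaves_plug)
  next
    case (CtxR z d)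
    then show ?thesis using CtxR.IH[of d] CtxR.prems by simp
  qed
qed

lemma Tip_ctx_exists:
  "k < length (leaves t) \<Longrightarrow> \<exists>c s. plug c (Tip s) = t \<and> length (leaves_before c) = k"
proof (induction t arbitrary: k)
  case (Tip r)
  then show ?case by (intro exI[of _ Hole]) simp
next
  case (Fork x y)
  show ?case
  proof (cases "k < length (leaves x)")
    case True
    then obtain c s where "plug c (Tip s) = x" "length (leaves_before c) = k"
      using Fork.IH(1) by blast
    then show ?thesis by (intro exI[of _ "CtxL c y"] exI[of _ s]) simp
  next
    case False
    then have "k - length (leaves x) < length (leaves y)" using Fork.prems by simp
    then obtain c s where "plug c (Tip s) = y" "length (leaves_before c) = k - length (leaves x)"
      using Fork.IH(2) by blast
    then show ?thesis using False by (intro exI[of _ "CtxR x c"] exI[of _ s]) simp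
  qed
qed

text \<open>\<open>k\<close> leaves precede \<open>x\<close>, and \<open>s\<close> is leaf number
  \<open>l\<close>, so the pairs \<open>(k, l)\<close> are the forward arrows to non-root sides. The
  context and \<open>s\<close> can be recovered from the filled tree and the index \<open>k\<close>,
  which turns a sum over contexts into a product of two sums over trees.\<close>

lemma sum_right_leaves:
  "(\<Sum>(c, s, x) | leaves_before c @ leaves x @ s # leaves_after c = as. gen r (plug c (Tip s)) * gen s x) =
    (\<Sum>(k, l) | k + 1 < l \<and> l \<le> length as.
      tree_sum r (take k as @ drop (l - 1) as) * tree_sum (as ! (l - 1)) (drop k (take (l - 1) as)))"
proof -
  let ?A = "{(c, s, x). leaves_before c @ leaves x @ s # leaves_after c = as}"
  let ?K = "{(k, l). k + 1 < l \<and> l \<le> length as}"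
  let ?T = "\<lambda>bs. {t. leaves t = bs}"
  let ?B = "SIGMA z:?K. ?T (take (fst z) as @ drop (snd z - 1) as) \<times> ?T (drop (fst z) (take (snd z - 1) as))"
  let ?h = "\<lambda>(c, s, x). (let k = length (leaves_before c) in ((k, Suc (k + length (leaves x))), plug c (Tip s), x))"
  have "bij_betw ?h ?A ?B"
  proof (rule bij_betw_imageI)
    show "inj_on ?h ?A"
      by (auto intro!: inj_onI simp: Let_def dest: Tip_ctx_unique)
    show "?h ` ?A = ?B"
    proof (intro equalityI subsetI)
      fix z assume "z \<in> ?h ` ?A"
      then show "z \<in> ?B" by (auto simp: Let_def leaves_plug Suc_le_eq)
    next
      fix z assume "z \<in> ?B"
      then obtain k l t x where z: "z = ((k, l), t, x)" and kl: "k + 1 < l" "l \<le> length as"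
        and t: "leaves t = take k as @ drop (l - 1) as" and x: "leaves x = drop k (take (l - 1) as)"
        by auto
      \<comment> \<open>The leaf of index \<open>k\<close> in \<open>t\<close> is the first entry of
        \<open>drop (l - 1) as\<close>, that is \<open>as ! (l - 1)\<close>.\<close>
      have "k < length (leaves t)" using kl by (simp add: t)
      then obtain c s where c: "plug c (Tip s) = t" "length (leaves_before c) = k"
        using Tip_ctx_exists by blast
      then have "leaves_before c @ s # leaves_after c = take k as @ drop (l - 1) as"
        using t leaves_plug[of c "Tip s"] by simp
      then have b: "leaves_before c = take k as" "s # leaves_after c = drop (l - 1) as"
        using c(2) kl by (auto simp: append_eq_append_conv)
      have "as = take (l - 1) as @ drop (l - 1) as" by simp
      also have "take (l - 1) as = take k (take (l - 1) as) @ drop k (take (l - 1) as)"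
        by (rule append_take_drop_id[symmetric])
      also have "take k (take (l - 1) as) = take k as" using kl by (simp add: min.absorb1)
      finally have "(c, s, x) \<in> ?A" by (simp add: b x)
      moreover have "?h (c, s, x) = z" using c kl by (simp add: z Let_def x)
      ultimately show "z \<in> ?h ` ?A" by force
    qed
  qed
  have fin: "finite ?K" by (rule finite_subset[of _ "{..length as} \<times> {..length as}"]) auto
  have "(\<Sum>(c, s, x)\<in>?A. gen r (plug c (Tip s)) * gen s x) =
      (\<Sum>a\<in>?A. (\<lambda>(z, t, x). gen r t * gen (as ! (snd z - 1)) x) (?h a))"
    by (rule sum.cong) (auto simp: Let_def nth_append)
  also have "\<dots> = (\<Sum>(z, t, x)\<in>?B. gen r t * gen (as ! (snd z - 1)) x)"
    by (rule sum.reindex_bij_betw[OF \<open>bij_betw ?h ?A ?B\<close>])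
  also have "\<dots> = (\<Sum>z\<in>?K. tree_sum r (take (fst z) as @ drop (snd z - 1) as) *
      tree_sum (as ! (snd z - 1)) (drop (fst z) (take (snd z - 1) as)))"
    unfolding tree_sum_def by (rule sum_product_Sigma[OF fin]) (simp_all add: finite_leaves)
  finally show ?thesis by (simp add: case_prod_unfold)
qed

text \<open>The counterpart for backward arrows: \<open>s\<close> is leaf number \<open>l\<close>,
  and the leaves of \<open>y\<close> are those numbered from \<open>l + 1\<close> to
  \<open>k\<close>.\<close>

lemma sum_left_leaves:
  "(\<Sum>(c, s, y) | leaves_before c @ s # leaves y @ leaves_after c = as. gen r (plug c (Tip s)) * gen s y) =
    (\<Sum>(k, l) | 1 \<le> l \<and> l < k \<and> k \<le> length as.
      tree_sum r (take l as @ drop k as) * tree_sum (as ! (l - 1)) (drop l (take k as)))"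
proof -
  let ?A = "{(c, s, y). leaves_before c @ s # leaves y @ leaves_after c = as}"
  let ?K = "{(k, l). 1 \<le> l \<and> l < k \<and> k \<le> length as}"
  let ?T = "\<lambda>bs. {t. leaves t = bs}"
  let ?B = "SIGMA z:?K. ?T (take (snd z) as @ drop (fst z) as) \<times> ?T (drop (snd z) (take (fst z) as))"
  let ?h = "\<lambda>(c, s, y). (let l = Suc (length (leaves_before c)) in ((l + length (leaves y), l), plug c (Tip s), y))"
  have "bij_betw ?h ?A ?B"
  proof (rule bij_betw_imageI)
    show "inj_on ?h ?A"
      by (auto intro!: inj_onI simp: Let_def dest: Tip_ctx_unique)
    show "?h ` ?A = ?B"
    proof (intro equalityI subsetI)
      fix z assume "z \<in> ?h ` ?A"
      then show "z \<in> ?B" by (auto simp: Let_def leaves_plug)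
    next
      fix z assume "z \<in> ?B"
      then obtain k l t y where z: "z = ((k, l), t, y)" and kl: "1 \<le> l" "l < k" "k \<le> length as"
        and t: "leaves t = take l as @ drop k as" and y: "leaves y = drop l (take k as)"
        by auto
      have "l - 1 < length (leaves t)" using kl by (simp add: t)
      then obtain c s where c: "plug c (Tip s) = t" "length (leaves_before c) = l - 1"
        using Tip_ctx_exists by blast
      then have "(leaves_before c @ [s]) @ leaves_after c = take l as @ drop k as"
        using t leaves_plug[of c "Tip s"] by simp
      then have b: "leaves_before c @ [s] = take l as" "leaves_after c = drop k as"
        using c(2) kl append_eq_append_conv[of "leaves_before c @ [s]" "take l as"] by auto
      have "as = take k as @ drop k as" by simp
      also have "take k as = take l (take k as) @ drop l (take k as)"
        by (rule append_take_drop_id[symmetric])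
      also have "take l (take k as) = take l as" using kl by (simp add: min_def)
      also have "\<dots> = leaves_before c @ [s]" by (simp add: b)
      finally have "(c, s, y) \<in> ?A" by (simp add: b(2) y)
      moreover have "?h (c, s, y) = z" using c kl by (simp add: z Let_def y)
      ultimately show "z \<in> ?h ` ?A" by force
    qed
  qed
  have fin: "finite ?K" by (rule finite_subset[of _ "{..length as} \<times> {..length as}"]) auto
  have "(\<Sum>(c, s, y)\<in>?A. gen r (plug c (Tip s)) * gen s y) =
      (\<Sum>a\<in>?A. (\<lambda>(z, t, y). gen r t * gen (as ! (snd z - 1)) y) (?h a))"
    by (rule sum.cong) (auto simp: Let_def nth_append)
  also have "\<dots> = (\<Sum>(z, t, y)\<in>?B. gen r t * gen (as ! (snd z - 1)) y)"
    by (rule sum.reindex_bij_betw[OF \<open>bij_betw ?h ?A ?B\<close>])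
  also have "\<dots> = (\<Sum>z\<in>?K. tree_sum r (take (snd z) as @ drop (fst z) as) *
      tree_sum (as ! (snd z - 1)) (drop (snd z) (take (fst z) as)))"
    unfolding tree_sum_def by (rule sum_product_Sigma[OF fin]) (simp_all add: finite_leaves)
  finally show ?thesis by (simp add: case_prod_unfold)
qed

lemma plane_tree_diff_tree_sum:
  "plane_tree_diff (tree_sum r as) =
    (\<Sum>k\<in>{1..<length as}. tree_sum r (take k as) * tree_sum r (drop k as)) +
    (\<Sum>(k, l) | k + 1 < l \<and> l \<le> length as.
      tree_sum r (take k as @ drop (l - 1) as) * tree_sum (as ! (l - 1)) (drop k (take (l - 1) as))) -
    (\<Sum>(k, l) | 1 \<le> l \<and> l < k \<and> k \<le> length as.
      tree_sum r (take l as @ drop k as) * tree_sum (as ! (l - 1)) (drop l (take k as)))"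
proof -
  let ?T = "{t. leaves t = as}"
  define D where "D = {(c, x, y). leaves (plug c (Fork x y)) = as}"
  have D: "D = (\<Union>t\<in>?T. forks t)" by (auto simp: D_def forks_def)
  then have fin: "finite D" by (simp add: finite_leaves finite_forks)
  have "(\<Sum>(c, x, y)\<in>D. left_term r c y x + right_term r c x y) =
      (\<Sum>t\<in>?T. \<Sum>(c, x, y)\<in>forks t. left_term r c y x + right_term r c x y)"
    unfolding D by (rule sum.UNION_disjoint) (simp_all add: finite_leaves finite_forks, auto simp: forks_def)
  then have diff: "plane_tree_diff (tree_sum r as) = (\<Sum>t\<in>?T. root_term r t) +
      ((\<Sum>(c, x, y)\<in>D. left_term r c y x) + (\<Sum>(c, x, y)\<in>D. right_term r c x y))"
    by (simp add: tree_sum_def plane_tree_diff_sum plane_tree_diff_gen sum.distrib case_prod_unfold)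
  define L where "L = {(c, s, y). leaves_before c @ s # leaves y @ leaves_after c = as}"
  define R where "R = {(c, s, x). leaves_before c @ leaves x @ s # leaves_after c = as}"
  \<comment> \<open>The same quadruple stands for the internal edge of \<open>((x y) z)\<close> and
    for that of \<open>(x (y z))\<close>. Hence \<open>?I\<close> occurs once with each sign and
    cancels.\<close>
  define I where "I = {(c, x, y, z). leaves_before c @ leaves x @ leaves y @ leaves z @ leaves_after c = as}"
  let ?I = "\<Sum>(c, x, y, z)\<in>I. plane_tree_scale ((- 1) ^ edges_before c) (tetravalent r c x y z)"
  have "(\<Sum>(c, x, y)\<in>D. left_term r c y x) = - (\<Sum>(c, s, y)\<in>L. gen r (plug c (Tip s)) * gen s y) - ?I"
  proof -
    let ?f = "\<lambda>(c, s, y). (c, Tip s, y)" and ?g = "\<lambda>(c, x, x', y). (c, Fork x x', y)"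
    have D: "D = ?f ` L \<union> ?g ` I"
    proof (intro equalityI subsetI)
      fix z assume "z \<in> D"
      then obtain c x y where "z = (c, x, y)" "leaves_before c @ leaves x @ leaves y @ leaves_after c = as"
        by (auto simp: D_def leaves_plug)
      then show "z \<in> ?f ` L \<union> ?g ` I"
        by (cases x) (force simp: L_def I_def)+
    qed (auto simp: D_def L_def I_def leaves_plug)
    have inj: "inj_on ?f L" "inj_on ?g I" by (auto intro!: inj_onI)
    have "(\<Sum>(c, x, y)\<in>D. left_term r c y x) =
        (\<Sum>(c, x, y)\<in>?f ` L. left_term r c y x) + (\<Sum>(c, x, y)\<in>?g ` I. left_term r c y x)"
      unfolding D by (rule sum.union_disjoint) (use fin D in \<open>auto dest: finite_subset[rotated]\<close>)
    also have "(\<Sum>(c, x, y)\<in>?f ` L. left_term r c y x) = - (\<Sum>(c, s, y)\<in>L. gen r (plug c (Tip s)) * gen s y)"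
      by (subst sum.reindex[OF inj(1)]) (simp add: o_def case_prod_unfold sum_negf)
    also have "(\<Sum>(c, x, y)\<in>?g ` I. left_term r c y x) = - ?I"
      by (subst sum.reindex[OF inj(2)]) (simp add: o_def case_prod_unfold sum_negf)
    finally show ?thesis by simp
  qed
  moreover have "(\<Sum>(c, x, y)\<in>D. right_term r c x y) = (\<Sum>(c, s, x)\<in>R. gen r (plug c (Tip s)) * gen s x) + ?I"
  proof -
    let ?f = "\<lambda>(c, s, x). (c, x, Tip s)" and ?g = "\<lambda>(c, x, y, y'). (c, x, Fork y y')"
    have D: "D = ?f ` R \<union> ?g ` I"
    proof (intro equalityI subsetI)
      fix z assume "z \<in> D"
      then obtain c x y where "z = (c, x, y)" "leaves_before c @ leaves x @ leaves y @ leaves_after c = as"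
        by (auto simp: D_def leaves_plug)
      then show "z \<in> ?f ` R \<union> ?g ` I"
        by (cases y) (force simp: R_def I_def)+
    qed (auto simp: D_def R_def I_def leaves_plug)
    have inj: "inj_on ?f R" "inj_on ?g I" by (auto intro!: inj_onI)
    have "(\<Sum>(c, x, y)\<in>D. right_term r c x y) =
        (\<Sum>(c, x, y)\<in>?f ` R. right_term r c x y) + (\<Sum>(c, x, y)\<in>?g ` I. right_term r c x y)"
      unfolding D by (rule sum.union_disjoint) (use fin D in \<open>auto dest: finite_subset[rotated]\<close>)
    also have "(\<Sum>(c, x, y)\<in>?f ` R. right_term r c x y) = (\<Sum>(c, s, x)\<in>R. gen r (plug c (Tip s)) * gen s x)"
      by (subst sum.reindex[OF inj(1)]) (simp add: o_def case_prod_unfold)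
    also have "(\<Sum>(c, x, y)\<in>?g ` I. right_term r c x y) = ?I"
      by (subst sum.reindex[OF inj(2)]) (simp add: o_def case_prod_unfold)
    finally show ?thesis .
  qed
  ultimately show ?thesis
    by (simp add: diff sum_root_terms sum_left_leaves sum_right_leaves L_def R_def)
qed

section \<open>Leaf lists and index pairs read as polygons and arrows\<close>

definition polygon_sum :: "'r polygon \<Rightarrow> 'r plane_tree_alg" where
  "polygon_sum \<pi> = tree_sum (last (sides \<pi>)) (butlast (sides \<pi>))"

lemma sides_snoc:
  obtains as r where "sides \<pi> = as @ [r]" "as \<noteq> []" "weight \<pi> = length as"
proof -
  have "2 \<le> length (sides \<pi>)" using sides[of \<pi>] by simp
  then obtain as r where "sides \<pi> = as @ [r]" by (cases "sides \<pi>" rule: rev_cases) auto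
  moreover from this have "as \<noteq> []" "weight \<pi> = length as"
    using \<open>2 \<le> length (sides \<pi>)\<close> by (auto simp: weight_def)
  ultimately show ?thesis using that by blast
qed

lemma polygon_sum_Polygon: "as \<noteq> [] \<Longrightarrow> polygon_sum (Polygon (as @ [r])) = tree_sum r as"
  using Polygon_inverse[of "as @ [r]"] by (cases as) (auto simp: polygon_sum_def)

text \<open>The arrows to the root side start neither at the first nor at the last vertex, its
  endpoints. The three sets match the three sums in \<open>plane_tree_diff_tree_sum\<close>.\<close>

lemma arrows_cases:
  assumes "weight \<pi> = n"
  shows "arrows \<pi> = (\<lambda>k. (k, n + 1)) ` {1..<n} \<union> {(k, l). k + 1 < l \<and> l \<le> n} \<union> {(k, l). 1 \<le> l \<and> l < k \<and> k \<le> n}"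
  using assms by (auto simp: arrows_def image_iff)

lemma plane_tree_diff_polygon_sum:
  "plane_tree_diff (polygon_sum \<pi>) = (\<Sum>\<alpha>\<in>arrows \<pi>. plane_tree_scale (arrow_sign \<alpha>)
     (polygon_sum (root_polygon \<pi> \<alpha>) * polygon_sum (cutoff_polygon_bar \<pi> \<alpha>)))"
proof -
  obtain as r where \<pi>: "sides \<pi> = as @ [r]" "as \<noteq> []" "weight \<pi> = length as" by (rule sides_snoc)
  let ?n = "length as"
  let ?f = "\<lambda>\<alpha>. plane_tree_scale (arrow_sign \<alpha>) (polygon_sum (root_polygon \<pi> \<alpha>) * polygon_sum (cutoff_polygon_bar \<pi> \<alpha>))"
  let ?A = "(\<lambda>k. (k, ?n + 1)) ` {1..<?n}" and ?B = "{(k, l). k + 1 < l \<and> l \<le> ?n}"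
    and ?C = "{(k, l). 1 \<le> l \<and> l < k \<and> k \<le> ?n}"
  have fin: "finite ?B" "finite ?C"
    by (rule finite_subset[of _ "{..?n} \<times> {..?n}"]; auto)+
  have "sum ?f (arrows \<pi>) = sum ?f ?A + sum ?f ?B + sum ?f ?C"
    unfolding arrows_cases[OF \<pi>(3)] using fin by (subst sum.union_disjoint; auto)+
  also have "sum ?f ?A = (\<Sum>k\<in>{1..<?n}. tree_sum r (take k as) * tree_sum r (drop k as))"
    by (subst sum.reindex)
      (auto intro!: inj_onI sum.cong simp: arrow_sign_def forward_def root_polygon_def cutoff_polygon_bar_def \<pi>
        polygon_sum_Polygon)
  also have "sum ?f ?B = (\<Sum>(k, l)\<in>?B.
      tree_sum r (take k as @ drop (l - 1) as) * tree_sum (as ! (l - 1)) (drop k (take (l - 1) as)))"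
  proof (rule sum.cong[OF refl])
    fix \<alpha> assume "\<alpha> \<in> ?B"
    then obtain k l where \<alpha>: "\<alpha> = (k, l)" "k + 1 < l" "l \<le> ?n" by auto
    \<comment> \<open>The side hit by the arrow occurs in both polygons: it is the root side of the
      cut-off polygon and also remains in the root polygon.\<close>
    then have "l = Suc (l - 1)" "l - 1 < ?n" by auto
    then have "take l as = take (l - 1) as @ [as ! (l - 1)]"
      by (metis take_Suc_conv_app_nth)
    then have "drop k (take l as) = drop k (take (l - 1) as) @ [as ! (l - 1)]"
      using \<alpha> by simp
    moreover have "drop k (take (l - 1) as) \<noteq> []" "drop (l - 1) as \<noteq> []" using \<alpha> by auto
    ultimately show "?f \<alpha> = (case \<alpha> of (k, l) \<Rightarrow>
        tree_sum r (take k as @ drop (l - 1) as) * tree_sum (as ! (l - 1)) (drop k (take (l - 1) as)))"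
      using \<alpha> polygon_sum_Polygon[of "take k as @ drop (l - 1) as" r]
      by (simp add: arrow_sign_def forward_def root_polygon_def cutoff_polygon_bar_def \<pi> polygon_sum_Polygon)
  qed
  also have "sum ?f ?C = - (\<Sum>(k, l)\<in>?C. tree_sum r (take l as @ drop k as) * tree_sum (as ! (l - 1)) (drop l (take k as)))"
    unfolding sum_negf[symmetric]
  proof (rule sum.cong[OF refl])
    fix \<alpha> assume "\<alpha> \<in> ?C"
    then obtain k l where \<alpha>: "\<alpha> = (k, l)" "1 \<le> l" "l < k" "k \<le> ?n" by auto
    then have "drop l (take k as) \<noteq> []" "take l as \<noteq> []" "l - 1 < ?n" using \<pi>(2) by auto
    then show "?f \<alpha> = - (case \<alpha> of (k, l) \<Rightarrow>
        tree_sum r (take l as @ drop k as) * tree_sum (as ! (l - 1)) (drop l (take k as)))"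
      using \<alpha> polygon_sum_Polygon[of "take l as @ drop k as" r]
      by (simp add: arrow_sign_def forward_def root_polygon_def cutoff_polygon_bar_def \<pi> polygon_sum_Polygon nth_append)
  qed
  finally show ?thesis
    by (simp add: polygon_sum_def \<pi> plane_tree_diff_tree_sum)
qed

section \<open>Triangulations and binary trees\<close>

text \<open>The segments dual to those edges of a tree that do not end in a leaf:\<close>

primrec arcs :: "nat \<Rightarrow> 'r btree \<Rightarrow> (nat \<times> nat) set" where
  "arcs i (Tip r) = {}"
| "arcs i (Fork x y) = insert (i, i + (length (leaves x) + length (leaves y)))
     (arcs i x \<union> arcs (i + length (leaves x)) y)"

lemma arcs_bounds: "(p, q) \<in> arcs i t \<Longrightarrow> i \<le> p \<and> p + 2 \<le> q \<and> q \<le> i + length (leaves t)"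
proof (induction t arbitrary: i)
  case (Fork x y)
  then show ?case
    using leaves_length_pos[of x] leaves_length_pos[of y] by fastforce
qed simp

lemma arcs_top: "2 \<le> length (leaves t) \<Longrightarrow> (i, i + length (leaves t)) \<in> arcs i t"
  by (cases t) auto

lemma cross_iff: "cross (i, j) (k, l) \<longleftrightarrow> (i < k \<and> k < j \<and> j < l) \<or> (k < i \<and> i < l \<and> l < j)"
  by (simp add: cross_def)

lemma arcs_not_cross: "D \<in> arcs i t \<Longrightarrow> E \<in> arcs i t \<Longrightarrow> \<not> cross D E"
proof (induction t arbitrary: i)
  case (Fork x y)
  obtain a b c d where DE: "D = (a, b)" "E = (c, d)" by (cases D; cases E)
  let ?k = "i + length (leaves x)"
  consider "D = (i, ?k + length (leaves y))" | "E = (i, ?k + length (leaves y))"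
    | "D \<in> arcs i x" "E \<in> arcs i x" | "D \<in> arcs ?k y" "E \<in> arcs ?k y"
    | "D \<in> arcs i x" "E \<in> arcs ?k y" | "D \<in> arcs ?k y" "E \<in> arcs i x"
    using Fork.prems by (auto simp: add.assoc)
  then show ?case
  proof cases
    case 1
    then show ?thesis using arcs_bounds[of c d i "Fork x y"] Fork.prems(2) by (auto simp: DE cross_iff)
  next
    case 2
    then show ?thesis using arcs_bounds[of a b i "Fork x y"] Fork.prems(1) by (auto simp: DE cross_iff)
  next
    case 5
    then show ?thesis using arcs_bounds[of a b i x] arcs_bounds[of c d ?k y] by (auto simp: DE cross_iff)
  next
    case 6
    then show ?thesis using arcs_bounds[of a b ?k y] arcs_bounds[of c d i x] by (auto simp: DE cross_iff)
  qed (use Fork.IH in blast)+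
qed simp

text \<open>A segment on one side of the splitting vertex is treated inside that branch. One that
  passes strictly over this vertex is the top arc or crosses a side of the top triangle, and the
  crossed side is then long enough to be an arc.\<close>

lemma arcs_maximal:
  assumes "i \<le> p" "p + 2 \<le> q" "q \<le> i + length (leaves t)" "(p, q) \<notin> arcs i t"
  shows "\<exists>E\<in>arcs i t. cross (p, q) E"
  using assms
proof (induction t arbitrary: i)
  case (Fork x y)
  let ?k = "i + length (leaves x)" and ?j = "i + length (leaves x) + length (leaves y)"
  consider "q \<le> ?k" | "?k \<le> p" | "p < ?k" "?k < q" by linarith
  then show ?case
  proof cases
    case 1
    then show ?thesis using Fork.IH(1)[of i] Fork.prems by auto
  next
    case 2
    then show ?thesis using Fork.IH(2)[of ?k] Fork.prems by (auto simp: add.assoc)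
  next
    case 3
    have "i < p \<or> q < ?j" using Fork.prems by (auto simp: add.assoc)
    then show ?thesis
    proof
      assume "i < p"
      moreover from this 3 have "(i, ?k) \<in> arcs i x" by (intro arcs_top) auto
      ultimately show ?thesis using 3 by (intro bexI[of _ "(i, ?k)"]) (auto simp: cross_iff)
    next
      assume "q < ?j"
      moreover from this 3 have "(?k, ?j) \<in> arcs ?k y" by (intro arcs_top) auto
      ultimately show ?thesis using 3 by (intro bexI[of _ "(?k, ?j)"]) (auto simp: cross_iff)
    qed
  qed
qed auto

text \<open>\<open>dual_branch\<close> finds its children through \<open>apex\<close>, so the
  splitting vertex of \<open>t\<close> has to be the only apex: another one would yield two crossing
  segments of \<open>T\<close>. The top arc is exempt from the inclusion because for the whole tree
  it is the root side, which is not a diagonal.\<close>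

lemma shape_dual_branch:
  assumes "\<forall>D\<in>T. \<forall>E\<in>T. \<not> cross D E" "arcs i t - {(i, i + length (leaves t))} \<subseteq> T"
    and "leaves t = map ((!) as) [i..<i + length (leaves t)]"
  shows "shape (dual_branch as T i (i + length (leaves t))) = unnumbered t"
  using assms(2,3)
proof (induction t arbitrary: i)
  case (Tip r)
  then show ?case by (subst dual_branch.simps) (auto simp: Let_def upt_Suc)
next
  case (Fork x y)
  let ?k = "i + length (leaves x)" and ?j = "i + length (leaves x) + length (leaves y)"
  have ik: "i < ?k" "?k < ?j" by simp_all
  have "arcs i (Fork x y) - {(i, ?j)} \<subseteq> T" using Fork.prems(1) by (simp add: add.assoc)
  then have sub: "D \<in> T" if "D \<in> arcs i x \<union> arcs ?k y" "D \<noteq> (i, ?j)" for D using that by auto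
  have x: "arcs i x \<subseteq> T"
    by (rule subsetI, rule sub) (use ik arcs_bounds[of i ?j i x] in auto)
  have y: "arcs ?k y \<subseteq> T"
    by (rule subsetI, rule sub) (use ik arcs_bounds[of i ?j ?k y] in auto)
  have seg: "segment T i ?k" "segment T ?k ?j"
  proof -
    have "length (leaves x) = 1 \<or> 2 \<le> length (leaves x)" "length (leaves y) = 1 \<or> 2 \<le> length (leaves y)"
      using leaves_length_pos[of x] leaves_length_pos[of y] by linarith+
    then show "segment T i ?k" "segment T ?k ?j"
      using subsetD[OF x arcs_top] subsetD[OF y arcs_top] by (auto simp: segment_def)
  qed
  have "apex T i ?j = ?k"
    unfolding apex_def
  proof (rule the_equality)
    show "i < ?k \<and> ?k < ?j \<and> segment T i ?k \<and> segment T ?k ?j" using ik seg by blast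
    fix k assume k: "i < k \<and> k < ?j \<and> segment T i k \<and> segment T k ?j"
    show "k = ?k"
    proof (rule ccontr)
      assume "k \<noteq> ?k"
      then consider "k < ?k" | "?k < k" by linarith
      then show False
      proof cases
        case 1
        then have "(i, ?k) \<in> T" "(k, ?j) \<in> T" "cross (i, ?k) (k, ?j)"
          using k seg ik by (auto simp: segment_def cross_iff)
        then show False using assms(1) by blast
      next
        case 2
        then have "(i, k) \<in> T" "(?k, ?j) \<in> T" "cross (i, k) (?k, ?j)"
          using k seg ik by (auto simp: segment_def cross_iff)
        then show False using assms(1) by blast
      qed
    qed
  qed
  moreover have l: "leaves x = map ((!) as) [i..<?k]" "leaves y = map ((!) as) [?k..<?j]"
  proof -
    have "[i..<?k] @ [?k..<?j] = [i..<?j]"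
      by (rule upt_append) auto
    then have "leaves x @ leaves y = map ((!) as) [i..<?k] @ map ((!) as) [?k..<?j]"
      using Fork.prems(2) by (simp only: leaves.simps length_append add.assoc map_append[symmetric])
    then show "leaves x = map ((!) as) [i..<?k]" "leaves y = map ((!) as) [?k..<?j]"
      by (simp_all add: append_eq_append_conv)
  qed
  moreover have "shape (dual_branch as T i ?k) = unnumbered x"
    by (rule Fork.IH(1)) (use x l(1) in auto)
  moreover have "shape (dual_branch as T ?k ?j) = unnumbered y"
    by (rule Fork.IH(2)) (use y l(2) in auto)
  ultimately have "shape (dual_branch as T i ?j) = unnumbered (Fork x y)"
    using ik by (subst dual_branch.simps) (simp add: Let_def)
  then show ?case by (simp add: add.assoc)
qed

text \<open>The apex is the largest \<open>k\<close> below \<open>j\<close> that is joined to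
  \<open>i\<close>. If \<open>(k, j)\<close> were not a segment, maximality of \<open>T\<close>
  would give a diagonal crossing it; as this diagonal does not cross \<open>(i, j)\<close>, it
  either starts at \<open>i\<close>, against the choice of \<open>k\<close>, or crosses
  \<open>(i, k)\<close>.\<close>

lemma apex_exists:
  assumes T: "T \<in> triangulations \<pi>" and ij: "(i, j) \<in> insert (0, weight \<pi>) T" "i + 2 \<le> j"
  shows "\<exists>k. i < k \<and> k < j \<and> segment T i k \<and> segment T k j"
proof -
  let ?K = "{k. i < k \<and> k < j \<and> segment T i k}"
  define k where "k = Max ?K"
  have fin: "finite ?K" by (rule finite_subset[of _ "{..j}"]) auto
  have "i + 1 \<in> ?K" using ij by (auto simp: segment_def)
  then have k: "k \<in> ?K" unfolding k_def using fin by (intro Max_in) auto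
  have max: "k' \<le> k" if "k' \<in> ?K" for k' unfolding k_def using fin that by (rule Max_ge)
  have T': "T \<subseteq> diagonals \<pi>" "\<And>D E. D \<in> T \<Longrightarrow> E \<in> T \<Longrightarrow> \<not> cross D E"
      "\<And>D. D \<in> diagonals \<pi> \<Longrightarrow> D \<notin> T \<Longrightarrow> \<exists>E\<in>T. cross D E"
    using T by (auto simp: triangulations_def)
  have "j \<le> weight \<pi>" using ij T'(1) by (auto simp: diagonals_def)
  have "segment T k j"
  proof (rule ccontr)
    assume "\<not> segment T k j"
    then have "(k, j) \<notin> T" "k + 2 \<le> j" using k by (auto simp: segment_def)
    moreover from this have "(k, j) \<in> diagonals \<pi>"
      using k \<open>j \<le> weight \<pi>\<close> by (auto simp: diagonals_def)
    ultimately obtain p q where pq: "(p, q) \<in> T" "cross (k, j) (p, q)" using T'(3) by fast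
    have "q \<le> weight \<pi>" "p + 2 \<le> q" using pq T'(1) by (auto simp: diagonals_def)
    have "\<not> cross (i, j) (p, q)"
      using ij(1) pq(1) T'(2) \<open>q \<le> weight \<pi>\<close> by (auto simp: cross_iff)
    then have "p < k" "k < q" "q < j" "i \<le> p"
      using pq(2) k by (auto simp: cross_iff)
    show False
    proof (cases "p = i")
      case True
      then have "q \<in> ?K" using pq \<open>k < q\<close> \<open>q < j\<close> k by (auto simp: segment_def)
      then show False using max[of q] \<open>k < q\<close> by simp
    next
      case False
      then have "(i, k) \<in> T" "cross (i, k) (p, q)"
        using k \<open>i \<le> p\<close> \<open>p < k\<close> \<open>k < q\<close> by (auto simp: segment_def cross_iff)
      then show False using T'(2) pq(1) by blast
    qed
  qed
  then show ?thesis using k by blast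
qed

text \<open>The inverse construction: \<open>(i, j)\<close> is split at an apex, and no other
  segment of \<open>T\<close> below \<open>(i, j)\<close> passes over it, so the arcs distribute
  over the two branches. The condition \<open>p + 2 \<le> q\<close> removes the inserted root side
  in the case of a 2-gon, whose tree has no arcs.\<close>

lemma tree_of_triangulation:
  assumes T: "T \<in> triangulations \<pi>" and ij: "segment T i j \<or> (i, j) = (0, weight \<pi>)" "i < j" "j \<le> weight \<pi>"
  shows "\<exists>t. leaves t = map ((!) as) [i..<j] \<and>
    arcs i t = {(p, q) \<in> insert (0, weight \<pi>) T. i \<le> p \<and> p + 2 \<le> q \<and> q \<le> j}"
  using ij
proof (induction "j - i" arbitrary: i j rule: less_induct)
  case less
  let ?T = "insert (0, weight \<pi>) T"
  show ?case
  proof (cases "j = i + 1")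
    case True
    then show ?thesis by (intro exI[of _ "Tip (as ! i)"]) (auto simp: upt_Suc)
  next
    case False
    then have ij: "(i, j) \<in> ?T" "i + 2 \<le> j" using less.prems by (auto simp: segment_def)
    then obtain k where k: "i < k" "k < j" "segment T i k" "segment T k j"
      using apex_exists[OF T] by blast
    have "\<exists>x. leaves x = map ((!) as) [i..<k] \<and> arcs i x = {(p, q) \<in> ?T. i \<le> p \<and> p + 2 \<le> q \<and> q \<le> k}"
      by (rule less.hyps) (use k less.prems in auto)
    then obtain x where x: "leaves x = map ((!) as) [i..<k]"
        "arcs i x = {(p, q) \<in> ?T. i \<le> p \<and> p + 2 \<le> q \<and> q \<le> k}" by blast
    have "\<exists>y. leaves y = map ((!) as) [k..<j] \<and> arcs k y = {(p, q) \<in> ?T. k \<le> p \<and> p + 2 \<le> q \<and> q \<le> j}"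
      by (rule less.hyps) (use k less.prems in auto)
    then obtain y where y: "leaves y = map ((!) as) [k..<j]"
        "arcs k y = {(p, q) \<in> ?T. k \<le> p \<and> p + 2 \<le> q \<and> q \<le> j}" by blast
    \<comment> \<open>The root side is harmless among the segments: it joins the two extreme
      vertices and crosses nothing.\<close>
    have nc: "\<not> cross D E" if "D \<in> T" "E \<in> ?T" "snd E \<le> weight \<pi>" for D E
      using that T by (auto simp: triangulations_def diagonals_def cross_def)
    have "leaves (Fork x y) = map ((!) as) [i..<j]"
      using upt_append[of i k j] k by (simp add: x y flip: map_append)
    moreover have "(p, q) = (i, j) \<or> q \<le> k \<or> k \<le> p"
      if pq: "(p, q) \<in> ?T" "i \<le> p" "p + 2 \<le> q" "q \<le> j" for p q
    proof (rule ccontr)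
      assume *: "\<not> ?thesis"
      then have "p < k" "k < q" by auto
      from * have "i < p \<or> q < j" using pq by auto
      then show False
      proof
        assume "i < p"
        then have "(i, k) \<in> T" "cross (i, k) (p, q)"
          using k \<open>p < k\<close> \<open>k < q\<close> by (auto simp: segment_def cross_iff)
        then show False using nc[of "(i, k)" "(p, q)"] pq less.prems(3) by simp
      next
        assume "q < j"
        then have "(k, j) \<in> T" "cross (k, j) (p, q)"
          using k \<open>p < k\<close> \<open>k < q\<close> by (auto simp: segment_def cross_iff)
        then show False using nc[of "(k, j)" "(p, q)"] pq less.prems(3) by simp
      qed
    qed
    then have "arcs i (Fork x y) = {(p, q) \<in> ?T. i \<le> p \<and> p + 2 \<le> q \<and> q \<le> j}"
      using ij k by (auto simp: x y)
    ultimately show ?thesis by blast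
  qed
qed

text \<open>Injectivity holds because the shape of the dual branch gives the tree back. The top arc
  is discarded as it represents the root side.\<close>

lemma bij_betw_triangulations:
  assumes "weight \<pi> = length as"
  shows "bij_betw (\<lambda>t. arcs 0 t - {(0, weight \<pi>)}) {t. leaves t = as} (triangulations \<pi>)"
proof (rule bij_betw_imageI)
  let ?f = "\<lambda>t. arcs 0 t - {(0, weight \<pi>)}"
  have w: "1 \<le> weight \<pi>" using sides[of \<pi>] by (auto simp: weight_def)
  show "inj_on ?f {t. leaves t = as}"
  proof (rule inj_onI)
    fix s t assume st: "s \<in> {t. leaves t = as}" "t \<in> {t. leaves t = as}" "?f s = ?f t"
    have sh: "shape (dual_branch as (?f t) 0 (weight \<pi>)) = unnumbered t" if "leaves t = as" for t
    proof -
      have "\<forall>D\<in>?f t. \<forall>E\<in>?f t. \<not> cross D E" by (auto dest: arcs_not_cross)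
      from shape_dual_branch[OF this, of 0 t as] show ?thesis
        using that assms by (simp add: map_nth)
    qed
    show "s = t"
      by (rule inj_unnumbered) (use st sh[of s] sh[of t] in simp)
  qed
  show "?f ` {t. leaves t = as} = triangulations \<pi>"
  proof (intro equalityI subsetI)
    fix T assume "T \<in> ?f ` {t. leaves t = as}"
    then obtain t where t: "leaves t = as" and T: "T = ?f t" by blast
    have "T \<subseteq> diagonals \<pi>"
      unfolding T by (auto simp: diagonals_def assms t dest!: arcs_bounds)
    moreover have "\<exists>E\<in>T. cross D E" if D: "D \<in> diagonals \<pi> - T" for D
    proof -
      obtain p q where pq: "D = (p, q)" by (cases D)
      then have "p + 2 \<le> q" "q \<le> weight \<pi>" "(p, q) \<notin> arcs 0 t"
        using D by (auto simp: diagonals_def T)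
      then obtain E where "E \<in> arcs 0 t" "cross (p, q) E"
        using arcs_maximal[of 0 p q t] by (auto simp: t assms)
      moreover from this have "E \<noteq> (0, weight \<pi>)"
        using \<open>q \<le> weight \<pi>\<close> by (auto simp: cross_iff)
      ultimately show ?thesis by (auto simp: T pq)
    qed
    ultimately show "T \<in> triangulations \<pi>"
      by (auto simp: triangulations_def T dest: arcs_not_cross)
  next
    fix T assume T: "T \<in> triangulations \<pi>"
    then obtain t where t: "leaves t = map ((!) as) [0..<weight \<pi>]"
        "arcs 0 t = {(p, q) \<in> insert (0, weight \<pi>) T. 0 \<le> p \<and> p + 2 \<le> q \<and> q \<le> weight \<pi>}"
      using tree_of_triangulation[OF T, of 0 "weight \<pi>" as] w by auto
    have "leaves t = as" using t(1) assms by (simp add: map_nth)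
    moreover have "T \<subseteq> diagonals \<pi>" using T by (simp add: triangulations_def)
    then have "T = ?f t" by (auto simp: t diagonals_def)
    ultimately show "T \<in> ?f ` {t. leaves t = as}" by blast
  qed
qed

lemma triangulation_sum_eq: "triangulation_sum \<pi> = polygon_sum \<pi>"
proof -
  obtain as r where \<pi>: "sides \<pi> = as @ [r]" "as \<noteq> []" "weight \<pi> = length as" by (rule sides_snoc)
  let ?f = "\<lambda>t. arcs 0 t - {(0, weight \<pi>)}"
  have "plane_class (canonically_oriented (dual_tree \<pi> (?f t))) = gen r t" if t: "leaves t = as" for t
  proof -
    have "\<forall>D\<in>?f t. \<forall>E\<in>?f t. \<not> cross D E" by (auto dest: arcs_not_cross)
    moreover have "map ((!) (as @ [r])) [0..<length as] = as"
      by (rule nth_equalityI) (simp_all add: nth_append)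
    ultimately have "shape (dual_branch (sides \<pi>) (?f t) 0 (weight \<pi>)) = unnumbered t"
      using shape_dual_branch[of "?f t" 0 t "sides \<pi>"] t \<pi> by simp
    then show ?thesis
      using dual_branch_edges[of 0 "weight \<pi>" "sides \<pi>" "?f t"] \<pi>
      unfolding dual_tree_def by (subst gen_eqI[of _ t]) auto
  qed
  then show ?thesis
    using sum.reindex_bij_betw[OF bij_betw_triangulations[OF \<pi>(3)],
        of "\<lambda>T. plane_class (canonically_oriented (dual_tree \<pi> T))"]
    by (simp add: triangulation_sum_def polygon_sum_def tree_sum_def \<pi>)
qed

section \<open>The homomorphism\<close>

lemma plane_tree_alg_double_eq_0: "x + x = 0 \<Longrightarrow> x = 0" for x :: "'r plane_tree_alg"
  using plane_tree_alg.scale_left_distrib[of "1/2" "1/2" x] plane_tree_alg.scale_right_distrib[of "1/2" x x]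
  by simp

lemma plane_tree_scale_mult:
  "plane_tree_scale c x * y = plane_tree_scale c (x * y)"
  "x * plane_tree_scale c y = plane_tree_scale c (x * y)"
  by (transfer; simp add: smul_mult_left smul_mult_right rel.zero)+

text \<open>Disjoint union is symmetric, so only the orientation changes, by the exchange of two
  blocks of odd length. Numbering \<open>t\<close> from \<open>edge_count s\<close> keeps the names
  apart.\<close>

lemma gen_anticommute: "gen r s * gen q t = - (gen q t * gen r s)"
proof -
  let ?s = "Planted r (numbered 0 s)" and ?t = "Planted q (numbered (edge_count s) t)"
  let ?a = "tree_edges ?s" and ?b = "tree_edges ?t"
  have v: "valid {#?s, ?t#} (?a @ ?b)" "valid {#?t, ?s#} (?b @ ?a)"
    by (auto simp: valid_def)
  have "sim True 1 (OForest ({#?s, ?t#}, ?a @ ?b)) (trivalent r s + trivalent q t)"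
    unfolding trivalent_def by (rule canonical_product[OF _ _ _ _ v(1)]) auto
  then have 1: "plane_class (OForest ({#?s, ?t#}, ?a @ ?b)) = gen r s * gen q t"
    using plane_class_sim by (fastforce simp: plane_class_plus gen_def)
  have "sim True 1 (OForest ({#?t, ?s#}, ?b @ ?a)) (canonically_oriented ?t + trivalent r s)"
    unfolding trivalent_def by (rule canonical_product[OF _ _ _ _ v(2)]) auto
  then have 2: "plane_class (OForest ({#?t, ?s#}, ?b @ ?a)) = gen q t * gen r s"
    using plane_class_sim gen_eqI[of "numbered (edge_count s) t" t q]
    by (fastforce simp: plane_class_plus gen_def)
  have "sim True ((- 1) ^ (length ?a * length ?b)) (OForest ({#?s, ?t#}, ?a @ ?b)) (OForest ({#?s, ?t#}, ?b @ ?a))"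
    using sim_blocks[of "{#?s, ?t#}" "[]" ?a ?b "[]"] v(1) by simp
  from plane_class_sim[OF this] show ?thesis
    unfolding 1 using 2 by (simp add: add_mset_commute)
qed

lemma polygon_sum_anticommute: "polygon_sum \<pi> * polygon_sum \<rho> = - (polygon_sum \<rho> * polygon_sum \<pi>)"
proof -
  have "tree_sum r as * tree_sum q bs = - (tree_sum q bs * tree_sum r as)" for r q :: 'a and as bs
  proof -
    have "tree_sum r as * tree_sum q bs = (\<Sum>s | leaves s = as. \<Sum>t | leaves t = bs. - (gen q t * gen r s))"
      by (simp only: tree_sum_def sum_product gen_anticommute[symmetric])
    also have "\<dots> = - (tree_sum q bs * tree_sum r as)"
      unfolding tree_sum_def sum_product by (subst sum.swap) (simp add: sum_negf)
    finally show ?thesis .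
  qed
  then show ?thesis unfolding polygon_sum_def .
qed

text \<open>A representative of \<open>polygon_sum\<close> in the free vector space, needed because
  \<open>linext\<close> takes its values there and not in the quotient.\<close>

definition polygon_rep :: "'r polygon \<Rightarrow> 'r oforest \<Rightarrow>\<^sub>0 rat" where
  "polygon_rep \<pi> = (\<Sum>t | leaves t = butlast (sides \<pi>). unit_at (trivalent (last (sides \<pi>)) t))"

lemma abs_polygon_rep: "abs_plane_tree_alg (polygon_rep \<pi>) = polygon_sum \<pi>"
  by (simp add: polygon_rep_def polygon_sum_def tree_sum_def abs_plane_tree_alg_sum gen_def plane_class.abs_eq)

definition dual_tensor :: "'r tensor_alg \<Rightarrow> 'r plane_tree_alg" where
  "dual_tensor x = abs_plane_tree_alg (linext (\<lambda>w. prod_list (map polygon_rep (letters w))) x)"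

lemma dual_tensor_add: "dual_tensor (x + y) = dual_tensor x + dual_tensor y"
  and dual_tensor_smul: "dual_tensor (smul c x) = plane_tree_scale c (dual_tensor x)"
  by (simp_all add: dual_tensor_def linext_add linext_smul plus_plane_tree_alg.abs_eq plane_tree_scale.abs_eq)

lemma abs_prod_polygon_rep:
  "abs_plane_tree_alg (prod_list (map polygon_rep ps)) = prod_list (map polygon_sum ps)"
  by (induction ps)
    (simp_all add: one_plane_tree_alg.abs_eq abs_polygon_rep times_plane_tree_alg.abs_eq[symmetric])

lemma dual_tensor_word: "dual_tensor (word ps) = prod_list (map polygon_sum ps)"
  by (simp add: dual_tensor_def word_def abs_prod_polygon_rep)

lemma dual_tensor_sum:
  "dual_tensor x = (\<Sum>w\<in>Poly_Mapping.keys x. plane_tree_scale (Poly_Mapping.lookup x w) (prod_list (map polygon_sum (letters w))))"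
  by (simp add: dual_tensor_def linext_def abs_plane_tree_alg_sum abs_prod_polygon_rep
      plane_tree_scale.abs_eq[symmetric])

lemma dual_tensor_mult: "dual_tensor (x * y) = dual_tensor x * dual_tensor y"
proof (induction x rule: tensor_induct)
  case (word ps)
  show ?case
    by (induction y rule: tensor_induct)
      (simp_all add: algebra_simps dual_tensor_add dual_tensor_smul smul_mult_right plane_tree_scale_mult,
       simp add: dual_tensor_word flip: word_append)
qed (simp_all add: algebra_simps dual_tensor_add dual_tensor_smul smul_mult_left plane_tree_scale_mult)

text \<open>Exchanging the two summation indices in the square, together with anticommutation of the
  generators, shows that it equals its own negative; over the rationals it is then 0.\<close>

lemma dual_tensor_square:
  assumes "v \<in> polygon_space"
  shows "dual_tensor v * dual_tensor v = 0"
proof -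
  let ?K = "Poly_Mapping.keys v"
  let ?f = "\<lambda>w. plane_tree_scale (Poly_Mapping.lookup v w) (prod_list (map polygon_sum (letters w)))"
  have anti: "?f w * ?f w' = - (?f w' * ?f w)" if "w \<in> ?K" "w' \<in> ?K" for w w'
  proof -
    obtain \<pi> \<rho> where w: "w = Word [\<pi>]" "w' = Word [\<rho>]"
      using assms \<open>w \<in> ?K\<close> \<open>w' \<in> ?K\<close> unfolding polygon_space_def by blast
    show ?thesis
      using polygon_sum_anticommute[of \<pi> \<rho>] by (simp add: w plane_tree_scale_mult mult.commute)
  qed
  have "(\<Sum>w\<in>?K. \<Sum>w'\<in>?K. ?f w * ?f w') = (\<Sum>w\<in>?K. \<Sum>w'\<in>?K. - (?f w' * ?f w))"
    by (intro sum.cong refl anti)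
  also have "\<dots> = - (\<Sum>w\<in>?K. \<Sum>w'\<in>?K. ?f w * ?f w')"
    by (subst sum.swap) (simp add: sum_negf)
  finally have "dual_tensor v * dual_tensor v = - (dual_tensor v * dual_tensor v)"
    by (simp only: dual_tensor_sum sum_product)
  then show ?thesis
    using plane_tree_alg_double_eq_0[of "dual_tensor v * dual_tensor v"] by (simp only: eq_neg_iff_add_eq_0)
qed

lemma dual_tensor_exterior_ideal: "x \<in> exterior_ideal \<Longrightarrow> dual_tensor x = 0"
  by (induction rule: exterior_ideal.induct) (simp_all add: dual_tensor_mult dual_tensor_add dual_tensor_square)

lift_definition dual :: "'r polygon_alg \<Rightarrow> 'r plane_tree_alg" is dual_tensor
proof -
  fix x y :: "'r tensor_alg"
  assume "x - y \<in> exterior_ideal"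
  then have "dual_tensor (x - y) = 0" by (rule dual_tensor_exterior_ideal)
  then show "dual_tensor x = dual_tensor y"
    using dual_tensor_add[of "x - y" y] by simp
qed

lemma polygon_alg_induct [case_names add scale one mult]:
  assumes "\<And>x y. P x \<Longrightarrow> P y \<Longrightarrow> P (x + y)" "\<And>c x. P x \<Longrightarrow> P (polygon_scale c x)" "P 1"
    "\<And>\<pi> x. P x \<Longrightarrow> P (polygon_gen \<pi> * x)"
  shows "P x"
proof (induction x rule: polygon_alg.abs_induct)
  case (1 x)
  show ?case
  proof (induction x rule: tensor_induct)
    case (add x y)
    then show ?case using assms(1) by (simp flip: plus_polygon_alg.abs_eq)
  next
    case (smul c x)
    then show ?case using assms(2) by (simp flip: polygon_scale.abs_eq)
  next
    case (word ps)
    show ?case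
    proof (induction ps)
      case Nil
      then show ?case using assms(3) by (simp add: word_Nil one_polygon_alg.abs_eq)
    next
      case (Cons \<pi> ps)
      then show ?case
        using assms(4)[of "abs_polygon_alg (word ps)" \<pi>] word_append[of "[\<pi>]" ps]
        by (simp add: polygon_gen.abs_eq times_polygon_alg.abs_eq)
    qed
  qed
qed

lemma dual_add: "dual (x + y) = dual x + dual y"
  and dual_mult: "dual (x * y) = dual x * dual y"
  and dual_scale: "dual (polygon_scale c x) = plane_tree_scale c (dual x)"
  by (induction x rule: polygon_alg.abs_induct; induction y rule: polygon_alg.abs_induct;
      simp add: plus_polygon_alg.abs_eq times_polygon_alg.abs_eq polygon_scale.abs_eq dual.abs_eq
        dual_tensor_add dual_tensor_mult dual_tensor_smul)+

lemma dual_1: "dual 1 = 1"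
  by (simp add: one_polygon_alg.abs_eq dual.abs_eq dual_tensor_word flip: word_Nil)

lemma dual_gen: "dual (polygon_gen \<pi>) = polygon_sum \<pi>"
  by (simp add: polygon_gen.abs_eq dual.abs_eq dual_tensor_word)

lemma dual_alg_hom: "alg_hom polygon_dga plane_tree_dga dual"
proof -
  have "Vector_Spaces.linear polygon_scale plane_tree_scale dual"
    by unfold_locales (simp_all add: dual_add dual_scale)
  then show ?thesis
    by (simp add: alg_hom_def polygon_dga_def plane_tree_dga_def dual_1 dual_mult)
qed

lemma alg_homD:
  assumes "alg_hom A B f"
  shows "f (x + y) = f x + f y" "f (scalar A c x) = scalar B c (f x)" "f (x * y) = f x * f y" "f 1 = 1"
proof -
  interpret Vector_Spaces.linear "scalar A" "scalar B" f
    using assms by (simp add: alg_hom_def)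
  show "f (x + y) = f x + f y" "f (scalar A c x) = scalar B c (f x)"
    by (rule add, rule scale)
  show "f (x * y) = f x * f y" "f 1 = 1"
    using assms by (simp_all add: alg_hom_def)
qed

lemma alg_hom_dual_unique:
  assumes "alg_hom polygon_dga plane_tree_dga \<Psi>" "\<And>\<pi>. \<Psi> (polygon_gen \<pi>) = polygon_sum \<pi>"
  shows "\<Psi> = dual"
proof
  fix x
  note [simp] = alg_homD[OF assms(1), unfolded polygon_dga_def plane_tree_dga_def dga.simps]
  show "\<Psi> x = dual x"
    by (induction x rule: polygon_alg_induct)
      (simp_all add: dual_add dual_scale dual_1 dual_mult dual_gen assms(2))
qed

subsection \<open>Compatibility with the differentials\<close>

lemma plane_tree_diff_scale: "plane_tree_diff (plane_tree_scale c x) = plane_tree_scale c (plane_tree_diff x)"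
  by transfer (simp add: linext_smul rel.zero)

lemma plane_tree_diff_1 [simp]: "plane_tree_diff 1 = 0"
proof -
  have "boundary (0 :: 'a oforest) = 0" by (simp add: boundary_def contractible_def)
  then show ?thesis by transfer (simp add: rel.zero flip: single_one)
qed

lemma plane_tree_alg_induct [case_names add scale gen]:
  assumes "\<And>x y. P x \<Longrightarrow> P y \<Longrightarrow> P (x + y)" "\<And>c x. P x \<Longrightarrow> P (plane_tree_scale c x)" "\<And>y. P (plane_class y)"
  shows "P x"
proof (induction x rule: plane_tree_alg.abs_induct)
  case (1 x)
  show ?case
  proof (induction x rule: free_induct)
    case zero
    show ?case using assms(2)[OF assms(3), of 0] by (simp add: zero_plane_tree_alg.abs_eq)
  next
    case (add x y)
    then show ?case using assms(1) by (simp flip: plus_plane_tree_alg.abs_eq)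
  next
    case (single b c)
    show ?case using assms(2)[OF assms(3)] by (simp only: abs_plane_tree_alg_single)
  qed
qed

text \<open>The Leibniz sign for trees counts edges, the one for polygons counts factors. They agree
  since \<open>gen r t\<close> has an odd number of edges.\<close>

lemma plane_tree_diff_gen_mult:
  "plane_tree_diff (gen r t * y) = plane_tree_diff (gen r t) * y - gen r t * plane_tree_diff y"
proof (induction y rule: plane_tree_alg_induct)
  case (gen y)
  show ?case
    using plane_tree_diff_Leibniz[of "trivalent r t" y] by (simp add: gen_def)
next
  case (scale c x)
  then show ?case
    by (simp add: plane_tree_diff_scale plane_tree_scale_mult plane_tree_alg.scale_right_diff_distrib)
qed (simp add: algebra_simps plane_tree_diff_add)

lemma plane_tree_diff_polygon_sum_mult:
  "plane_tree_diff (polygon_sum \<pi> * y) = plane_tree_diff (polygon_sum \<pi>) * y - polygon_sum \<pi> * plane_tree_diff y"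
  by (simp add: polygon_sum_def tree_sum_def sum_distrib_right plane_tree_diff_sum plane_tree_diff_gen_mult
      sum_subtractf)

lemma polygon_diff_linear:
  "polygon_diff (x + y) = polygon_diff x + polygon_diff y"
  "polygon_diff (polygon_scale c x) = polygon_scale c (polygon_diff x)"
  "polygon_diff_bar (x + y) = polygon_diff_bar x + polygon_diff_bar y"
  "polygon_diff_bar (polygon_scale c x) = polygon_scale c (polygon_diff_bar x)"
  by (transfer; simp add: leibniz_def linext_add linext_smul ext.zero)+

lemma dual_tensor_sum_distrib: "dual_tensor (sum f A) = (\<Sum>a\<in>A. dual_tensor (f a))"
proof (induction A rule: infinite_finite_induct)
  have "dual_tensor 0 = 0" using dual_tensor_smul[of 0 0] by simp
  then show "dual_tensor (sum f {}) = (\<Sum>a\<in>{}. dual_tensor (f a))"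
    "infinite A \<Longrightarrow> dual_tensor (sum f A) = (\<Sum>a\<in>A. dual_tensor (f a))" for A by simp_all
qed (simp add: dual_tensor_add)

lemma dual_diff_gen:
  "dual (polygon_diff (polygon_gen \<pi>)) = (\<Sum>\<alpha>\<in>arrows \<pi>.
     plane_tree_scale (arrow_sign \<alpha> ^ weight (cutoff_polygon \<pi> \<alpha>))
       (polygon_sum (root_polygon \<pi> \<alpha>) * polygon_sum (cutoff_polygon \<pi> \<alpha>)))"
  "dual (polygon_diff_bar (polygon_gen \<pi>)) = (\<Sum>\<alpha>\<in>arrows \<pi>.
     plane_tree_scale (arrow_sign \<alpha>) (polygon_sum (root_polygon \<pi> \<alpha>) * polygon_sum (cutoff_polygon_bar \<pi> \<alpha>)))"
  by (simp_all add: polygon_gen.abs_eq polygon_diff.abs_eq polygon_diff_bar.abs_eq dual.abs_eq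
      leibniz_word_single word_Nil dissect_def dissect_bar_def dual_tensor_sum_distrib dual_tensor_smul
      dual_tensor_mult dual_tensor_word)

lemma dual_minus: "dual (x - y) = dual x - dual y"
  using dual_add[of "x - y" y] by (simp add: algebra_simps)

lemma dual_0 [simp]: "dual 0 = 0"
  using dual_minus[of 0 0] by simp

lemma dual_diff_bar: "dual (polygon_diff_bar x) = plane_tree_diff (dual x)"
proof (induction x rule: polygon_alg_induct)
  case (mult \<pi> x)
  then show ?case
    by (simp add: polygon_diff_Leibniz dual_minus dual_mult dual_gen plane_tree_diff_polygon_sum_mult
        dual_diff_gen(2) flip: plane_tree_diff_polygon_sum)
qed (simp_all add: polygon_diff_linear dual_add dual_scale plane_tree_diff_add plane_tree_diff_scale
    polygon_diff_Leibniz dual_1)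

subsection \<open>Compatibility with the gradings\<close>

lemma plane_tree_piece_add:
  "x \<in> plane_tree_piece m \<Longrightarrow> y \<in> plane_tree_piece m \<Longrightarrow> x + y \<in> plane_tree_piece m"
proof -
  assume "x \<in> plane_tree_piece m" "y \<in> plane_tree_piece m"
  then obtain u v where uv: "x = abs_plane_tree_alg u" "y = abs_plane_tree_alg v"
      "\<forall>k\<in>Poly_Mapping.keys u. length (orient k) = m" "\<forall>k\<in>Poly_Mapping.keys v. length (orient k) = m"
    by (auto simp: plane_tree_piece_def)
  have "\<forall>k\<in>Poly_Mapping.keys (u + v). length (orient k) = m"
    using uv(3,4) keys_add[of u v] by blast
  then show ?thesis
    by (auto simp: plane_tree_piece_def uv plus_plane_tree_alg.abs_eq)
qed

lemma plane_tree_piece_scale: "x \<in> plane_tree_piece m \<Longrightarrow> plane_tree_scale c x \<in> plane_tree_piece m"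
  by (force simp: plane_tree_piece_def plane_tree_scale.abs_eq in_keys_iff lookup_smul)

lemma plane_tree_piece_0 [simp]: "0 \<in> plane_tree_piece m"
  by (force simp: plane_tree_piece_def zero_plane_tree_alg.abs_eq)

lemma plane_tree_piece_sum:
  "(\<And>a. a \<in> A \<Longrightarrow> f a \<in> plane_tree_piece m) \<Longrightarrow> sum f A \<in> plane_tree_piece m"
  by (induction A rule: infinite_finite_induct) (auto intro: plane_tree_piece_add)

lemma plane_tree_piece_mult:
  "x \<in> plane_tree_piece m \<Longrightarrow> y \<in> plane_tree_piece n \<Longrightarrow> x * y \<in> plane_tree_piece (m + n)"
proof -
  assume "x \<in> plane_tree_piece m" "y \<in> plane_tree_piece n"
  then obtain u v where uv: "x = abs_plane_tree_alg u" "y = abs_plane_tree_alg v"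
      "\<forall>k\<in>Poly_Mapping.keys u. length (orient k) = m" "\<forall>k\<in>Poly_Mapping.keys v. length (orient k) = n"
    by (auto simp: plane_tree_piece_def)
  have "\<forall>k\<in>Poly_Mapping.keys (u * v). length (orient k) = m + n"
    using uv(3,4) keys_mult[of u v] by (fastforce simp: orient_plus)
  then show ?thesis
    by (auto simp: plane_tree_piece_def uv times_plane_tree_alg.abs_eq)
qed

lemma plane_tree_piece_class: "plane_class x \<in> plane_tree_piece (length (orient x))"
  by (force simp: plane_tree_piece_def plane_class.abs_eq)

lemma polygon_sum_piece: "polygon_sum \<pi> \<in> plane_tree_piece (2 * weight \<pi> - 1)"
  unfolding polygon_sum_def tree_sum_def
proof (rule plane_tree_piece_sum)
  fix t assume "t \<in> {t. leaves t = butlast (sides \<pi>)}"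
  then have "edge_count t = 2 * weight \<pi> - 1"
    using edge_count_leaves[of t] by (simp add: weight_def)
  then show "gen (last (sides \<pi>)) t \<in> plane_tree_piece (2 * weight \<pi> - 1)"
    using plane_tree_piece_class[of "trivalent (last (sides \<pi>)) t"] by (simp add: gen_def)
qed

lemma dual_piece: "dual ` polygon_piece m \<subseteq> plane_tree_piece m"
proof -
  have "prod_list (map polygon_sum ps) \<in> plane_tree_piece (word_degree (Word ps))" for ps :: "'a polygon list"
  proof (induction ps)
    case Nil
    have "plane_class (0 :: 'a oforest) = 1" by (simp add: plane_class.abs_eq one_plane_tree_alg.abs_eq)
    then show ?case using plane_tree_piece_class[of "0 :: 'a oforest"] by (simp add: word_degree_def)
  next
    case (Cons \<pi> ps)
    then show ?case
      using plane_tree_piece_mult[OF polygon_sum_piece[of \<pi>] Cons] by (simp add: word_degree_def)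
  qed
  then have "prod_list (map polygon_sum (letters w)) \<in> plane_tree_piece (word_degree w)" for w :: "'a word"
    by (metis word.collapse)
  then have "prod_list (map polygon_sum (letters w)) \<in> plane_tree_piece m" if "word_degree w = m" for w :: "'a word"
    using that by blast
  then show ?thesis
    by (auto simp: polygon_piece_def dual.abs_eq dual_tensor_sum intro!: plane_tree_piece_sum plane_tree_piece_scale)
qed

subsection \<open>Reversal of the cyclic orders\<close>

primrec mirror :: "'r btree \<Rightarrow> 'r btree" where
  "mirror (Tip r) = Tip r"
| "mirror (Fork x y) = Fork (mirror y) (mirror x)"

lemma leaves_mirror [simp]: "leaves (mirror t) = rev (leaves t)"
  by (induction t) auto

lemma mirror_mirror [simp]: "mirror (mirror t) = t"
  by (induction t) auto

text \<open>The mirror image with the names of \<open>numbered\<close> kept, so that it differs from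
  the original only in its cyclic orders. Its edges are then no longer numbered in canonical
  order.\<close>

primrec mirror_numbered :: "nat \<Rightarrow> 'r btree \<Rightarrow> 'r branch" where
  "mirror_numbered n (Tip r) = Leaf n r"
| "mirror_numbered n (Fork x y) =
     Node n [mirror_numbered (Suc n + edge_count x) y, mirror_numbered (Suc n) x]"

lemma replane_mirror: "replane (numbered n t) (mirror_numbered n t)"
proof (induction t arbitrary: n)
  case (Fork x y)
  have "list_all2 replane [numbered (Suc n) x, numbered (Suc n + edge_count x) y]
      [mirror_numbered (Suc n) x, mirror_numbered (Suc n + edge_count x) y]"
    using Fork by simp
  then show ?case
    unfolding numbered.simps mirror_numbered.simps by (rule replane_Node) (simp add: add_mset_commute)
qed (simp add: replane_Leaf)

lemma shape_mirror_numbered [simp]: "shape (mirror_numbered n t) = unnumbered (mirror t)"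
  by (induction t arbitrary: n) auto

lemma wf_branch_mirror_numbered [simp]: "wf_branch (mirror_numbered n t)"
  by (induction t arbitrary: n) auto

lemma mset_mirror_numbered: "mset (branch_edges (mirror_numbered n t)) = mset (branch_edges (numbered n t))"
  by (rule replane_edges[OF replane_mirror, symmetric])

text \<open>The forest \<open>F\<close> is fixed and only the orientation is rewritten;
  \<open>u\<close> and \<open>w\<close> allow the induction hypotheses to act on a block inside a
  longer list.\<close>

lemma sim_mirror:
  assumes "valid F (u @ branch_edges (numbered n t) @ w)"
  shows "sim p ((- 1) ^ (length (leaves t) - 1)) (OForest (F, u @ branch_edges (numbered n t) @ w))
    (OForest (F, u @ branch_edges (mirror_numbered n t) @ w))"
  using assms
proof (induction t arbitrary: n u w)
  case (Fork x y)
  let ?x = "branch_edges (numbered (Suc n) x)" and ?y = "branch_edges (numbered (Suc n + edge_count x) y)"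
  let ?x' = "branch_edges (mirror_numbered (Suc n) x)" and ?y' = "branch_edges (mirror_numbered (Suc n + edge_count x) y)"
  let ?u = "u @ [n]"
  have v: "valid F (?u @ ?x @ ?y @ w)"
    using Fork.prems by (simp only: numbered.simps branch_edges.simps list.map concat.simps) simp
  then have v': "valid F ((?u @ ?x') @ ?y @ w)"
    by (rule valid_reorder) (simp add: mset_mirror_numbered)
  then have v'': "valid F (?u @ ?x' @ ?y' @ w)"
    by (rule valid_reorder) (simp add: mset_mirror_numbered)
  have 1: "sim p ((- 1) ^ (length (leaves x) - 1)) (OForest (F, ?u @ ?x @ ?y @ w)) (OForest (F, ?u @ ?x' @ ?y @ w))"
    using v by (rule Fork.IH(1))
  have 2: "sim p ((- 1) ^ (length (leaves y) - 1)) (OForest (F, ?u @ ?x' @ ?y @ w)) (OForest (F, ?u @ ?x' @ ?y' @ w))"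
    using Fork.IH(2)[OF v'] by simp
  have "length ?x' = length ?x" "length ?y' = length ?y"
    using mset_mirror_numbered by (metis size_mset)+
  then have 3: "sim p (- 1) (OForest (F, ?u @ ?x' @ ?y' @ w)) (OForest (F, ?u @ ?y' @ ?x' @ w))"
    using sim_blocks[OF v''] by simp
  have "Suc (length (leaves x) - 1 + (length (leaves y) - 1)) = length (leaves (Fork x y)) - 1"
    using leaves_length_pos[of x] leaves_length_pos[of y] by simp
  moreover have "(- 1) ^ (length (leaves x) - 1) * ((- 1) ^ (length (leaves y) - 1) * - 1) =
      (- 1 :: rat) ^ Suc (length (leaves x) - 1 + (length (leaves y) - 1))"
    by (simp add: power_add)
  ultimately show ?case
    using sim_trans[OF 1 sim_trans[OF 2 3]]
    by (simp only: numbered.simps mirror_numbered.simps branch_edges.simps list.map concat.simps) simp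
qed (simp add: sim_refl)

lemma tree_class_sim: "sim False c x y \<Longrightarrow> tree_class x = tree_scale c (tree_class y)"
  unfolding sim_def by transfer

lemma forget_plane_class: "forget_plane (plane_class x) = tree_class x"
  by (simp add: forget_plane.abs_eq plane_class.abs_eq tree_class.abs_eq)

text \<open>Without cyclic orders the tree may be replaced by its mirror image under the old
  orientation at no cost; the sign arises when this orientation is made canonical for the mirror
  image.\<close>

lemma forget_plane_gen_mirror:
  "forget_plane (gen r t) = tree_scale ((- 1) ^ (length (leaves t) - 1)) (forget_plane (gen r (mirror t)))"
proof -
  let ?b = "numbered 0 t" and ?b' = "mirror_numbered 0 t"
  let ?F = "{#Planted r ?b'#}"
  have mset: "mset (branch_edges ?b') = mset (branch_edges ?b)"
    by (rule mset_mirror_numbered)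
  have wf: "wf_branch ?b'" "distinct (branch_edges ?b')"
    using mset_eq_imp_distinct_iff[OF mset] by simp_all
  have v: "valid ?F (branch_edges ?b)"
    by (rule valid_reorder[OF valid_tree[OF wf] mset])
  have "rel_mset replane_tree {#Planted r ?b#} ?F"
    by (intro rel_mset_Plus rel_mset_Zero replane_tree.intros replane_mirror)
  then have "sim False 1 (trivalent r t) (OForest (?F, branch_edges ?b))"
    using v unfolding sim_def by (simp add: rel_replane forest_OForest orient_OForest)
  moreover have "sim False ((- 1) ^ (length (leaves t) - 1)) (OForest (?F, branch_edges ?b)) (canonically_oriented (Planted r ?b'))"
    using sim_mirror[of ?F "[]" 0 t "[]"] v by (simp add: canonically_oriented_def)
  ultimately have "tree_class (trivalent r t) =
      tree_scale (1 * (- 1) ^ (length (leaves t) - 1)) (tree_class (canonically_oriented (Planted r ?b')))"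
    by (intro tree_class_sim) (rule sim_trans)
  moreover have "plane_class (canonically_oriented (Planted r ?b')) = gen r (mirror t)"
    by (rule gen_eqI[OF wf]) simp
  ultimately show ?thesis
    by (metis forget_plane_class gen_def mult_1)
qed

lemma forget_plane_alg_hom:
  "forget_plane (x + y) = forget_plane x + forget_plane y"
  "forget_plane (plane_tree_scale c x) = tree_scale c (forget_plane x)"
  "forget_plane (x * y) = forget_plane x * forget_plane y"
  "forget_plane (1 :: 'a plane_tree_alg) = 1"
  for x y :: "'a plane_tree_alg"
proof -
  have "alg_hom plane_tree_dga tree_dga (forget_plane :: 'a plane_tree_alg \<Rightarrow> _)"
    using forget_plane_dga_hom unfolding dga_hom_def by blast
  note * = alg_homD[OF this, unfolded plane_tree_dga_def tree_dga_def dga.simps]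
  show "forget_plane (x + y) = forget_plane x + forget_plane y"
    "forget_plane (plane_tree_scale c x) = tree_scale c (forget_plane x)"
    "forget_plane (x * y) = forget_plane x * forget_plane y"
    "forget_plane (1 :: 'a plane_tree_alg) = 1"
    by (fact *)+
qed

lemma forget_plane_diff: "forget_plane (plane_tree_diff x) = tree_diff (forget_plane x)"
  for x :: "'a plane_tree_alg"
  using forget_plane_dga_hom[where 'a = 'a] by (simp add: dga_hom_def plane_tree_dga_def tree_dga_def)

lemma forget_plane_0 [simp]: "forget_plane 0 = 0"
  using forget_plane_alg_hom(1)[of 0 0] by simp

lemma forget_plane_minus: "forget_plane (x - y) = forget_plane x - forget_plane y"
  using forget_plane_alg_hom(1)[of "x - y" y] by (simp add: algebra_simps)

lemma forget_plane_sum: "forget_plane (sum f A) = (\<Sum>a\<in>A. forget_plane (f a))"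
  by (induction A rule: infinite_finite_induct) (simp_all add: forget_plane_alg_hom)

lemma forget_plane_tree_sum_rev:
  "forget_plane (tree_sum r (rev as)) = tree_scale ((- 1) ^ (length as - 1)) (forget_plane (tree_sum r as))"
proof -
  have "bij_betw mirror {t. leaves t = as} {t. leaves t = rev as}"
    by (rule bij_betw_byWitness[where f' = mirror]) auto
  then have "(\<Sum>t | leaves t = rev as. forget_plane (gen r t)) = (\<Sum>t | leaves t = as. forget_plane (gen r (mirror t)))"
    by (rule sum.reindex_bij_betw[symmetric])
  also have "\<dots> = (\<Sum>t | leaves t = as. tree_scale ((- 1) ^ (length as - 1)) (forget_plane (gen r t)))"
  proof (rule sum.cong[OF refl])
    fix t assume "t \<in> {t. leaves t = as}"
    then show "forget_plane (gen r (mirror t)) = tree_scale ((- 1) ^ (length as - 1)) (forget_plane (gen r t))"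
      using forget_plane_gen_mirror[of r "mirror t"] by simp
  qed
  finally show ?thesis
    by (simp add: tree_sum_def forget_plane_sum tree_alg.scale_sum_right)
qed

text \<open>
  Reversing the \<open>m\<close> non-root sides of a cut-off polygon changes the sign by \<open>(- 1)\<^bsup>m - 1\<^esup>\<close>. This
  accounts for the difference between the signs in the two differentials.
\<close>

lemma forget_plane_dissect:
  assumes "\<alpha> \<in> arrows \<pi>"
  shows "tree_scale (arrow_sign \<alpha> ^ weight (cutoff_polygon \<pi> \<alpha>)) (forget_plane (polygon_sum (cutoff_polygon \<pi> \<alpha>))) =
    tree_scale (arrow_sign \<alpha>) (forget_plane (polygon_sum (cutoff_polygon_bar \<pi> \<alpha>)))"
proof (cases "forward \<alpha>")
  case True
  then show ?thesis
    by (cases \<alpha>) (simp add: arrow_sign_def cutoff_polygon_def cutoff_polygon_bar_def)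
next
  case False
  obtain k l where \<alpha>: "\<alpha> = (k, l)" by (cases \<alpha>)
  have kl: "l < k" "k \<le> weight \<pi>"
    using assms False by (auto simp: \<alpha> arrows_def forward_def)
  define vs where "vs = drop l (take k (sides \<pi>))"
  define s where "s = sides \<pi> ! (l - 1)"
  have "length vs = k - l" using kl by (simp add: vs_def weight_def)
  then have vs: "vs \<noteq> []" using kl by auto
  have co: "cutoff_polygon \<pi> \<alpha> = Polygon (rev vs @ [s])" "cutoff_polygon_bar \<pi> \<alpha> = Polygon (vs @ [s])"
    using False by (simp_all add: \<alpha> cutoff_polygon_def cutoff_polygon_bar_def vs_def s_def)
  have "weight (cutoff_polygon \<pi> \<alpha>) = length vs"
    using vs Polygon_inverse[of "rev vs @ [s]"] by (cases vs) (auto simp: co weight_def)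
  moreover have "(- 1 :: rat) ^ length vs * (- 1) ^ (length vs - 1) = - 1"
    using vs by (cases vs) (auto simp flip: power_mult_distrib)
  ultimately show ?thesis
    using False vs by (simp add: co polygon_sum_Polygon forget_plane_tree_sum_rev arrow_sign_def)
qed

lemma tree_scale_mult: "x * tree_scale c y = tree_scale c (x * y)"
  by transfer (simp add: smul_mult_right rel.zero)

lemma forget_plane_dual_diff_gen:
  "forget_plane (dual (polygon_diff (polygon_gen \<pi>))) = forget_plane (dual (polygon_diff_bar (polygon_gen \<pi>)))"
  unfolding dual_diff_gen forget_plane_sum
  by (rule sum.cong) (simp_all add: forget_plane_alg_hom forget_plane_dissect flip: tree_scale_mult)

text \<open>Both sides obey the same Leibniz rule, so it suffices that the two polygon differentials
  of a generator have the same image after \<open>forget_plane\<close>.\<close>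

lemma forget_plane_dual_diff: "forget_plane (dual (polygon_diff x)) = tree_diff (forget_plane (dual x))"
  unfolding forget_plane_diff[symmetric]
proof (induction x rule: polygon_alg_induct)
  case (mult \<pi> x)
  have "forget_plane (dual (polygon_diff (polygon_gen \<pi>))) = forget_plane (plane_tree_diff (polygon_sum \<pi>))"
    by (simp only: forget_plane_dual_diff_gen dual_diff_bar dual_gen)
  with mult show ?case
    by (simp add: polygon_diff_Leibniz dual_minus dual_mult dual_gen plane_tree_diff_polygon_sum_mult
        forget_plane_alg_hom forget_plane_minus)
qed (simp_all add: polygon_diff_linear dual_add dual_scale plane_tree_diff_add plane_tree_diff_scale
    polygon_diff_Leibniz dual_1 forget_plane_alg_hom)

theorem theorem5p19:
  shows "\<exists>\<Phi> :: 'r polygon_alg \<Rightarrow> 'r plane_tree_alg.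
    (alg_hom polygon_dga plane_tree_dga \<Phi> \<and> (\<forall>\<pi>. \<Phi> (polygon_gen \<pi>) = triangulation_sum \<pi>)) \<and>
    (\<forall>\<Psi>. alg_hom polygon_dga plane_tree_dga \<Psi> \<and> (\<forall>\<pi>. \<Psi> (polygon_gen \<pi>) = triangulation_sum \<pi>) \<longrightarrow>
      \<Psi> = \<Phi>) \<and>
    dga_hom polygon_dga_bar plane_tree_dga \<Phi> \<and>
    dga_hom polygon_dga_bar tree_dga (forget_plane \<circ> \<Phi>) \<and>
    dga_hom polygon_dga tree_dga (forget_plane \<circ> \<Phi>)"
proof (intro exI[of _ dual] conjI allI impI)
  let ?\<Phi> = "dual :: 'r polygon_alg \<Rightarrow> 'r plane_tree_alg"
  show "alg_hom polygon_dga plane_tree_dga ?\<Phi>" by (rule dual_alg_hom)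
  show "?\<Phi> (polygon_gen \<pi>) = triangulation_sum \<pi>" for \<pi> :: "'r polygon"
    by (simp add: dual_gen triangulation_sum_eq)
  show "\<Psi> = ?\<Phi>" if "alg_hom polygon_dga plane_tree_dga \<Psi> \<and> (\<forall>\<pi>. \<Psi> (polygon_gen \<pi>) = triangulation_sum \<pi>)"
    for \<Psi> :: "'r polygon_alg \<Rightarrow> 'r plane_tree_alg"
    using that by (intro alg_hom_dual_unique) (simp_all add: triangulation_sum_eq)
  have "alg_hom polygon_dga_bar plane_tree_dga ?\<Phi>"
    using dual_alg_hom by (simp add: alg_hom_def polygon_dga_def polygon_dga_bar_def)
  then show bar: "dga_hom polygon_dga_bar plane_tree_dga ?\<Phi>"
    using dual_piece[where 'a = 'r] dual_diff_bar[where 'a = 'r] by (simp add: dga_hom_def polygon_dga_bar_def plane_tree_dga_def)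
  have hom: "alg_hom A tree_dga (forget_plane \<circ> ?\<Phi>)"
    if "alg_hom A plane_tree_dga ?\<Phi>" for A :: "'r polygon_alg dga"
    using that forget_plane_dga_hom[where 'a = 'r] unfolding dga_hom_def alg_hom_def
    by (auto intro: Vector_Spaces.linear_compose)
  have piece: "(forget_plane \<circ> ?\<Phi>) ` polygon_piece m \<subseteq> tree_piece m" for m
    using dual_piece[of m, where 'a = 'r] forget_plane_dga_hom[where 'a = 'r]
    by (fastforce simp: dga_hom_def plane_tree_dga_def tree_dga_def)
  show "dga_hom polygon_dga_bar tree_dga (forget_plane \<circ> ?\<Phi>)"
    using hom[of polygon_dga_bar] bar piece
    by (simp add: dga_hom_def polygon_dga_bar_def plane_tree_dga_def tree_dga_def dual_diff_bar forget_plane_diff)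
  show "dga_hom polygon_dga tree_dga (forget_plane \<circ> ?\<Phi>)"
    using hom[OF dual_alg_hom] piece
    by (simp add: dga_hom_def polygon_dga_def plane_tree_dga_def tree_dga_def forget_plane_dual_diff)
qed

end
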